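(* Let $Y_1$ and $Y_2$ be compact orientable $3$-manifolds with torus boundary, let $\varphi\colon\partial Y_1\to\partial Y_2$ be a diffeomorphism, and let $Y=Y_1\cup_\varphi Y_2$. Let $\lambda_{Y_1}$ and $\lambda_{Y_2}$ be the rational longitudes of $Y_1$ and $Y_2$, regarded as slopes on the common torus $\partial Y_1=\partial Y_2\subset Y$. If $Y$ is $SU(2)$-abelian, then the Dehn fillings $Y_1(\lambda_{Y_2})$ and $Y_2(\lambda_{Y_1})$ are $SU(2)$-abelian.
   Context: A $3$-manifold is $SU(2)$-abelian if every homomorphism from its fundamental group to $SU(2)$ has abelian image. The rational longitude of a compact orientable $3$-manifold $Y$ with torus boundary is the simple closed curve $\lambda_Y\subset\partial Y$, unique up to isotopy, whose class is torsion in $H_1(Y;\mathbb{Z})$. For a slope $\gamma$ on $\partial Y_i$, $Y_i(\gamma)$ denotes the Dehn filling of $Y_i$ along $\gamma$; slopes are transported between $\partial Y_1$ and $\partial Y_2$ by $\varphi$. *)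

theory Defs
  imports "HOL-Analysis.Analysis" "HOL-Homology.Homology"
begin

section \<open>Smooth 3-manifolds with boundary\<close>

text \<open>\<open>Ck_on k V g\<close> is meant for open \<open>V\<close>: all directional derivatives of \<open>g\<close> up to order \<open>k\<close>
  exist (as Frechet derivatives) and are continuous. Smoothness on an arbitrary subset means local
  extendability to smooth maps on open sets.\<close>

primrec Ck_on ::
  "nat \<Rightarrow> 'a::euclidean_space set \<Rightarrow> ('a \<Rightarrow> 'b::euclidean_space) \<Rightarrow> bool" where
  "Ck_on 0 V g \<longleftrightarrow> continuous_on V g"
| "Ck_on (Suc k) V g \<longleftrightarrow>
     (\<exists>g'. (\<forall>x\<in>V. (g has_derivative g' x) (at x)) \<and> (\<forall>v. Ck_on k V (\<lambda>x. g' x v)))"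

definition smooth_on :: "'a::euclidean_space set \<Rightarrow> ('a \<Rightarrow> 'b::euclidean_space) \<Rightarrow> bool" where
  "smooth_on S f \<longleftrightarrow>
     (\<forall>x\<in>S. \<exists>V g. open V \<and> x \<in> V \<and> (\<forall>k. Ck_on k V g) \<and> (\<forall>y\<in>S \<inter> V. g y = f y))"

type_synonym 'a chart = "'a set \<times> ('a \<Rightarrow> real ^ 3)"

definition half_space3 :: "(real ^ 3) set" where
  "half_space3 = {x. 0 \<le> x $ 1}"

definition is_chart :: "'a topology \<Rightarrow> 'a chart \<Rightarrow> bool" where
  "is_chart X = (\<lambda>(U, c).
     openin X U \<and> openin (top_of_set half_space3) (c ` U) \<and>
     homeomorphic_map (subtopology X U) (top_of_set (c ` U)) c)"

definition smooth_atlas :: "'a topology \<Rightarrow> 'a chart set \<Rightarrow> bool" where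
  "smooth_atlas X A \<longleftrightarrow>
     (\<forall>C\<in>A. is_chart X C) \<and> (\<Union>(fst ` A)) = topspace X \<and>
     (\<forall>(U, c)\<in>A. \<forall>(V, d)\<in>A. smooth_on (c ` (U \<inter> V)) (d \<circ> inv_into U c))"

definition mfd_boundary :: "'a topology \<Rightarrow> 'a chart set \<Rightarrow> 'a set" where
  "mfd_boundary X A = {x \<in> topspace X. \<exists>(U, c)\<in>A. x \<in> U \<and> c x $ 1 = 0}"

text \<open>Positivity of the Jacobian determinants is only required at points with positive first
  coordinate; by continuity it then also holds at boundary points.\<close>

definition oriented_atlas :: "'a chart set \<Rightarrow> bool" where
  "oriented_atlas B \<longleftrightarrow>
     (\<forall>(U, c)\<in>B. \<forall>(V, d)\<in>B. \<forall>x\<in>U \<inter> V. 0 < c x $ 1 \<longrightarrow>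
        (\<exists>D. ((d \<circ> inv_into U c) has_derivative D) (at (c x)) \<and> 0 < det (matrix D)))"

definition smooth_orientable :: "'a topology \<Rightarrow> 'a chart set \<Rightarrow> bool" where
  "smooth_orientable X A \<longleftrightarrow>
     (\<exists>B. smooth_atlas X B \<and> smooth_atlas X (A \<union> B) \<and> oriented_atlas B)"

text \<open>Second countability is automatic for compact spaces covered by charts.\<close>

definition compact_orientable_3manifold :: "'a topology \<Rightarrow> 'a chart set \<Rightarrow> bool" where
  "compact_orientable_3manifold X A \<longleftrightarrow>
     compact_space X \<and> Hausdorff_space X \<and> smooth_atlas X A \<and> smooth_orientable X A"

abbreviation circle :: "complex set" where
  "circle \<equiv> sphere 0 1"

definition boundary_torus :: "'a topology \<Rightarrow> 'a chart set \<Rightarrow> 'a topology" where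
  "boundary_torus X A = subtopology X (mfd_boundary X A)"

definition torus_boundary :: "'a topology \<Rightarrow> 'a chart set \<Rightarrow> bool" where
  "torus_boundary X A \<longleftrightarrow> boundary_torus X A homeomorphic_space top_of_set (circle \<times> circle)"

definition smooth_between ::
  "'a chart set \<Rightarrow> 'a set \<Rightarrow> 'b chart set \<Rightarrow> ('a \<Rightarrow> 'b) \<Rightarrow> bool" where
  "smooth_between A S B f \<longleftrightarrow>
     (\<forall>(U, c)\<in>A. \<forall>(V, d)\<in>B. smooth_on (c ` {x \<in> S \<inter> U. f x \<in> V}) (d \<circ> f \<circ> inv_into U c))"

definition boundary_diffeo ::
  "'a topology \<Rightarrow> 'a chart set \<Rightarrow> 'b topology \<Rightarrow> 'b chart set \<Rightarrow> ('a \<Rightarrow> 'b) \<Rightarrow> bool" where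
  "boundary_diffeo X A Z B f \<longleftrightarrow>
     homeomorphic_map (boundary_torus X A) (boundary_torus Z B) f \<and>
     smooth_between A (mfd_boundary X A) B f \<and>
     smooth_between B (mfd_boundary Z B) A (inv_into (mfd_boundary X A) f)"


section \<open>Gluing\<close>

text \<open>\<open>glue X S f Z\<close> is the quotient of the disjoint union of \<open>X\<close> and \<open>Z\<close> that identifies \<open>x\<close> with
  \<open>f x\<close> for \<open>x \<in> S\<close>; it is intended for \<open>f\<close> injective on \<open>S\<close>, so that \<open>glue_class\<close> yields the
  equivalence classes.\<close>

definition glue_class :: "'a set \<Rightarrow> ('a \<Rightarrow> 'b) \<Rightarrow> 'a + 'b \<Rightarrow> ('a + 'b) set" where
  "glue_class S f z = (case z of
      Inl x \<Rightarrow> insert (Inl x) (if x \<in> S then {Inr (f x)} else {})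
    | Inr y \<Rightarrow> insert (Inr y) (Inl ` {x \<in> S. f x = y}))"

definition glue_open ::
  "'a topology \<Rightarrow> 'a set \<Rightarrow> ('a \<Rightarrow> 'b) \<Rightarrow> 'b topology \<Rightarrow> ('a + 'b) set set \<Rightarrow> bool" where
  "glue_open X S f Z W \<longleftrightarrow>
     W \<subseteq> glue_class S f ` (Inl ` topspace X \<union> Inr ` topspace Z) \<and>
     openin X {x \<in> topspace X. glue_class S f (Inl x) \<in> W} \<and>
     openin Z {y \<in> topspace Z. glue_class S f (Inr y) \<in> W}"

definition glue ::
  "'a topology \<Rightarrow> 'a set \<Rightarrow> ('a \<Rightarrow> 'b) \<Rightarrow> 'b topology \<Rightarrow> ('a + 'b) set topology" where
  "glue X S f Z = topology (glue_open X S f Z)"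

lemma istopology_glue_open: "istopology (glue_open X S f Z)"
  unfolding istopology_def
proof (intro conjI allI impI)
  fix U V assume U: "glue_open X S f Z U" and V: "glue_open X S f Z V"
  have "{x \<in> topspace X. glue_class S f (Inl x) \<in> U \<inter> V} =
      {x \<in> topspace X. glue_class S f (Inl x) \<in> U} \<inter> {x \<in> topspace X. glue_class S f (Inl x) \<in> V}"
    "{x \<in> topspace Z. glue_class S f (Inr x) \<in> U \<inter> V} =
      {x \<in> topspace Z. glue_class S f (Inr x) \<in> U} \<inter> {x \<in> topspace Z. glue_class S f (Inr x) \<in> V}"
    by auto
  with U V show "glue_open X S f Z (U \<inter> V)"
    unfolding glue_open_def by (auto simp only: intro!: openin_Int)
next
  fix K assume K: "\<forall>U\<in>K. glue_open X S f Z U"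
  have "{x \<in> topspace X. glue_class S f (Inl x) \<in> \<Union>K} =
      (\<Union>U\<in>K. {x \<in> topspace X. glue_class S f (Inl x) \<in> U})"
    "{x \<in> topspace Z. glue_class S f (Inr x) \<in> \<Union>K} =
      (\<Union>U\<in>K. {x \<in> topspace Z. glue_class S f (Inr x) \<in> U})"
    by auto
  with K show "glue_open X S f Z (\<Union>K)"
    unfolding glue_open_def by (simp add: openin_clauses(3) Sup_le_iff)
qed

lemma openin_glue: "openin (glue X S f Z) = glue_open X S f Z"
  by (simp add: glue_def istopology_glue_open)

lemma topspace_glue:
  "topspace (glue X S f Z) = glue_class S f ` (Inl ` topspace X \<union> Inr ` topspace Z)" (is "_ = ?Q")
proof
  show "topspace (glue X S f Z) \<subseteq> ?Q"
    using openin_topspace[of "glue X S f Z"] unfolding openin_glue glue_open_def by blast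
  have "{x \<in> topspace X. glue_class S f (Inl x) \<in> ?Q} = topspace X"
    "{y \<in> topspace Z. glue_class S f (Inr y) \<in> ?Q} = topspace Z"
    by auto
  then have "openin (glue X S f Z) ?Q"
    unfolding openin_glue glue_open_def by simp
  then show "?Q \<subseteq> topspace (glue X S f Z)"
    by (rule openin_subset)
qed


section \<open>Fundamental groups and \<open>SU(2)\<close>\<close>

definition loops :: "'a topology \<Rightarrow> 'a \<Rightarrow> (real \<Rightarrow> 'a) set" where
  "loops X x = {p. pathin X p \<and> p 0 = x \<and> p 1 = x}"

definition loop_homotopy :: "'a topology \<Rightarrow> 'a \<Rightarrow> ((real \<Rightarrow> 'a) \<times> (real \<Rightarrow> 'a)) set" where
  "loop_homotopy X x = {(p, q). p \<in> loops X x \<and> q \<in> loops X x \<and>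
     homotopic_with (\<lambda>h. h 0 = x \<and> h 1 = x) (top_of_set {0..1}) X p q}"

text \<open>The library's \<open>joinpaths\<close> requires a topological type class, which quotient spaces lack.\<close>

definition loop_concat :: "(real \<Rightarrow> 'a) \<Rightarrow> (real \<Rightarrow> 'a) \<Rightarrow> real \<Rightarrow> 'a" where
  "loop_concat p q = (\<lambda>t. if t \<le> 1/2 then p (2 * t) else q (2 * t - 1))"

definition fundamental_group :: "'a topology \<Rightarrow> 'a \<Rightarrow> (real \<Rightarrow> 'a) set monoid" where
  "fundamental_group X x =
     \<lparr>carrier = loops X x // loop_homotopy X x,
      mult = (\<lambda>a b. \<Union>p\<in>a. \<Union>q\<in>b. loop_homotopy X x `` {loop_concat p q}),
      one = loop_homotopy X x `` {\<lambda>_. x}\<rparr>"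

definition conj_transpose :: "complex ^ 'n ^ 'm \<Rightarrow> complex ^ 'm ^ 'n" where
  "conj_transpose M = (\<chi> i j. cnj (M $ j $ i))"

definition SU2 :: "(complex ^ 2 ^ 2) monoid" where
  "SU2 = \<lparr>carrier = {M. M ** conj_transpose M = mat 1 \<and> det M = 1}, mult = (**), one = mat 1\<rparr>"

lemma conj_transpose_mult: "conj_transpose (M ** N) = conj_transpose N ** conj_transpose M"
  by (simp add: conj_transpose_def matrix_matrix_mult_def vec_eq_iff mult.commute)

lemma group_SU2: "group SU2"
proof (rule groupI)
  fix M N assume M: "M \<in> carrier SU2" and N: "N \<in> carrier SU2"
  have "M ** N ** conj_transpose (M ** N) = M ** (N ** conj_transpose N) ** conj_transpose M"
    by (simp add: conj_transpose_mult matrix_mul_assoc)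
  with M N show "M \<otimes>\<^bsub>SU2\<^esub> N \<in> carrier SU2"
    by (simp add: SU2_def det_mul)
next
  have "conj_transpose (mat 1) = (mat 1 :: complex ^ 2 ^ 2)"
    by (simp add: conj_transpose_def mat_def vec_eq_iff)
  then show "\<one>\<^bsub>SU2\<^esub> \<in> carrier SU2"
    by (simp add: SU2_def)
next
  fix M assume "M \<in> carrier SU2"
  then have M: "M ** conj_transpose M = mat 1" "det M = 1"
    by (auto simp: SU2_def)
  have 1: "conj_transpose M ** M = mat 1"
    using M(1) matrix_left_right_inverse by blast
  have 2: "conj_transpose (conj_transpose M) = M"
    by (simp add: conj_transpose_def vec_eq_iff)
  have 3: "det (conj_transpose M) = 1"
    using arg_cong[OF M(1), of det] M(2) by (simp add: det_mul)
  show "\<exists>N\<in>carrier SU2. N \<otimes>\<^bsub>SU2\<^esub> M = \<one>\<^bsub>SU2\<^esub>"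
    by (rule bexI[of _ "conj_transpose M"]) (simp_all add: SU2_def 1 2 3)
qed (auto simp: SU2_def matrix_mul_assoc)

text \<open>For path-connected \<open>X\<close> the condition is the same at every base point.\<close>

definition SU2_abelian :: "'a topology \<Rightarrow> bool" where
  "SU2_abelian X \<longleftrightarrow>
     (\<forall>x\<in>topspace X. \<forall>\<rho>\<in>hom (fundamental_group X x) SU2.
        \<forall>a\<in>carrier (fundamental_group X x). \<forall>b\<in>carrier (fundamental_group X x).
          \<rho> a \<otimes>\<^bsub>SU2\<^esub> \<rho> b = \<rho> b \<otimes>\<^bsub>SU2\<^esub> \<rho> a)"


section \<open>Slopes, rational longitudes, Dehn filling\<close>

text \<open>Slopes are represented by unoriented curves, i.e. by images of injective maps of the circle;
  two such subsets of \<open>T\<close> define the same slope iff they are isotopic.\<close>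

definition simple_closed_param :: "'a topology \<Rightarrow> (complex \<Rightarrow> 'a) \<Rightarrow> bool" where
  "simple_closed_param T \<gamma> \<longleftrightarrow> continuous_map (top_of_set circle) T \<gamma> \<and> inj_on \<gamma> circle"

definition is_slope :: "'a topology \<Rightarrow> 'a set \<Rightarrow> bool" where
  "is_slope T C \<longleftrightarrow>
     (\<exists>\<gamma>. simple_closed_param T \<gamma> \<and> C = \<gamma> ` circle \<and>
        \<not> (\<exists>a. homotopic_with (\<lambda>_. True) (top_of_set circle) T \<gamma> (\<lambda>_. a)))"

definition isotopic_curves :: "'a topology \<Rightarrow> 'a set \<Rightarrow> 'a set \<Rightarrow> bool" where
  "isotopic_curves T C C' \<longleftrightarrow>
     (\<exists>\<gamma> \<gamma>'. C = \<gamma> ` circle \<and> C' = \<gamma>' ` circle \<and>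
        homotopic_with (\<lambda>h. inj_on h circle) (top_of_set circle) T \<gamma> \<gamma>')"

text \<open>The class in \<open>H\<^sub>1(X; \<int>)\<close> of the singular 1-cycle that runs once around \<open>\<gamma>\<close>. Points of the
  standard 1-simplex have barycentric coordinates \<open>(v 0, v 1)\<close>.\<close>

definition curve_class :: "'a topology \<Rightarrow> (complex \<Rightarrow> 'a) \<Rightarrow> 'a chain set" where
  "curve_class X \<gamma> = homologous_rel_set 1 X {}
     (frag_of (restrict (\<lambda>v. \<gamma> (cis (2 * pi * v 1))) (standard_simplex 1)))"

definition torsion_curve :: "'a topology \<Rightarrow> 'a topology \<Rightarrow> 'a set \<Rightarrow> bool" where
  "torsion_curve X T C \<longleftrightarrow>
     (\<exists>\<gamma>. simple_closed_param T \<gamma> \<and> C = \<gamma> ` circle \<and>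
        (\<exists>n>0::nat. curve_class X \<gamma> [^]\<^bsub>homology_group 1 X\<^esub> n = \<one>\<^bsub>homology_group 1 X\<^esub>))"

text \<open>The rational longitude is, by definition, the slope that is unique up to isotopy among those
  with torsion class; the last conjunct renders this definite description.\<close>

definition rational_longitude :: "'a topology \<Rightarrow> 'a chart set \<Rightarrow> 'a set \<Rightarrow> bool" where
  "rational_longitude X A C \<longleftrightarrow>
     is_slope (boundary_torus X A) C \<and> torsion_curve X (boundary_torus X A) C \<and>
     (\<forall>C'. is_slope (boundary_torus X A) C' \<and> torsion_curve X (boundary_torus X A) C' \<longrightarrow>
        isotopic_curves (boundary_torus X A) C C')"

text \<open>The solid torus is \<open>circle \<times> cball 0 1\<close>; its meridian \<open>{1} \<times> circle\<close> is attached along \<open>C\<close>.\<close>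

definition is_dehn_filling ::
  "'a topology \<Rightarrow> 'a chart set \<Rightarrow> 'a set \<Rightarrow> (complex \<times> complex + 'a) set topology \<Rightarrow> bool" where
  "is_dehn_filling X A C M \<longleftrightarrow>
     (\<exists>\<psi>. homeomorphic_map (top_of_set (circle \<times> circle)) (boundary_torus X A) \<psi> \<and>
        \<psi> ` ({1} \<times> circle) = C \<and>
        M = glue (top_of_set (circle \<times> cball 0 1)) (circle \<times> circle) \<psi> X)"

end

theory Submission
  imports Defs "HOL-Library.Function_Algebras"
begin

text \<open>Let \<open>\<rho>\<close> be a representation of the group of the filling of \<open>Y1\<close> along \<open>lam2\<close>. It restricts to a
representation of \<open>\<pi>\<^sub>1(Y1)\<close> with \<open>\<rho>(lam2) = 1\<close>, so on the boundary torus it is determined by the value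
\<open>A \<in> SU(2)\<close> on one dual curve \<open>\<mu>\<close>. The class of \<open>lam2\<close> in \<open>H\<^sub>1(Y2)\<close> is torsion, while that of \<open>\<mu>\<close> has
infinite order: otherwise \<open>\<mu>\<close> would be a second torsion slope, and \<open>\<mu>\<close> is not isotopic to \<open>lam2\<close>
because one of them winds around the first factor of the torus and the other does not. Hence there
is a homomorphism \<open>H\<^sub>1(Y2) \<rightarrow> \<real>\<close> that sends \<open>\<mu>\<close> to \<open>1\<close> and \<open>lam2\<close> to \<open>0\<close>; followed by a one-parameter
subgroup of \<open>SU(2)\<close> through \<open>A\<close> it is an abelian representation of \<open>\<pi>\<^sub>1(Y2)\<close> that agrees with \<open>\<rho>\<close> on
the torus. By van Kampen the two glue to a representation of \<open>\<pi>\<^sub>1(Y)\<close>. As \<open>Y\<close> is \<open>SU(2)\<close>-abelian,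
\<open>\<rho>\<close> has commuting values on loops in \<open>Y1\<close>; since every loop in the filling can be moved into
\<open>Y1\<close>, \<open>\<rho>\<close> is abelian.

Representations are handled in groupoid form, as \<^emph>\<open>transports\<close>: homotopy-invariant multiplicative
functions on paths (\<open>path_transport\<close>). They restrict along continuous maps and need neither a base
point nor connectedness. Homotopies are almost always obtained from one source, the fact that two
paths with common end points in a convex set are homotopic (\<open>path_homotopic_convex\<close>).

Van Kampen's theorem is needed for two closed pieces that meet in a surface. Instead of thickening
the pieces to open sets by collars, transports are described locally: on a small neighbourhood the
transport along a path is \<open>F(p 0)\<inverse> F(p 1)\<close> for a function \<open>F\<close> on points. Such functions on the two
sides of the seam can be matched up, and a family of them that agrees locally up to constants is
integrated along paths, as sections of a covering space are lifted (\<open>flat_structure\<close>,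
\<open>glued_transport\<close>). Manifolds enter through three facts: charts provide convex patches, the
boundary torus is locally path connected, and it is closed in each side.

The surjectivity statement is \<open>path_to_Z\<close>, the homological input \<open>real_transport_of_homology\<close>, the
comparison on the torus \<open>torus_transports_agree\<close>; they are combined in \<open>filling_SU2_abelian\<close>, which
is applied to each of the two sides.\<close>

section \<open>Path homotopies in abstract topological spaces\<close>

text \<open>Homotopy relative to the end points, for spaces given as explicit topologies such as quotients.\<close>

definition path_homotopic :: "'a topology \<Rightarrow> (real \<Rightarrow> 'a) \<Rightarrow> (real \<Rightarrow> 'a) \<Rightarrow> bool" where
  "path_homotopic X p q \<longleftrightarrow>
     homotopic_with (\<lambda>h. h 0 = p 0 \<and> h 1 = p 1) (top_of_set {0..1}) X p q"

definition reverse_path :: "(real \<Rightarrow> 'a) \<Rightarrow> real \<Rightarrow> 'a" where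
  "reverse_path p = (\<lambda>t. p (1 - t))"

lemma reverse_path_simps [simp]: "reverse_path p 0 = p 1" "reverse_path p 1 = p 0"
  by (simp_all add: reverse_path_def)

lemma loop_concat_simps [simp]: "loop_concat p q 0 = p 0" "loop_concat p q 1 = q 1"
  by (simp_all add: loop_concat_def)

lemma prod_top_of_set: "prod_topology (top_of_set S) (top_of_set T) = top_of_set (S \<times> T)"
  by (metis prod_topology_euclidean subtopology_Times)

lemma path_homotopic_iff:
  "path_homotopic X p q \<longleftrightarrow>
     (\<exists>H. continuous_map (top_of_set ({0..1::real} \<times> {0..1})) X H \<and>
        (\<forall>t\<in>{0..1}. H (0, t) = p t \<and> H (1, t) = q t) \<and>
        (\<forall>s\<in>{0..1}. H (s, 0) = p 0 \<and> H (s, 1) = p 1))"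
  unfolding path_homotopic_def
  by (subst homotopic_with) (auto simp: prod_top_of_set)

lemma path_homotopic_endpoints:
  assumes "path_homotopic X p q" shows "q 0 = p 0" "q 1 = p 1"
  using homotopic_with_imp_property[OF assms[unfolded path_homotopic_def]] by auto

lemma path_homotopic_pathin:
  assumes "path_homotopic X p q" shows "pathin X p" "pathin X q"
  using homotopic_with_imp_continuous_maps[OF assms[unfolded path_homotopic_def]]
  by (auto simp: pathin_def)

lemma path_homotopic_sym: "path_homotopic X p q \<Longrightarrow> path_homotopic X q p"
  using path_homotopic_endpoints[of X p q] unfolding path_homotopic_def
  by (simp add: homotopic_with_symD)

lemma path_homotopic_trans:
  "path_homotopic X p q \<Longrightarrow> path_homotopic X q r \<Longrightarrow> path_homotopic X p r"
  using path_homotopic_endpoints[of X p q] homotopic_with_trans unfolding path_homotopic_def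
  by fastforce

lemma path_homotopic_equal:
  assumes "pathin X p" "\<And>t. t \<in> {0..1} \<Longrightarrow> q t = p t" shows "path_homotopic X p q"
  using assms unfolding path_homotopic_def pathin_def
  by (intro homotopic_with_equal) auto

lemma path_homotopic_refl: "pathin X p \<Longrightarrow> path_homotopic X p p"
  by (rule path_homotopic_equal) auto

text \<open>The straight-line homotopy in \<open>K\<close>, pushed forward. Associativity of concatenation, cancellation of
  inverse paths and null-homotopies in discs are all instances.\<close>

lemma path_homotopic_convex:
  fixes K :: "'v::real_normed_vector set"
  assumes K: "convex K" and m: "continuous_map (top_of_set K) X m"
    and a: "continuous_on {0..1} \<alpha>" "\<alpha> ` {0..1} \<subseteq> K" and b: "continuous_on {0..1} \<beta>" "\<beta> ` {0..1} \<subseteq> K"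
    and e: "\<alpha> 0 = \<beta> 0" "\<alpha> 1 = \<beta> 1"
  shows "path_homotopic X (m \<circ> \<alpha>) (m \<circ> \<beta>)"
  unfolding path_homotopic_iff
proof (intro exI conjI ballI)
  let ?L = "\<lambda>z. (1 - fst z) *\<^sub>R \<alpha> (snd z) + fst z *\<^sub>R \<beta> (snd z)"
  have "continuous_on ({0..1} \<times> {0..1}) ?L"
    by (intro continuous_intros continuous_on_compose2[OF a(1)] continuous_on_compose2[OF b(1)]) auto
  moreover have "?L ` ({0..1} \<times> {0..1}) \<subseteq> K"
  proof clarsimp
    fix s t :: real assume "0 \<le> s" "s \<le> 1" "0 \<le> t" "t \<le> 1"
    then have "\<alpha> t \<in> K" "\<beta> t \<in> K" using a(2) b(2) by auto
    with K \<open>0 \<le> s\<close> \<open>s \<le> 1\<close> show "(1 - s) *\<^sub>R \<alpha> t + s *\<^sub>R \<beta> t \<in> K"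
      by (auto simp: convex_alt)
  qed
  ultimately have "continuous_map (top_of_set ({0..1} \<times> {0..1})) (top_of_set K) ?L"
    by (auto simp: continuous_map_in_subtopology)
  from continuous_map_compose[OF this m]
  show "continuous_map (top_of_set ({0..1} \<times> {0..1})) X (m \<circ> ?L)" .
qed (auto simp: e algebra_simps simp flip: scaleR_add_left)

lemma continuous_map_I:
  "continuous_on S f \<Longrightarrow> f ` S \<subseteq> T \<Longrightarrow> continuous_map (top_of_set S) (top_of_set T) f"
  by (auto simp: continuous_map_in_subtopology)

text \<open>A reparametrization or an out-and-back path is a path inside the interval, where any two
  paths with common endpoints are homotopic.\<close>

lemma path_homotopic_reparam:
  assumes "pathin X p" "continuous_on {0..1} \<alpha>" "\<alpha> ` {0..1} \<subseteq> {0..1::real}"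
    "continuous_on {0..1} \<beta>" "\<beta> ` {0..1} \<subseteq> {0..1}" "\<alpha> 0 = \<beta> 0" "\<alpha> 1 = \<beta> 1"
  shows "path_homotopic X (p \<circ> \<alpha>) (p \<circ> \<beta>)"
  using assms by (intro path_homotopic_convex[of "{0..1}"]) (auto simp: pathin_def)

lemma pathin_loop_concat:
  assumes p: "pathin X p" and q: "pathin X q" and e: "p 1 = q 0"
  shows "pathin X (loop_concat p q)"
  unfolding pathin_def loop_concat_def
proof (rule continuous_map_cases_le)
  have "continuous_map (subtopology (top_of_set {0..1}) {x \<in> topspace (top_of_set {0..1}). x \<le> 1/2})
     X (p \<circ> (\<lambda>t. 2 * t))"
    by (rule continuous_map_compose[OF _ p[unfolded pathin_def]])
      (auto simp: subtopology_subtopology intro!: continuous_map_I continuous_intros)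
  then show "continuous_map (subtopology (top_of_set {0..1}) {x \<in> topspace (top_of_set {0..1}). x \<le> 1/2})
     X (\<lambda>t. p (2 * t))" by (simp add: o_def)
  have "continuous_map (subtopology (top_of_set {0..1}) {x \<in> topspace (top_of_set {0..1}). 1/2 \<le> x})
     X (q \<circ> (\<lambda>t. 2 * t - 1))"
    by (rule continuous_map_compose[OF _ q[unfolded pathin_def]])
      (auto simp: subtopology_subtopology intro!: continuous_map_I continuous_intros)
  then show "continuous_map (subtopology (top_of_set {0..1}) {x \<in> topspace (top_of_set {0..1}). 1/2 \<le> x})
     X (\<lambda>t. q (2 * t - 1))" by (simp add: o_def)
next
  fix t :: real assume "t = 1/2"
  then have "2 * t = 1" "2 * t - 1 = 0" by auto
  then show "p (2 * t) = q (2 * t - 1)" using e by (simp only:)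
qed (auto simp: continuous_map_in_subtopology)

lemma pathin_reparam:
  "pathin X p \<Longrightarrow> continuous_on {0..1} \<alpha> \<Longrightarrow> \<alpha> ` {0..1} \<subseteq> {0..1::real} \<Longrightarrow> pathin X (p \<circ> \<alpha>)"
  unfolding pathin_def by (rule continuous_map_compose[rotated]) (auto intro: continuous_map_I)

lemma pathin_reverse: "pathin X p \<Longrightarrow> pathin X (reverse_path p)"
  using pathin_reparam[of X p "\<lambda>t. 1 - t"]
  by (auto simp: o_def reverse_path_def continuous_intros)

lemma path_homotopic_concat:
  assumes p: "path_homotopic X p p'" and q: "path_homotopic X q q'" and e: "p 1 = q 0"
  shows "path_homotopic X (loop_concat p q) (loop_concat p' q')"
proof -
  obtain H where H: "continuous_map (top_of_set ({0..1::real} \<times> {0..1})) X H"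
        "\<And>t. t\<in>{0..1} \<Longrightarrow> H (0, t) = p t \<and> H (1, t) = p' t"
        "\<And>s. s\<in>{0..1} \<Longrightarrow> H (s, 0) = p 0 \<and> H (s, 1) = p 1"
    using p unfolding path_homotopic_iff by blast
  obtain J where J: "continuous_map (top_of_set ({0..1::real} \<times> {0..1})) X J"
        "\<And>t. t\<in>{0..1} \<Longrightarrow> J (0, t) = q t \<and> J (1, t) = q' t"
        "\<And>s. s\<in>{0..1} \<Longrightarrow> J (s, 0) = q 0 \<and> J (s, 1) = q 1"
    using q unfolding path_homotopic_iff by blast
  let ?S = "{0..1} \<times> {0..1} :: (real \<times> real) set"
  let ?F = "\<lambda>z. if snd z \<le> 1/2 then H (fst z, 2 * snd z) else J (fst z, 2 * snd z - 1)"
  have "continuous_map (top_of_set ?S) X ?F"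
  proof (rule continuous_map_cases_le)
    have "continuous_map (subtopology (top_of_set ?S) {x \<in> topspace (top_of_set ?S). snd x \<le> 1/2})
       X (H \<circ> (\<lambda>z. (fst z, 2 * snd z)))"
      by (rule continuous_map_compose[OF _ H(1)])
        (auto simp: subtopology_subtopology intro!: continuous_map_I continuous_intros)
    then show "continuous_map (subtopology (top_of_set ?S) {x \<in> topspace (top_of_set ?S). snd x \<le> 1/2})
       X (\<lambda>z. H (fst z, 2 * snd z))" by (simp add: o_def)
    have "continuous_map (subtopology (top_of_set ?S) {x \<in> topspace (top_of_set ?S). 1/2 \<le> snd x})
       X (J \<circ> (\<lambda>z. (fst z, 2 * snd z - 1)))"
      by (rule continuous_map_compose[OF _ J(1)])
        (auto simp: subtopology_subtopology intro!: continuous_map_I continuous_intros)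
    then show "continuous_map (subtopology (top_of_set ?S) {x \<in> topspace (top_of_set ?S). 1/2 \<le> snd x})
       X (\<lambda>z. J (fst z, 2 * snd z - 1))" by (simp add: o_def)
  next
    fix z :: "real \<times> real" assume z: "z \<in> topspace (top_of_set ?S)" "snd z = 1/2"
    then have "2 * snd z = 1" "2 * snd z - 1 = 0" by auto
    moreover have "fst z \<in> {0..1}" using z(1) by (auto simp: mem_Times_iff)
    ultimately show "H (fst z, 2 * snd z) = J (fst z, 2 * snd z - 1)"
      using e H(3) J(3) by metis
  qed (auto simp: continuous_map_in_subtopology continuous_on_snd)
  then show ?thesis
    unfolding path_homotopic_iff
    by (intro exI[of _ ?F] conjI ballI) (auto simp: loop_concat_def H(2,3) J(2,3))
qed

lemma path_homotopic_assoc: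
  assumes p: "pathin X p" and q: "pathin X q" and r: "pathin X r" and e: "p 1 = q 0" "q 1 = r 0"
  shows "path_homotopic X (loop_concat (loop_concat p q) r) (loop_concat p (loop_concat q r))"
proof -
  let ?w = "loop_concat (loop_concat p q) r"
  let ?\<alpha> = "\<lambda>t::real. if t \<le> 1/2 then t / 2 else if t \<le> 3/4 then t - 1/4 else 2 * t - 1"
  have \<alpha>: "?\<alpha> = (\<lambda>t. max (min (t/2) (1/4)) (max (t - 1/4) (2 * t - 1)))"
    by (auto simp: fun_eq_iff)
  have "path_homotopic X (?w \<circ> id) (?w \<circ> ?\<alpha>)"
  proof (rule path_homotopic_reparam)
    show "continuous_on {0..1} ?\<alpha>" unfolding \<alpha> by (auto intro!: continuous_intros)
  qed (auto intro!: pathin_loop_concat p q r e)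
  moreover have "?w \<circ> ?\<alpha> = loop_concat p (loop_concat q r)"
    using e by (auto simp: loop_concat_def fun_eq_iff field_simps intro!: arg_cong[of _ _ q])
  ultimately show ?thesis by simp
qed

lemma path_homotopic_reverse:
  assumes "pathin X p"
  shows "path_homotopic X (loop_concat p (reverse_path p)) (\<lambda>_. p 0)"
    "path_homotopic X (loop_concat (reverse_path p) p) (\<lambda>_. p 1)"
proof -
  let ?\<alpha> = "\<lambda>t::real. if t \<le> 1/2 then 2 * t else 2 - 2 * t"
  have \<alpha>: "?\<alpha> = (\<lambda>t. min (2 * t) (2 - 2 * t))" by (auto simp: fun_eq_iff)
  have "path_homotopic X (p \<circ> ?\<alpha>) (p \<circ> (\<lambda>_. 0))"
  proof (rule path_homotopic_reparam[OF assms])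
    show "continuous_on {0..1} ?\<alpha>" unfolding \<alpha> by (auto intro!: continuous_intros)
  qed auto
  moreover have "loop_concat p (reverse_path p) = p \<circ> ?\<alpha>"
    by (auto simp: loop_concat_def reverse_path_def fun_eq_iff)
  ultimately show "path_homotopic X (loop_concat p (reverse_path p)) (\<lambda>_. p 0)"
    by (simp add: o_def)
  let ?\<beta> = "\<lambda>t::real. if t \<le> 1/2 then 1 - 2 * t else 2 * t - 1"
  have \<beta>: "?\<beta> = (\<lambda>t. max (1 - 2 * t) (2 * t - 1))" by (auto simp: fun_eq_iff)
  have "path_homotopic X (p \<circ> ?\<beta>) (p \<circ> (\<lambda>_. 1))"
  proof (rule path_homotopic_reparam[OF assms])
    show "continuous_on {0..1} ?\<beta>" unfolding \<beta> by (intro continuous_intros)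
  qed auto
  moreover have "loop_concat (reverse_path p) p = p \<circ> ?\<beta>"
    by (auto simp: loop_concat_def reverse_path_def fun_eq_iff)
  ultimately show "path_homotopic X (loop_concat (reverse_path p) p) (\<lambda>_. p 1)"
    by (simp add: o_def)
qed

lemma path_homotopic_const:
  assumes "pathin X p"
  shows "path_homotopic X (loop_concat (\<lambda>_. p 0) p) p" "path_homotopic X (loop_concat p (\<lambda>_. p 1)) p"
proof -
  have "path_homotopic X (p \<circ> (\<lambda>t. max 0 (2 * t - 1))) (p \<circ> id)"
    by (rule path_homotopic_reparam[OF assms]) (auto intro!: continuous_intros)
  moreover have "loop_concat (\<lambda>_. p 0) p = p \<circ> (\<lambda>t. max 0 (2 * t - 1))"
    by (auto simp: loop_concat_def fun_eq_iff max_def intro: arg_cong[of _ _ p])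
  ultimately show "path_homotopic X (loop_concat (\<lambda>_. p 0) p) p" by simp
  have "path_homotopic X (p \<circ> (\<lambda>t. min 1 (2 * t))) (p \<circ> id)"
    by (rule path_homotopic_reparam[OF assms]) (auto intro!: continuous_intros)
  moreover have "loop_concat p (\<lambda>_. p 1) = p \<circ> (\<lambda>t. min 1 (2 * t))"
    by (auto simp: loop_concat_def fun_eq_iff min_def intro: arg_cong[of _ _ p])
  ultimately show "path_homotopic X (loop_concat p (\<lambda>_. p 1)) p" by simp
qed

section \<open>Transports\<close>

text \<open>A functor from the fundamental groupoid of \<open>X\<close> to \<open>G\<close>, in other words a flat \<open>G\<close>-bundle with
  trivialized fibres. Changing the trivializations is the gauge transformation of \<open>transport_gauge\<close>.\<close>

definition path_transport ::
  "('g, 'm) monoid_scheme \<Rightarrow> 'a topology \<Rightarrow> ((real \<Rightarrow> 'a) \<Rightarrow> 'g) \<Rightarrow> bool" where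
  "path_transport G X \<tau> \<longleftrightarrow>
     (\<forall>p. pathin X p \<longrightarrow> \<tau> p \<in> carrier G) \<and>
     (\<forall>p q. pathin X p \<longrightarrow> pathin X q \<longrightarrow> p 1 = q 0 \<longrightarrow>
        \<tau> (loop_concat p q) = \<tau> p \<otimes>\<^bsub>G\<^esub> \<tau> q) \<and>
     (\<forall>p q. path_homotopic X p q \<longrightarrow> \<tau> p = \<tau> q)"

lemma path_transportD:
  assumes "path_transport G X \<tau>"
  shows transport_closed: "pathin X p \<Longrightarrow> \<tau> p \<in> carrier G"
    and transport_concat: "pathin X p \<Longrightarrow> pathin X q \<Longrightarrow> p 1 = q 0 \<Longrightarrow>
        \<tau> (loop_concat p q) = \<tau> p \<otimes>\<^bsub>G\<^esub> \<tau> q"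
    and transport_homotopic: "path_homotopic X p q \<Longrightarrow> \<tau> p = \<tau> q"
  using assms unfolding path_transport_def by blast+

text \<open>Paths are functions on all of \<open>\<real>\<close>, but only their values on the unit interval count.\<close>

lemma transport_cong:
  assumes "path_transport G X \<tau>" "pathin X p" "\<And>t. t \<in> {0..1} \<Longrightarrow> q t = p t"
  shows "\<tau> q = \<tau> p"
  using transport_homotopic[OF assms(1) path_homotopic_equal[OF assms(2,3)]] by simp

lemma transport_convex:
  fixes K :: "'v::real_normed_vector set"
  assumes "path_transport G X \<tau>" "convex K" "continuous_map (top_of_set K) X m"
    "pathin (top_of_set K) \<alpha>" "pathin (top_of_set K) \<beta>" "\<alpha> 0 = \<beta> 0" "\<alpha> 1 = \<beta> 1"
  shows "\<tau> (m \<circ> \<alpha>) = \<tau> (m \<circ> \<beta>)"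
  using assms(4-7)
  by (intro transport_homotopic[OF assms(1)] path_homotopic_convex[OF assms(2,3)])
    (auto simp: pathin_def continuous_map_in_subtopology)

lemma pathin_top_of_set:
  "pathin (top_of_set K) \<alpha> \<longleftrightarrow> continuous_on {0..1} \<alpha> \<and> \<alpha> ` {0..1} \<subseteq> K"
  by (auto simp: pathin_def continuous_map_in_subtopology)

lemma pathin_linepath:
  fixes K :: "'v::real_normed_vector set"
  shows "convex K \<Longrightarrow> a \<in> K \<Longrightarrow> b \<in> K \<Longrightarrow> pathin (top_of_set K) (linepath a b)"
  by (auto simp: pathin_top_of_set linepath_def convex_alt intro!: continuous_intros)

lemma transport_compose:
  assumes \<tau>: "path_transport G X \<tau>" and f: "continuous_map W X f"
  shows "path_transport G W (\<lambda>p. \<tau> (f \<circ> p))"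
proof -
  have c: "f \<circ> loop_concat p q = loop_concat (f \<circ> p) (f \<circ> q)" for p q
    by (auto simp: loop_concat_def fun_eq_iff)
  have h: "path_homotopic X (f \<circ> p) (f \<circ> q)" if pq: "path_homotopic W p q" for p q
  proof -
    obtain H where H: "continuous_map (top_of_set ({0..1::real} \<times> {0..1})) W H"
      "\<And>t. t\<in>{0..1} \<Longrightarrow> H (0, t) = p t \<and> H (1, t) = q t"
      "\<And>s. s\<in>{0..1} \<Longrightarrow> H (s, 0) = p 0 \<and> H (s, 1) = p 1"
      using pq unfolding path_homotopic_iff by blast
    show ?thesis
      unfolding path_homotopic_iff
      by (rule exI[of _ "f \<circ> H"]) (auto intro: continuous_map_compose[OF H(1) f] simp: H(2,3))
  qed
  show ?thesis
    unfolding path_transport_def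
    using pathin_compose[OF _ f] \<tau> h unfolding c path_transport_def by auto
qed

lemma transport_line:
  fixes K :: "'v::real_normed_vector set"
  assumes \<tau>: "path_transport G X \<tau>" and K: "convex K" and m: "continuous_map (top_of_set K) X m"
    and abc: "a \<in> K" "b \<in> K" "c \<in> K"
  shows "\<tau> (m \<circ> linepath a c) = \<tau> (m \<circ> linepath a b) \<otimes>\<^bsub>G\<^esub> \<tau> (m \<circ> linepath b c)"
proof -
  have "\<tau> (m \<circ> linepath a c) = \<tau> (m \<circ> loop_concat (linepath a b) (linepath b c))"
    by (rule transport_convex[OF \<tau> K m])
      (auto intro!: pathin_linepath pathin_loop_concat K abc simp: linepath_0' linepath_1')
  also have "\<dots> = \<tau> (m \<circ> linepath a b) \<otimes>\<^bsub>G\<^esub> \<tau> (m \<circ> linepath b c)"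
    using abc K
    by (intro transport_concat[OF transport_compose[OF \<tau> m]])
      (auto intro!: pathin_linepath simp: linepath_0' linepath_1')
  finally show ?thesis .
qed

text \<open>Both ways around a square are paths in a convex set with common endpoints.\<close>

lemma transport_square:
  assumes \<tau>: "path_transport G X \<tau>" and m: "continuous_map (top_of_set ({0..1::real} \<times> {0..1::real})) X m"
  shows "\<tau> (\<lambda>t. m (0, t)) \<otimes>\<^bsub>G\<^esub> \<tau> (\<lambda>s. m (s, 1)) = \<tau> (\<lambda>s. m (s, 0)) \<otimes>\<^bsub>G\<^esub> \<tau> (\<lambda>t. m (1, t))"
proof -
  have K: "convex ({0..1::real} \<times> {0..1::real})" by (intro convex_Times) auto
  note l = transport_line[OF \<tau> K m, symmetric]
  have e: "(\<lambda>t. m (0, t)) = m \<circ> linepath (0,0) (0,1)" "(\<lambda>s. m (s, 1)) = m \<circ> linepath (0,1) (1,1)"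
    "(\<lambda>s. m (s, 0)) = m \<circ> linepath (0,0) (1,0)" "(\<lambda>t. m (1, t)) = m \<circ> linepath (1,0) (1,1)"
    by (auto simp: linepath_def fun_eq_iff)
  show ?thesis unfolding e by (subst (1 2) l) auto
qed

context group
begin

lemma inv_cancel_left [simp]:
  assumes "x \<in> carrier G" "y \<in> carrier G"
  shows "x \<otimes> (inv x \<otimes> y) = y" "inv x \<otimes> (x \<otimes> y) = y"
  using assms by (simp_all flip: m_assoc)

lemma transport_const:
  assumes \<tau>: "path_transport G X \<tau>" and x: "x \<in> topspace X"
  shows "\<tau> (\<lambda>_. x) = \<one>"
proof -
  have p: "pathin X (\<lambda>_. x)" using x by simp
  have "\<tau> (\<lambda>_. x) \<otimes> \<tau> (\<lambda>_. x) = \<tau> (loop_concat (\<lambda>_. x) (\<lambda>_. x))"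
    using transport_concat[OF \<tau> p p] by simp
  also have "loop_concat (\<lambda>_. x) (\<lambda>_. x) = (\<lambda>_. x)"
    by (auto simp: loop_concat_def)
  finally show ?thesis
    using transport_closed[OF \<tau> p] by (metis l_cancel_one')
qed

lemma transport_closed_path:
  fixes K :: "'v::real_normed_vector set"
  assumes "path_transport G X \<tau>" "convex K" "continuous_map (top_of_set K) X m"
    "pathin (top_of_set K) \<alpha>" "\<alpha> 0 = \<alpha> 1"
  shows "\<tau> (m \<circ> \<alpha>) = \<one>"
proof -
  have "\<alpha> 0 \<in> K" using assms(4) path_start_in_topspace by fastforce
  then have "\<tau> (m \<circ> \<alpha>) = \<tau> (m \<circ> (\<lambda>_. \<alpha> 0))"
    using assms by (intro transport_convex[OF assms(1-3)]) auto
  also have "\<dots> = \<one>"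
    using \<open>\<alpha> 0 \<in> K\<close> transport_const[OF assms(1)] assms(3)
    by (auto simp: o_def continuous_map_def Pi_iff)
  finally show ?thesis .
qed

lemma transport_reverse:
  assumes \<tau>: "path_transport G X \<tau>" and p: "pathin X p"
  shows "\<tau> (reverse_path p) = inv (\<tau> p)"
proof -
  have "\<tau> (reverse_path p) \<otimes> \<tau> p = \<tau> (loop_concat (reverse_path p) p)"
    by (rule transport_concat[OF \<tau>, symmetric]) (auto intro: pathin_reverse p)
  also have "\<dots> = \<tau> (\<lambda>_. p 1)"
    by (rule transport_homotopic[OF \<tau> path_homotopic_reverse(2)[OF p]])
  also have "\<dots> = \<one>"
    by (rule transport_const[OF \<tau> path_finish_in_topspace[OF p]])
  finally show ?thesis
    using transport_closed[OF \<tau>] p pathin_reverse by (metis inv_equality)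
qed

lemma transport_gauge:
  assumes \<tau>: "path_transport G X \<tau>" and u: "\<And>x. x \<in> topspace X \<Longrightarrow> u x \<in> carrier G"
  shows "path_transport G X (\<lambda>p. inv (u (p 0)) \<otimes> \<tau> p \<otimes> u (p 1))"
  unfolding path_transport_def
proof (intro conjI allI impI)
  fix p assume p: "pathin X p"
  note c = u[OF path_start_in_topspace] u[OF path_finish_in_topspace] transport_closed[OF \<tau>]
  show "inv (u (p 0)) \<otimes> \<tau> p \<otimes> u (p 1) \<in> carrier G" using c p by simp
  fix q assume q: "pathin X q" and e: "p 1 = q 0"
  have "inv (u (p 0)) \<otimes> \<tau> p \<otimes> u (p 1) \<otimes> (inv (u (q 0)) \<otimes> \<tau> q \<otimes> u (q 1))
     = inv (u (p 0)) \<otimes> \<tau> (loop_concat p q) \<otimes> u (q 1)"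
    using c[OF p] c[OF q] c(3)[OF p] c(3)[OF q] by (simp add: e m_assoc transport_concat[OF \<tau> p q])
  then show "inv (u (loop_concat p q 0)) \<otimes> \<tau> (loop_concat p q) \<otimes> u (loop_concat p q 1) =
    inv (u (p 0)) \<otimes> \<tau> p \<otimes> u (p 1) \<otimes> (inv (u (q 0)) \<otimes> \<tau> q \<otimes> u (q 1))" by simp
next
  fix p q assume "path_homotopic X p q"
  then show "inv (u (p 0)) \<otimes> \<tau> p \<otimes> u (p 1) = inv (u (q 0)) \<otimes> \<tau> q \<otimes> u (q 1)"
    using path_homotopic_endpoints transport_homotopic[OF \<tau>] by metis
qed

lemma transport_subpath:
  assumes \<tau>: "path_transport G X \<tau>" and p: "pathin X p" and "a \<in> {0..1}" "b \<in> {0..1}" "c \<in> {0..1}"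
  shows "\<tau> (p \<circ> linepath a c) = \<tau> (p \<circ> linepath a b) \<otimes> \<tau> (p \<circ> linepath b c)"
  using assms by (intro transport_line[of G X \<tau> "{0..1}"]) (auto simp: pathin_def)

lemma pathin_subpath:
  assumes "pathin X p" "a \<in> {0..1}" "b \<in> {0..1}" shows "pathin X (p \<circ> linepath a b)"
  using pathin_linepath[of "{0..1}" a b] assms
  by (intro pathin_compose[of "top_of_set {0..1}"]) (auto simp: pathin_def)

end

text \<open>Lebesgue's covering argument for paths. \<open>P\<close> is a predicate on parameters rather than on subpaths
  of \<open>p\<close>, because it is also needed for statements about a second path obtained from \<open>p\<close>.\<close>

lemma path_subdivision:
  assumes p: "pathin X p"
    and local: "\<And>x. x \<in> p ` {0..1} \<Longrightarrow> \<exists>N. openin X N \<and> x \<in> N \<and>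
       (\<forall>a b. a \<in> {0..1} \<longrightarrow> b \<in> {0..1} \<longrightarrow> a \<le> b \<longrightarrow> p ` {a..b} \<subseteq> N \<longrightarrow> P a b)"
    and trans: "\<And>a b c. 0 \<le> a \<Longrightarrow> a \<le> b \<Longrightarrow> b \<le> c \<Longrightarrow> c \<le> 1 \<Longrightarrow> P a b \<Longrightarrow> P b c \<Longrightarrow> P a c"
  shows "P 0 1"
proof -
  define Q where "Q a b \<longleftrightarrow> (0 \<le> a \<and> a \<le> b \<and> b \<le> 1 \<longrightarrow> P a b)" for a b :: real
  have "Q 0 1"
  proof (induction rule: Bolzano[of 0 1 Q, OF zero_le_one, case_names trans local])
    case (trans a b c)
    then show ?case using assms(3) unfolding Q_def by (meson order_trans)
  next
    case (local t)
    then obtain N where N: "openin X N" "p t \<in> N"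
      "\<And>a b. a \<in> {0..1} \<Longrightarrow> b \<in> {0..1} \<Longrightarrow> a \<le> b \<Longrightarrow> p ` {a..b} \<subseteq> N \<Longrightarrow> P a b"
      using assms(2)[of "p t"] by auto
    have "openin (top_of_set {0..1}) {x \<in> topspace (top_of_set {0..1}). p x \<in> N}"
      using p N(1) unfolding pathin_def by (rule openin_continuous_map_preimage)
    moreover have "t \<in> {x \<in> topspace (top_of_set {0..1}). p x \<in> N}" using local N(2) by simp
    ultimately obtain e where e: "e > 0" "ball t e \<inter> {0..1} \<subseteq> {x \<in> topspace (top_of_set {0..1}). p x \<in> N}"
      unfolding openin_contains_ball by meson
    show ?case
    proof (intro exI[of _ e] conjI allI impI e(1))
      fix a b assume ab: "a \<le> t \<and> t \<le> b \<and> b - a < e"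
      show "Q a b" unfolding Q_def
      proof (intro impI N(3))
        assume "0 \<le> a \<and> a \<le> b \<and> b \<le> 1"
        with ab have "{a..b} \<subseteq> ball t e \<inter> {0..1}" by (auto simp: dist_real_def)
        then show "p ` {a..b} \<subseteq> N" using e(2) by auto
      qed auto
    qed
  qed
  then show ?thesis unfolding Q_def by simp
qed

lemma subpath_in_iff:
  "a \<le> b \<Longrightarrow> (\<forall>t\<in>{0..1}. (p \<circ> linepath a b) t \<in> N) \<longleftrightarrow> p ` {a..b} \<subseteq> N" for a b :: real
proof -
  assume "a \<le> b"
  then have "{a..b} = linepath a b ` {0..1}"
    by (simp add: linepath_image_01 closed_segment_eq_real_ivl)
  then show ?thesis by auto
qed

lemma (in group) transports_agree_locally:
  assumes \<tau>: "path_transport G X \<tau>" and \<sigma>: "path_transport G X \<sigma>"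
    and local: "\<And>x. x \<in> topspace X \<Longrightarrow> \<exists>N. openin X N \<and> x \<in> N \<and>
       (\<forall>q. pathin X q \<longrightarrow> (\<forall>t\<in>{0..1}. q t \<in> N) \<longrightarrow> \<tau> q = \<sigma> q)"
    and p: "pathin X p"
  shows "\<tau> p = \<sigma> p"
proof -
  have "\<tau> (p \<circ> linepath 0 1) = \<sigma> (p \<circ> linepath 0 1)"
  proof (rule path_subdivision[OF p, where P = "\<lambda>a b. \<tau> (p \<circ> linepath a b) = \<sigma> (p \<circ> linepath a b)"])
    fix x assume "x \<in> p ` {0..1}"
    then have "x \<in> topspace X" using path_image_subset_topspace[OF p] by auto
    then obtain N where N: "openin X N" "x \<in> N"
      "\<And>q. pathin X q \<Longrightarrow> \<forall>t\<in>{0..1}. q t \<in> N \<Longrightarrow> \<tau> q = \<sigma> q" using local by meson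
    show "\<exists>N. openin X N \<and> x \<in> N \<and> (\<forall>a b. a \<in> {0..1} \<longrightarrow> b \<in> {0..1} \<longrightarrow> a \<le> b \<longrightarrow>
      p ` {a..b} \<subseteq> N \<longrightarrow> \<tau> (p \<circ> linepath a b) = \<sigma> (p \<circ> linepath a b))"
    proof (intro exI[of _ N] conjI allI impI N(1,2) N(3))
      fix a b :: real assume ab: "a \<in> {0..1}" "b \<in> {0..1}" "a \<le> b" "p ` {a..b} \<subseteq> N"
      show "pathin X (p \<circ> linepath a b)" by (rule pathin_subpath[OF p ab(1,2)])
      show "\<forall>t\<in>{0..1}. (p \<circ> linepath a b) t \<in> N" using subpath_in_iff[OF ab(3)] ab(4) by blast
    qed
  next
    fix a b c :: real assume "0 \<le> a" "a \<le> b" "b \<le> c" "c \<le> 1"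
    then have *: "a \<in> {0..1}" "b \<in> {0..1}" "c \<in> {0..1}" by auto
    assume "\<tau> (p \<circ> linepath a b) = \<sigma> (p \<circ> linepath a b)" "\<tau> (p \<circ> linepath b c) = \<sigma> (p \<circ> linepath b c)"
    then show "\<tau> (p \<circ> linepath a c) = \<sigma> (p \<circ> linepath a c)"
      using transport_subpath[OF \<tau> p *] transport_subpath[OF \<sigma> p *] by simp
  qed
  moreover have "p \<circ> linepath 0 1 = p" by (auto simp: linepath_def)
  ultimately show ?thesis by simp
qed

section \<open>Transports and representations of the fundamental group\<close>

lemma loop_homotopy_iff:
  "(p, q) \<in> loop_homotopy X x \<longleftrightarrow> p 0 = x \<and> p 1 = x \<and> path_homotopic X p q"
proof
  assume "(p, q) \<in> loop_homotopy X x"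
  then show "p 0 = x \<and> p 1 = x \<and> path_homotopic X p q"
    by (auto simp: loop_homotopy_def loops_def path_homotopic_def)
next
  assume *: "p 0 = x \<and> p 1 = x \<and> path_homotopic X p q"
  then show "(p, q) \<in> loop_homotopy X x"
    using path_homotopic_endpoints[of X p q] path_homotopic_pathin[of X p q]
    by (auto simp: loop_homotopy_def loops_def path_homotopic_def)
qed

lemma equiv_loop_homotopy: "equiv (loops X x) (loop_homotopy X x)"
proof (rule equivI)
  show "loop_homotopy X x \<subseteq> loops X x \<times> loops X x" by (auto simp: loop_homotopy_def)
  show "refl_on (loops X x) (loop_homotopy X x)"
    by (rule refl_onI) (auto simp: loop_homotopy_iff loops_def intro: path_homotopic_refl)
  show "sym (loop_homotopy X x)"
    by (rule symI) (metis loop_homotopy_iff path_homotopic_endpoints path_homotopic_sym)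
  show "trans (loop_homotopy X x)"
    by (rule transI) (metis loop_homotopy_iff path_homotopic_trans)
qed

lemma loop_concat_in_loops: "p \<in> loops X x \<Longrightarrow> q \<in> loops X x \<Longrightarrow> loop_concat p q \<in> loops X x"
  by (auto simp: loops_def pathin_loop_concat)

lemma mult_loop_class:
  assumes p: "p \<in> loops X x" and q: "q \<in> loops X x"
  shows "loop_homotopy X x `` {p} \<otimes>\<^bsub>fundamental_group X x\<^esub> loop_homotopy X x `` {q} =
    loop_homotopy X x `` {loop_concat p q}"
proof -
  let ?R = "loop_homotopy X x"
  have "?R `` {loop_concat p' q'} = ?R `` {loop_concat p q}" if "p' \<in> ?R `` {p}" "q' \<in> ?R `` {q}" for p' q'
  proof (rule equiv_class_eq[OF equiv_loop_homotopy, symmetric])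
    show "(loop_concat p q, loop_concat p' q') \<in> ?R"
      using that by (auto simp: loop_homotopy_iff intro!: path_homotopic_concat)
  qed
  moreover have "p \<in> ?R `` {p}" "q \<in> ?R `` {q}"
    using p q equiv_class_self[OF equiv_loop_homotopy] by auto
  ultimately have "(\<Union>p'\<in>?R `` {p}. \<Union>q'\<in>?R `` {q}. ?R `` {loop_concat p' q'}) = ?R `` {loop_concat p q}"
    by blast
  then show ?thesis
    by (simp add: fundamental_group_def)
qed

lemma (in group) hom_of_transport:
  assumes \<tau>: "path_transport G X \<tau>"
  shows "(\<lambda>a. \<tau> (SOME p. p \<in> a)) \<in> hom (fundamental_group X x) G"
    and "p \<in> loops X x \<Longrightarrow> \<tau> (SOME q. q \<in> loop_homotopy X x `` {p}) = \<tau> p"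
proof -
  show *: "\<tau> (SOME q. q \<in> loop_homotopy X x `` {p}) = \<tau> p" if "p \<in> loops X x" for p
  proof -
    have "p \<in> loop_homotopy X x `` {p}"
      by (rule equiv_class_self[OF equiv_loop_homotopy that])
    then have "(SOME q. q \<in> loop_homotopy X x `` {p}) \<in> loop_homotopy X x `` {p}"
      by (rule someI[of "\<lambda>q. q \<in> loop_homotopy X x `` {p}"])
    then show ?thesis
      using transport_homotopic[OF \<tau>] by (auto simp: loop_homotopy_iff)
  qed
  have rep: "\<exists>p\<in>loops X x. a = loop_homotopy X x `` {p}" if "a \<in> carrier (fundamental_group X x)" for a
    using that by (auto simp: fundamental_group_def elim: quotientE)
  have closed: "\<tau> (SOME p. p \<in> a) \<in> carrier G" if a: "a \<in> carrier (fundamental_group X x)" for a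
  proof -
    obtain p where p: "p \<in> loops X x" "a = loop_homotopy X x `` {p}" using rep[OF a] by blast
    have "\<tau> p \<in> carrier G" using p(1) by (intro transport_closed[OF \<tau>]) (simp add: loops_def)
    then show ?thesis unfolding p(2) *[OF p(1)] .
  qed
  have mult: "\<tau> (SOME p. p \<in> a \<otimes>\<^bsub>fundamental_group X x\<^esub> b) = \<tau> (SOME p. p \<in> a) \<otimes> \<tau> (SOME p. p \<in> b)"
    if a: "a \<in> carrier (fundamental_group X x)" and b: "b \<in> carrier (fundamental_group X x)" for a b
  proof -
    obtain p where p: "p \<in> loops X x" "a = loop_homotopy X x `` {p}" using rep[OF a] by blast
    obtain q where q: "q \<in> loops X x" "b = loop_homotopy X x `` {q}" using rep[OF b] by blast
    have "\<tau> (loop_concat p q) = \<tau> p \<otimes> \<tau> q"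
      using p(1) q(1) by (intro transport_concat[OF \<tau>]) (auto simp: loops_def)
    then show ?thesis
      unfolding p(2) q(2) mult_loop_class[OF p(1) q(1)]
        *[OF p(1)] *[OF q(1)] *[OF loop_concat_in_loops[OF p(1) q(1)]] .
  qed
  show "(\<lambda>a. \<tau> (SOME p. p \<in> a)) \<in> hom (fundamental_group X x) G"
    by (rule homI; (fact closed | fact mult))
qed

text \<open>Conversely, a homomorphism out of the fundamental group extends to a transport: close each path
  up by chosen paths from the base point. Paths outside the path component of the base point get
  the value one. Closing up a loop at the base point itself conjugates it by the path chosen there.\<close>

lemma (in group) transport_of_hom:
  assumes \<rho>: "\<rho> \<in> hom (fundamental_group X x) G" and x: "x \<in> topspace X"
  shows "\<exists>\<tau>. path_transport G X \<tau> \<and> (\<exists>g\<in>carrier G. \<forall>p\<in>loops X x.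
    \<tau> p = g \<otimes> \<rho> (loop_homotopy X x `` {p}) \<otimes> inv g)"
proof -
  let ?R = "\<lambda>p. \<rho> (loop_homotopy X x `` {p})"
  have Rc: "?R p \<in> carrier G" if "p \<in> loops X x" for p
    using hom_in_carrier[OF \<rho>] that by (auto simp: fundamental_group_def quotientI)
  have Rm: "?R (loop_concat p q) = ?R p \<otimes> ?R q" if "p \<in> loops X x" "q \<in> loops X x" for p q
    using hom_mult[OF \<rho>] that unfolding mult_loop_class[OF that, symmetric]
    by (auto simp: fundamental_group_def quotientI)
  have Rh: "?R p = ?R q" if "path_homotopic X p q" "p 0 = x" "p 1 = x" for p q
  proof -
    have "(p, q) \<in> loop_homotopy X x" using that by (simp add: loop_homotopy_iff)
    then show ?thesis using equiv_class_eq[OF equiv_loop_homotopy] by metis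
  qed
  define C where "C = {y. \<exists>c. pathin X c \<and> c 0 = x \<and> c 1 = y}"
  define c where "c y = (SOME c. pathin X c \<and> c 0 = x \<and> c 1 = y)" for y
  have c: "pathin X (c y)" "c y 0 = x" "c y 1 = y" if "y \<in> C" for y
    using someI_ex[of "\<lambda>c. pathin X c \<and> c 0 = x \<and> c 1 = y"] that unfolding C_def c_def by auto
  have CI: "d 1 \<in> C" if "pathin X d" "d 0 = x" for d
    using that unfolding C_def by auto
  have step: "p 1 \<in> C \<longleftrightarrow> p 0 \<in> C" if p: "pathin X p" for p
  proof
    assume "p 0 \<in> C"
    then show "p 1 \<in> C"
      using c p CI[of "loop_concat (c (p 0)) p"] by (simp add: pathin_loop_concat)
  next
    assume "p 1 \<in> C"
    then show "p 0 \<in> C"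
      using c pathin_reverse[OF p] CI[of "loop_concat (c (p 1)) (reverse_path p)"]
      by (simp add: pathin_loop_concat)
  qed
  define L where "L p = loop_concat (loop_concat (c (p 0)) p) (reverse_path (c (p 1)))" for p
  have L: "L p \<in> loops X x" if "pathin X p" "p 0 \<in> C" for p
    using that c[of "p 0"] c[of "p 1"] step[of p]
    by (simp add: L_def loops_def pathin_loop_concat pathin_reverse)
  define \<tau> where "\<tau> p = (if p 0 \<in> C then ?R (L p) else \<one>)" for p
  have Lh: "path_homotopic X (L p) (L q)" if "path_homotopic X p q" "p 0 \<in> C" for p q
    using that c[of "p 0"] c[of "p 1"] path_homotopic_endpoints[OF that(1)] step[of p]
      path_homotopic_pathin[OF that(1)]
    by (simp add: L_def path_homotopic_concat path_homotopic_refl pathin_reverse)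
  have Lc: "path_homotopic X (loop_concat (L p) (L q)) (L (loop_concat p q))"
    if p: "pathin X p" and q: "pathin X q" and e: "p 1 = q 0" and C: "p 0 \<in> C" for p q
  proof -
    have C1: "q 0 \<in> C" "q 1 \<in> C" using step[OF p] step[OF q] e C by auto
    define a b d where "a = c (p 0)" and "b = c (q 0)" and "d = reverse_path (c (q 1))"
    have abd: "pathin X a" "a 1 = p 0" "pathin X b" "b 1 = q 0" "pathin X d" "d 0 = q 1" "a 0 = x" "d 1 = x" "b 0 = x"
      by (simp_all add: a_def b_def d_def c[OF C] c[OF C1(1)] c[OF C1(2)] pathin_reverse)
    note I = pathin_loop_concat pathin_reverse abd p q e path_homotopic_refl
    let ?ap = "loop_concat a p" and ?qd = "loop_concat q d" and ?b' = "reverse_path b"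
    have 1: "path_homotopic X (loop_concat (loop_concat ?ap ?b') (loop_concat (loop_concat b q) d))
      (loop_concat (loop_concat ?ap ?b') (loop_concat b ?qd))"
      by (rule path_homotopic_concat[OF path_homotopic_refl path_homotopic_assoc]) (simp_all add: I)
    have 2: "path_homotopic X (loop_concat (loop_concat ?ap ?b') (loop_concat b ?qd))
       (loop_concat (loop_concat (loop_concat ?ap ?b') b) ?qd)"
      by (rule path_homotopic_sym[OF path_homotopic_assoc]) (simp_all add: I)
    have 3: "path_homotopic X (loop_concat (loop_concat ?ap ?b') b) ?ap"
    proof -
      have "path_homotopic X (loop_concat (loop_concat ?ap ?b') b) (loop_concat ?ap (loop_concat ?b' b))"
        by (rule path_homotopic_assoc) (simp_all add: I)
      moreover have "path_homotopic X (loop_concat ?ap (loop_concat ?b' b)) (loop_concat ?ap (\<lambda>_. b 1))"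
        by (rule path_homotopic_concat[OF path_homotopic_refl path_homotopic_reverse(2)]) (simp_all add: I)
      moreover have "path_homotopic X (loop_concat ?ap (\<lambda>_. ?ap 1)) ?ap"
        by (rule path_homotopic_const(2)) (simp_all add: I)
      ultimately show ?thesis unfolding loop_concat_simps abd(4) e by (metis path_homotopic_trans)
    qed
    have 4: "path_homotopic X (loop_concat (loop_concat (loop_concat ?ap ?b') b) ?qd) (loop_concat ?ap ?qd)"
      by (rule path_homotopic_concat[OF 3 path_homotopic_refl]) (simp_all add: I)
    have 5: "path_homotopic X (loop_concat ?ap ?qd) (loop_concat (loop_concat ?ap q) d)"
      by (rule path_homotopic_sym[OF path_homotopic_assoc]) (simp_all add: I)
    have 6: "path_homotopic X (loop_concat (loop_concat ?ap q) d) (loop_concat (loop_concat a (loop_concat p q)) d)"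
      by (rule path_homotopic_concat[OF path_homotopic_assoc path_homotopic_refl]) (simp_all add: I)
    have "L p = loop_concat ?ap ?b'" "L q = loop_concat (loop_concat b q) d"
      "L (loop_concat p q) = loop_concat (loop_concat a (loop_concat p q)) d"
      by (simp_all add: L_def a_def b_def d_def e)
    with 1 2 4 5 6 show ?thesis by (metis path_homotopic_trans)
  qed
  have T: "path_transport G X \<tau>"
    unfolding path_transport_def
  proof (intro conjI allI impI)
    fix p assume p: "pathin X p"
    show "\<tau> p \<in> carrier G" using L[OF p] Rc by (simp add: \<tau>_def)
    fix q assume q: "pathin X q" and e: "p 1 = q 0"
    have C: "q 0 \<in> C \<longleftrightarrow> p 0 \<in> C" using step[OF p] e by simp
    show "\<tau> (loop_concat p q) = \<tau> p \<otimes> \<tau> q"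
    proof (cases "p 0 \<in> C")
      case True
      then have "L p \<in> loops X x" "L q \<in> loops X x" using L p q C by auto
      moreover from this have "?R (loop_concat (L p) (L q)) = ?R (L (loop_concat p q))"
        by (intro Rh Lc p q e True) (auto simp: loops_def)
      ultimately show ?thesis using True C Rm by (simp add: \<tau>_def)
    qed (auto simp: \<tau>_def C)
  next
    fix p q assume pq: "path_homotopic X p q"
    show "\<tau> p = \<tau> q"
    proof (cases "p 0 \<in> C")
      case True
      then have "L p \<in> loops X x" using L path_homotopic_pathin[OF pq] by auto
      then have "?R (L p) = ?R (L q)" by (intro Rh Lh pq True) (auto simp: loops_def)
      then show ?thesis using True path_homotopic_endpoints[OF pq] by (simp add: \<tau>_def)
    qed (use path_homotopic_endpoints[OF pq] in \<open>auto simp: \<tau>_def\<close>)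
  qed
  have conj: "\<exists>g\<in>carrier G. \<forall>p\<in>loops X x. \<tau> p = g \<otimes> ?R p \<otimes> inv g"
  proof -
    have "x \<in> C" using CI[of "\<lambda>_. x"] x by simp
    then have l: "c x \<in> loops X x" using c by (auto simp: loops_def)
    then have l': "reverse_path (c x) \<in> loops X x" by (auto simp: loops_def pathin_reverse)
    have "?R (loop_concat (\<lambda>_. x) (\<lambda>_. x)) = ?R (\<lambda>_. x) \<otimes> ?R (\<lambda>_. x)"
      by (rule Rm) (auto simp: loops_def x)
    moreover have "loop_concat (\<lambda>_. x) (\<lambda>_. x) = (\<lambda>_. x)" by (auto simp: loop_concat_def)
    moreover have "?R (\<lambda>_. x) \<in> carrier G" using x by (intro Rc) (auto simp: loops_def)
    ultimately have one: "?R (\<lambda>_. x) = \<one>" by (metis l_cancel_one')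
    have "?R (c x) \<otimes> ?R (reverse_path (c x)) = ?R (loop_concat (c x) (reverse_path (c x)))"
      using Rm[OF l l'] by simp
    also have "\<dots> = ?R (\<lambda>_. x)"
      using c[OF \<open>x \<in> C\<close>] path_homotopic_reverse(1)[of X "c x"] by (intro Rh) auto
    finally have "?R (reverse_path (c x)) = inv (?R (c x))"
      using one Rc[OF l] Rc[OF l'] by (metis inv_equality inv_comm)
    then have "\<tau> p = ?R (c x) \<otimes> ?R p \<otimes> inv (?R (c x))" if p: "p \<in> loops X x" for p
      using p \<open>x \<in> C\<close> Rm[OF loop_concat_in_loops[OF l p] l'] Rm[OF l p]
      by (auto simp: \<tau>_def L_def loops_def)
    then show ?thesis using Rc[OF l] by blast
  qed
  show ?thesis by (intro exI[of _ \<tau>] conjI T conj)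
qed

section \<open>Flat structures\<close>

text \<open>A flat \<open>G\<close>-bundle on \<open>Y\<close> given by local trivializations \<open>F\<close> whose transition functions are locally
  constant. \<open>F\<close> is a bare function on points, which identifies the fibres over \<open>W\<close> with each other.\<close>

locale flat_structure = group +
  fixes Y :: "'y topology" and \<Phi> :: "('y set \<times> ('y \<Rightarrow> 'a)) set"
  assumes chart_open: "(W, F) \<in> \<Phi> \<Longrightarrow> openin Y W"
    and chart_closed: "(W, F) \<in> \<Phi> \<Longrightarrow> x \<in> W \<Longrightarrow> F x \<in> carrier G"
    and chart_cover: "x \<in> topspace Y \<Longrightarrow> \<exists>W F. (W, F) \<in> \<Phi> \<and> x \<in> W"
    and chart_overlap: "(W, F) \<in> \<Phi> \<Longrightarrow> (W', F') \<in> \<Phi> \<Longrightarrow> x \<in> W \<Longrightarrow> x \<in> W' \<Longrightarrow>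
      \<exists>N c. openin Y N \<and> x \<in> N \<and> N \<subseteq> W \<inter> W' \<and> c \<in> carrier G \<and> (\<forall>y\<in>N. F' y = c \<otimes> F y)"

lemma continuous_map_nbhd:
  assumes "continuous_map (top_of_set K) Y p" "openin Y N" "t \<in> K" "p t \<in> N"
  obtains V where "open V" "t \<in> V" "\<And>s. s \<in> K \<Longrightarrow> s \<in> V \<Longrightarrow> p s \<in> N"
proof -
  have "openin (top_of_set K) {x \<in> topspace (top_of_set K). p x \<in> N}"
    by (rule openin_continuous_map_preimage[OF assms(1,2)])
  then obtain V where V: "open V" "{x \<in> topspace (top_of_set K). p x \<in> N} = K \<inter> V"
    unfolding openin_open by metis
  have "t \<in> K \<inter> V" using assms(3,4) unfolding V(2)[symmetric] by simp
  moreover have "p s \<in> N" if "s \<in> K" "s \<in> V" for s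
    using that V(2) by (metis (mono_tags, lifting) IntI mem_Collect_eq)
  ultimately show thesis using V(1) by (intro that[of V]) simp_all
qed

context flat_structure
begin

text \<open>\<open>g\<close> is a horizontal section of the bundle pulled back along \<open>p\<close>; equivalently, the lift of \<open>p\<close> to
  the covering space with fibre \<open>G\<close>. The parameter space is general because paths need an interval and
  homotopies a square.\<close>

definition horizontal :: "'c::topological_space set \<Rightarrow> ('c \<Rightarrow> 'y) \<Rightarrow> ('c \<Rightarrow> 'a) \<Rightarrow> bool" where
  "horizontal K p g \<longleftrightarrow>
     (\<forall>t\<in>K. \<exists>W F c V. (W, F) \<in> \<Phi> \<and> c \<in> carrier G \<and> open V \<and> t \<in> V \<and>
        (\<forall>s\<in>K \<inter> V. p s \<in> W \<and> g s = c \<otimes> F (p s)))"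

lemma horizontalE:
  assumes "horizontal K p g" "t \<in> K"
  obtains W F c V where "(W, F) \<in> \<Phi>" "c \<in> carrier G" "open V" "t \<in> V"
    "\<And>s. s \<in> K \<Longrightarrow> s \<in> V \<Longrightarrow> p s \<in> W" "\<And>s. s \<in> K \<Longrightarrow> s \<in> V \<Longrightarrow> g s = c \<otimes> F (p s)"
proof -
  obtain W F c V where *: "(W, F) \<in> \<Phi>" "c \<in> carrier G" "open V" "t \<in> V"
    "\<forall>s\<in>K \<inter> V. p s \<in> W \<and> g s = c \<otimes> F (p s)"
    using assms unfolding horizontal_def by metis
  show thesis by (rule that[OF *(1-4)]) (simp_all add: *(5))
qed

lemma horizontalI:
  assumes "\<And>t. t \<in> K \<Longrightarrow> \<exists>W F c V. (W, F) \<in> \<Phi> \<and> c \<in> carrier G \<and> open V \<and> t \<in> V \<and>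
        (\<forall>s\<in>K \<inter> V. p s \<in> W \<and> g s = c \<otimes> F (p s))"
  shows "horizontal K p g"
  using assms unfolding horizontal_def by simp

lemma horizontal_closed: "horizontal K p g \<Longrightarrow> t \<in> K \<Longrightarrow> g t \<in> carrier G"
  by (erule (1) horizontalE) (metis chart_closed m_closed)

lemma horizontal_cong:
  assumes "horizontal K p g" "\<And>t. t \<in> K \<Longrightarrow> p' t = p t" "\<And>t. t \<in> K \<Longrightarrow> g' t = g t"
  shows "horizontal K p' g'"
  using assms unfolding horizontal_def by simp

lemma horizontal_translate:
  assumes h: "horizontal K p g" and d: "d \<in> carrier G"
  shows "horizontal K p (\<lambda>t. d \<otimes> g t)"
proof (rule horizontalI)
  fix t assume "t \<in> K"
  with h obtain W F c V where *: "(W, F) \<in> \<Phi>" "c \<in> carrier G" "open V" "t \<in> V"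
    "\<And>s. s \<in> K \<Longrightarrow> s \<in> V \<Longrightarrow> p s \<in> W" "\<And>s. s \<in> K \<Longrightarrow> s \<in> V \<Longrightarrow> g s = c \<otimes> F (p s)"
    by (rule horizontalE) (rule that; (assumption | simp))
  show "\<exists>W F c V. (W, F) \<in> \<Phi> \<and> c \<in> carrier G \<and> open V \<and> t \<in> V \<and>
        (\<forall>s\<in>K \<inter> V. p s \<in> W \<and> d \<otimes> g s = c \<otimes> F (p s))"
    by (rule exI[of _ W], rule exI[of _ F], rule exI[of _ "d \<otimes> c"], rule exI[of _ V])
      (use * d chart_closed in \<open>simp add: m_assoc\<close>)
qed

lemma horizontal_compose:
  assumes h: "horizontal K p g" and \<alpha>: "continuous_on L \<alpha>" "\<alpha> ` L \<subseteq> K"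
  shows "horizontal L (p \<circ> \<alpha>) (g \<circ> \<alpha>)"
proof (rule horizontalI)
  fix t assume t: "t \<in> L"
  then have "\<alpha> t \<in> K" using \<alpha>(2) by auto
  with h obtain W F c V where *: "(W, F) \<in> \<Phi>" "c \<in> carrier G" "open V" "\<alpha> t \<in> V"
    "\<And>s. s \<in> K \<Longrightarrow> s \<in> V \<Longrightarrow> p s \<in> W" "\<And>s. s \<in> K \<Longrightarrow> s \<in> V \<Longrightarrow> g s = c \<otimes> F (p s)"
    by (rule horizontalE) (rule that; (assumption | simp))
  obtain V' where V': "open V'" "t \<in> V'" "\<forall>s\<in>L. s \<in> V' \<longrightarrow> \<alpha> s \<in> V"
    using \<alpha>(1) t *(3,4) unfolding continuous_on_topological by metis
  show "\<exists>W F c V. (W, F) \<in> \<Phi> \<and> c \<in> carrier G \<and> open V \<and> t \<in> V \<and>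
        (\<forall>s\<in>L \<inter> V. (p \<circ> \<alpha>) s \<in> W \<and> (g \<circ> \<alpha>) s = c \<otimes> F ((p \<circ> \<alpha>) s))"
    by (rule exI[of _ W], rule exI[of _ F], rule exI[of _ c], rule exI[of _ V'])
      (use * V' \<alpha>(2) in auto)
qed

lemma horizontal_chart:
  assumes "(W, F) \<in> \<Phi>" "p ` K \<subseteq> W"
  shows "horizontal K p (F \<circ> p)"
proof (rule horizontalI)
  fix t assume "t \<in> K"
  show "\<exists>W F' c V. (W, F') \<in> \<Phi> \<and> c \<in> carrier G \<and> open V \<and> t \<in> V \<and>
        (\<forall>s\<in>K \<inter> V. p s \<in> W \<and> (F \<circ> p) s = c \<otimes> F' (p s))"
    by (rule exI[of _ W], rule exI[of _ F], rule exI[of _ "\<one>"], rule exI[of _ UNIV])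
      (use assms chart_closed[OF assms(1)] in auto)
qed

text \<open>Two charts compare two horizontal functions near each point by a constant, so that their
  ratio is locally constant.\<close>

lemma horizontal_unique:
  assumes h: "horizontal K p g" and h': "horizontal K p g'"
    and p: "continuous_map (top_of_set K) Y p" and K: "connected K"
    and a: "a \<in> K" and b: "b \<in> K"
  shows "inv (g a) \<otimes> g b = inv (g' a) \<otimes> g' b"
proof -
  note cl = horizontal_closed[OF h] horizontal_closed[OF h']
  have "g' a \<otimes> inv (g a) = g' b \<otimes> inv (g b)"
  proof (rule connected_local_const[OF K a b], rule ballI)
    fix t assume t: "t \<in> K"
    from h t obtain W F c V where *: "(W, F) \<in> \<Phi>" "c \<in> carrier G" "open V" "t \<in> V"
      "\<And>s. s \<in> K \<Longrightarrow> s \<in> V \<Longrightarrow> p s \<in> W" "\<And>s. s \<in> K \<Longrightarrow> s \<in> V \<Longrightarrow> g s = c \<otimes> F (p s)"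
      by (rule horizontalE) (rule that; (assumption | simp))
    from h' t obtain W' F' c' V' where **: "(W', F') \<in> \<Phi>" "c' \<in> carrier G" "open V'" "t \<in> V'"
      "\<And>s. s \<in> K \<Longrightarrow> s \<in> V' \<Longrightarrow> p s \<in> W'" "\<And>s. s \<in> K \<Longrightarrow> s \<in> V' \<Longrightarrow> g' s = c' \<otimes> F' (p s)"
      by (rule horizontalE) (rule that; (assumption | simp))
    obtain N d where N: "openin Y N" "p t \<in> N" "N \<subseteq> W \<inter> W'" "d \<in> carrier G" "\<forall>y\<in>N. F' y = d \<otimes> F y"
      using chart_overlap[OF *(1) **(1) *(5)[OF t *(4)] **(5)[OF t **(4)]] by metis
    obtain U where U: "open U" "t \<in> U" "\<And>s. s \<in> K \<Longrightarrow> s \<in> U \<Longrightarrow> p s \<in> N"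
      by (rule continuous_map_nbhd[OF p N(1) t N(2)]) (rule that; (assumption | simp))
    have r: "g' s \<otimes> inv (g s) = c' \<otimes> d \<otimes> inv c" if s: "s \<in> K" "s \<in> V \<inter> V' \<inter> U" for s
    proof -
      have F: "F (p s) \<in> carrier G" using chart_closed[OF *(1) *(5)] s by simp
      have "g s = c \<otimes> F (p s)" "g' s = c' \<otimes> (d \<otimes> F (p s))"
        using *(6) **(6) U(3) N(5) s by simp_all
      then show ?thesis using F *(2) **(2) N(4) by (simp add: inv_mult_group m_assoc)
    qed
    show "\<forall>\<^sub>F s in at t within K. g' t \<otimes> inv (g t) = g' s \<otimes> inv (g s)"
      unfolding eventually_at_topological
    proof (intro exI[of _ "V \<inter> V' \<inter> U"] conjI ballI impI)
      show "open (V \<inter> V' \<inter> U)" using * ** U by auto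
      show t': "t \<in> V \<inter> V' \<inter> U" using * ** U by auto
      fix s assume "s \<in> V \<inter> V' \<inter> U" "s \<in> K"
      then show "g' t \<otimes> inv (g t) = g' s \<otimes> inv (g s)" using r t t' by metis
    qed
  qed
  then have "inv (g' a) \<otimes> (g' a \<otimes> inv (g a)) \<otimes> g b = inv (g' a) \<otimes> (g' b \<otimes> inv (g b)) \<otimes> g b" by simp
  then show ?thesis using cl a b by (simp add: m_assoc)
qed

text \<open>On the overlap the two sections differ by a constant, as it is connected; so one of them can be
  multiplied by a constant to fit the other. At a point of the overlap a single chart then serves
  both sides.\<close>

lemma horizontal_union:
  assumes p: "continuous_map (top_of_set (K1 \<union> K2)) Y p"
    and h1: "horizontal K1 p g1" and h2: "horizontal K2 p g2"
    and K: "closed K1" "closed K2" "connected (K1 \<inter> K2)" "K1 \<inter> K2 \<noteq> {}"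
  shows "\<exists>g. horizontal (K1 \<union> K2) p g"
proof -
  obtain a where a: "a \<in> K1" "a \<in> K2" using K(4) by auto
  define d where "d = g1 a \<otimes> inv (g2 a)"
  have d: "d \<in> carrier G" using a horizontal_closed[OF h1] horizontal_closed[OF h2] by (simp add: d_def)
  define g3 where "g3 t = d \<otimes> g2 t" for t
  have h3: "horizontal K2 p g3" unfolding g3_def by (rule horizontal_translate[OF h2 d])
  have "continuous_map (top_of_set (K1 \<inter> K2)) Y p"
    using continuous_map_from_subtopology_mono[OF p] by (metis Int_lower1 le_supI1)
  then have e0: "inv (g1 a) \<otimes> g1 b = inv (g3 a) \<otimes> g3 b" if "b \<in> K1 \<inter> K2" for b
    by (rule horizontal_unique[rotated 2])
      (use K a that horizontal_compose[OF h1, of _ id] horizontal_compose[OF h3, of _ id] in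
        \<open>auto simp: continuous_on_id\<close>)
  have "g3 a = g1 a"
    unfolding g3_def d_def using a horizontal_closed[OF h1] horizontal_closed[OF h2] by (simp add: m_assoc)
  then have e: "g1 b = g3 b" if "b \<in> K1" "b \<in> K2" for b
    using e0[of b] that a horizontal_closed[OF h1] horizontal_closed[OF h3] by simp
  define g where "g t = (if t \<in> K1 then g1 t else g3 t)" for t
  have g: "t \<in> K1 \<Longrightarrow> g t = g1 t" "t \<in> K2 \<Longrightarrow> g t = g3 t" for t
    using e by (auto simp: g_def)
  have "horizontal (K1 \<union> K2) p g"
  proof (rule horizontalI)
    fix t assume t: "t \<in> K1 \<union> K2"
    consider "t \<in> K1" "t \<notin> K2" | "t \<in> K2" "t \<notin> K1" | "t \<in> K1" "t \<in> K2" using t by auto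
    then show "\<exists>W F c V. (W, F) \<in> \<Phi> \<and> c \<in> carrier G \<and> open V \<and> t \<in> V \<and>
        (\<forall>s\<in>(K1 \<union> K2) \<inter> V. p s \<in> W \<and> g s = c \<otimes> F (p s))"
    proof cases
      case 1
      from h1 1(1) obtain W F c V where *: "(W, F) \<in> \<Phi>" "c \<in> carrier G" "open V" "t \<in> V"
        "\<And>s. s \<in> K1 \<Longrightarrow> s \<in> V \<Longrightarrow> p s \<in> W" "\<And>s. s \<in> K1 \<Longrightarrow> s \<in> V \<Longrightarrow> g1 s = c \<otimes> F (p s)"
        by (rule horizontalE) (rule that; (assumption | simp))
      have "open (V \<inter> - K2)" using *(3) K(2) by auto
      then show ?thesis
        by (intro exI[of _ W] exI[of _ F] exI[of _ c] exI[of _ "V \<inter> - K2"]) (use * 1 g(1) in auto)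
    next
      case 2
      from h3 2(1) obtain W F c V where *: "(W, F) \<in> \<Phi>" "c \<in> carrier G" "open V" "t \<in> V"
        "\<And>s. s \<in> K2 \<Longrightarrow> s \<in> V \<Longrightarrow> p s \<in> W" "\<And>s. s \<in> K2 \<Longrightarrow> s \<in> V \<Longrightarrow> g3 s = c \<otimes> F (p s)"
        by (rule horizontalE) (rule that; (assumption | simp))
      have "open (V \<inter> - K1)" using *(3) K(1) by auto
      then show ?thesis
        by (intro exI[of _ W] exI[of _ F] exI[of _ c] exI[of _ "V \<inter> - K1"]) (use * 2 g(2) in auto)
    next
      case 3
      from h1 3(1) obtain W F c V where *: "(W, F) \<in> \<Phi>" "c \<in> carrier G" "open V" "t \<in> V"
        "\<And>s. s \<in> K1 \<Longrightarrow> s \<in> V \<Longrightarrow> p s \<in> W" "\<And>s. s \<in> K1 \<Longrightarrow> s \<in> V \<Longrightarrow> g1 s = c \<otimes> F (p s)"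
        by (rule horizontalE) (rule that; (assumption | simp))
      from h3 3(2) obtain W' F' c' V' where **: "(W', F') \<in> \<Phi>" "c' \<in> carrier G" "open V'" "t \<in> V'"
        "\<And>s. s \<in> K2 \<Longrightarrow> s \<in> V' \<Longrightarrow> p s \<in> W'" "\<And>s. s \<in> K2 \<Longrightarrow> s \<in> V' \<Longrightarrow> g3 s = c' \<otimes> F' (p s)"
        by (rule horizontalE) (rule that; (assumption | simp))
      obtain N f where N: "openin Y N" "p t \<in> N" "N \<subseteq> W \<inter> W'" "f \<in> carrier G" "\<forall>y\<in>N. F' y = f \<otimes> F y"
        using chart_overlap[OF *(1) **(1) *(5)[OF 3(1) *(4)] **(5)[OF 3(2) **(4)]] by metis
      obtain U where U: "open U" "t \<in> U" "\<And>s. s \<in> K1 \<union> K2 \<Longrightarrow> s \<in> U \<Longrightarrow> p s \<in> N"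
        by (rule continuous_map_nbhd[OF p N(1) t N(2)]) (rule that; (assumption | simp))
      have Fc: "F (p s) \<in> carrier G" if "s \<in> K1 \<union> K2" "s \<in> U" for s
        using chart_closed[OF *(1)] U(3)[OF that] N(3) by auto
      have g3: "g3 s = c' \<otimes> f \<otimes> F (p s)" if "s \<in> K2" "s \<in> V' \<inter> U" for s
        using **(6)[of s] N(5) U(3)[of s] Fc[of s] **(2) N(4) that by (simp add: m_assoc)
      have "c \<otimes> F (p t) = c' \<otimes> f \<otimes> F (p t)"
        using *(6)[OF 3(1) *(4)] g3[OF 3(2)] e[OF 3] **(4) U(2) by simp
      then have c: "c' \<otimes> f = c" using Fc[OF t U(2)] *(2) **(2) N(4) by simp
      have "open (V \<inter> V' \<inter> U)" using * ** U by auto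
      moreover have "p s \<in> W \<and> g s = c \<otimes> F (p s)" if s: "s \<in> (K1 \<union> K2) \<inter> (V \<inter> V' \<inter> U)" for s
      proof
        show "p s \<in> W" using U(3)[of s] s N(3) by auto
        show "g s = c \<otimes> F (p s)"
          using s g[of s] *(6)[of s] g3[of s] c by auto
      qed
      ultimately show ?thesis
        by (intro exI[of _ W] exI[of _ F] exI[of _ c] exI[of _ "V \<inter> V' \<inter> U"]) (use * ** U in auto)
    qed
  qed
  then show ?thesis by blast
qed

text \<open>The square is cut into small rectangles that map into single charts. The bisection principle
  \<open>Bolzano\<close> is used once in each direction: a thin strip around \<open>s\<close> is assembled from small
  rectangles, and the square from thin strips.\<close>

lemma horizontal_exists_square:
  assumes p: "continuous_map (top_of_set ({0..1::real} \<times> {0..1::real})) Y p"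
  shows "\<exists>g. horizontal ({0..1} \<times> {0..1}) p g"
proof -
  have sub: "continuous_map (top_of_set K) Y p" if "K \<subseteq> {0..1} \<times> {0..1}" for K
    using continuous_map_from_subtopology_mono[OF p that] .
  define R where "R a b c d \<longleftrightarrow> (\<exists>g. horizontal ({a..b} \<times> {c..d}) p g)" for a b c d :: real
  have join: "\<exists>g. horizontal K p g"
    if K: "K = K1 \<union> K2" "K \<subseteq> {0..1} \<times> {0..1}" "closed K1" "closed K2" "connected (K1 \<inter> K2)" "K1 \<inter> K2 \<noteq> {}"
      and h: "\<exists>g. horizontal K1 p g" "\<exists>g. horizontal K2 p g" for K K1 K2
  proof -
    obtain g1 where g1: "horizontal K1 p g1" using h(1) by (elim exE)
    obtain g2 where g2: "horizontal K2 p g2" using h(2) by (elim exE)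
    show ?thesis unfolding K(1)
      by (rule horizontal_union[OF _ g1 g2 K(3-6)]) (use sub[OF K(2)] K(1) in simp)
  qed
  have box: "closed ({a..b} \<times> {c..d})" "connected ({a..b} \<times> {c..d})" for a b c d :: real
    by (simp_all add: closed_Times connected_Times)
  have R_fst: "R a c 0 1" if "R a b 0 1" "R b c 0 1" "0 \<le> a" "a \<le> b" "b \<le> c" "c \<le> 1" for a b c
    unfolding R_def
  proof (rule join)
    show "{a..c} \<times> {0..1} = {a..b} \<times> {0..1} \<union> {b..c} \<times> {0..1::real}" using that by auto
    have "({a..b} \<times> {0..1::real}) \<inter> ({b..c} \<times> {0..1}) = {b..b} \<times> {0..1}" using that by auto
    then show "connected (({a..b} \<times> {0..1::real}) \<inter> ({b..c} \<times> {0..1}))"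
      "({a..b} \<times> {0..1::real}) \<inter> ({b..c} \<times> {0..1}) \<noteq> {}" by (simp_all only: box) simp
    show "{a..c} \<times> {0..1} \<subseteq> {0..1} \<times> {0..1::real}" using that by auto
  qed (use that in \<open>simp_all add: box R_def\<close>)
  have R_snd: "R a b c f" if "R a b c d" "R a b d f" "0 \<le> a" "a \<le> b" "b \<le> 1" "0 \<le> c" "c \<le> d" "d \<le> f" "f \<le> 1"
    for a b c d f
    unfolding R_def
  proof (rule join)
    show "{a..b} \<times> {c..f} = {a..b} \<times> {c..d} \<union> {a..b} \<times> {d..f}" using that by auto
    have "({a..b} \<times> {c..d}) \<inter> ({a..b} \<times> {d..f}) = {a..b} \<times> {d..d}" using that by auto
    then show "connected (({a..b} \<times> {c..d}) \<inter> ({a..b} \<times> {d..f}))"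
      "({a..b} \<times> {c..d}) \<inter> ({a..b} \<times> {d..f}) \<noteq> {}" using that by (simp_all only: box) simp
    show "{a..b} \<times> {c..f} \<subseteq> {0..1} \<times> {0..1}" using that by auto
  qed (use that in \<open>simp_all add: box R_def\<close>)
  define P where "P a b \<longleftrightarrow> (0 \<le> a \<and> a \<le> b \<and> b \<le> 1 \<longrightarrow> R a b 0 1)" for a b :: real
  have "P 0 1"
  proof (induction rule: Bolzano[of 0 1 P, OF zero_le_one, case_names trans local])
    case (trans a b c)
    show ?case unfolding P_def
      using R_fst[of a b c] trans unfolding P_def by simp
  next
    case (local s)
    note s = local
    define S where "S e c d \<longleftrightarrow> (\<forall>a b. 0 \<le> a \<and> a \<le> s \<and> s \<le> b \<and> b \<le> 1 \<and> b - a < e \<longrightarrow> R a b c d)" for e c d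
    have SD: "S e c d \<Longrightarrow> 0 \<le> a \<Longrightarrow> a \<le> s \<Longrightarrow> s \<le> b \<Longrightarrow> b \<le> 1 \<Longrightarrow> b - a < e \<Longrightarrow> R a b c d" for a b c d e
      unfolding S_def by simp
    define Q where "Q c d \<longleftrightarrow> (0 \<le> c \<and> c \<le> d \<and> d \<le> 1 \<longrightarrow> (\<exists>e>0. S e c d))" for c d :: real
    have "Q 0 1"
    proof (induction rule: Bolzano[of 0 1 Q, OF zero_le_one, case_names trans local])
      case (trans c d f)
      show ?case unfolding Q_def
      proof
        assume cf: "0 \<le> c \<and> c \<le> f \<and> f \<le> 1"
        obtain e1 where e1: "e1 > 0" "S e1 c d"
          using trans(1,3,4) cf unfolding Q_def by auto
        obtain e2 where e2: "e2 > 0" "S e2 d f"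
          using trans(2,3,4) cf unfolding Q_def by auto
        have "S (min e1 e2) c f"
          unfolding S_def
        proof (intro allI impI)
          fix a b assume ab: "0 \<le> a \<and> a \<le> s \<and> s \<le> b \<and> b \<le> 1 \<and> b - a < min e1 e2"
          show "R a b c f"
            by (rule R_snd[OF SD[OF e1(2)] SD[OF e2(2)]]) (use ab trans(3,4) cf in auto)
        qed
        then show "\<exists>e>0. S e c f" using e1(1) e2(1) by (intro exI[of _ "min e1 e2"]) simp
      qed
    next
      case (local t)
      then have st: "(s, t) \<in> {0..1} \<times> {0..1}" using s by simp
      then have "p (s, t) \<in> topspace Y" using p by (auto simp: continuous_map_def)
      then obtain W F where W: "(W, F) \<in> \<Phi>" "p (s, t) \<in> W" using chart_cover by metis
      obtain V where V: "open V" "(s, t) \<in> V" "\<And>z. z \<in> {0..1} \<times> {0..1} \<Longrightarrow> z \<in> V \<Longrightarrow> p z \<in> W"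
        by (rule continuous_map_nbhd[OF p chart_open[OF W(1)] st W(2)]) (rule that; (assumption | simp))
      obtain A B where AB: "open A" "open B" "s \<in> A" "t \<in> B" "A \<times> B \<subseteq> V"
        using V(1,2) by (metis mem_Sigma_iff open_prod_elim)
      obtain e1 where e1: "e1 > 0" "ball s e1 \<subseteq> A" using AB(1,3) openE by metis
      obtain e2 where e2: "e2 > 0" "ball t e2 \<subseteq> B" using AB(2,4) openE by metis
      have *: "R a b c d"
        if "c \<le> t" "t \<le> d" "d - c < e2" "0 \<le> c" "d \<le> 1" "0 \<le> a" "a \<le> s" "s \<le> b" "b \<le> 1" "b - a < e1" for a b c d
      proof -
        have "{a..b} \<subseteq> ball s e1" "{c..d} \<subseteq> ball t e2" using that by (auto simp: dist_real_def)
        then have "{a..b} \<times> {c..d} \<subseteq> V" using AB(5) e1(2) e2(2) by (meson Sigma_mono order_trans)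
        moreover have "{a..b} \<times> {c..d} \<subseteq> {0..1} \<times> {0..1}" using that by auto
        ultimately have "p ` ({a..b} \<times> {c..d}) \<subseteq> W" using V(3) by (meson image_subsetI subsetD)
        then show ?thesis unfolding R_def by (intro exI[of _ "F \<circ> p"] horizontal_chart[OF W(1)])
      qed
      have "S e1 c d" if "c \<le> t" "t \<le> d" "d - c < e2" "0 \<le> c" "d \<le> 1" for c d
        unfolding S_def using *[OF that] by simp
      then show ?case
        unfolding Q_def using e1(1) by (intro exI[of _ e2] conjI allI impI e2(1) exI[of _ e1]) simp_all
    qed
    then obtain e where e: "e > 0" "S e 0 1" unfolding Q_def by auto
    show ?case unfolding P_def by (intro exI[of _ e] conjI allI impI e(1) SD[OF e(2)]) auto
  qed
  then show ?thesis unfolding P_def R_def by simp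
qed

lemma horizontal_exists_path:
  assumes p: "pathin Y p" shows "\<exists>g. horizontal {0..1} p g"
proof -
  have "continuous_map (top_of_set ({0..1::real} \<times> {0..1})) Y (p \<circ> snd)"
    using p unfolding pathin_def by (rule continuous_map_compose[rotated]) (auto intro!: continuous_map_I continuous_intros)
  then obtain g where g: "horizontal ({0..1::real} \<times> {0..1}) (p \<circ> snd) g" using horizontal_exists_square by blast
  have "horizontal {0..1} ((p \<circ> snd) \<circ> (\<lambda>t. (0::real, t))) (g \<circ> (\<lambda>t. (0, t)))"
    by (rule horizontal_compose[OF g]) (auto intro!: continuous_intros)
  then have "horizontal {0..1} p (g \<circ> (\<lambda>t. (0, t)))"
    by (rule horizontal_cong) simp_all
  then show ?thesis by (intro exI[of _ "g \<circ> (\<lambda>t. (0, t))"])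
qed

definition holonomy :: "(real \<Rightarrow> 'y) \<Rightarrow> 'a" where
  "holonomy p = (SOME x. \<exists>g. horizontal {0..1} p g \<and> x = inv (g 0) \<otimes> g 1)"

lemma holonomy_eq:
  assumes p: "pathin Y p" and g: "horizontal {0..1} p g"
  shows "holonomy p = inv (g 0) \<otimes> g 1"
proof -
  have "\<exists>g. horizontal {0..1} p g \<and> holonomy p = inv (g 0) \<otimes> g 1"
    unfolding holonomy_def by (rule someI_ex) (use g in blast)
  then obtain g' where g': "horizontal {0..1} p g'" "holonomy p = inv (g' 0) \<otimes> g' 1" by blast
  show ?thesis unfolding g'(2)
    by (rule horizontal_unique[OF g'(1) g p[unfolded pathin_def]]) auto
qed

lemma holonomy_chart:
  assumes p: "pathin Y p" and W: "(W, F) \<in> \<Phi>" and pW: "\<And>t. t \<in> {0..1} \<Longrightarrow> p t \<in> W"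
  shows "holonomy p = inv (F (p 0)) \<otimes> F (p 1)"
  using holonomy_eq[OF p horizontal_chart[OF W]] pW by (simp add: image_subset_iff)

text \<open>For a homotopy, lift the whole square: along the two sides where the end points rest the
  horizontal section is constant, so both paths have the same holonomy.\<close>

lemma path_transport_holonomy: "path_transport G Y holonomy"
  unfolding path_transport_def
proof (intro conjI allI impI)
  fix p assume p: "pathin Y p"
  obtain g where g: "horizontal {0..1} p g" using horizontal_exists_path[OF p] by blast
  show "holonomy p \<in> carrier G"
    using holonomy_eq[OF p g] horizontal_closed[OF g] by simp
next
  fix p q assume p: "pathin Y p" and q: "pathin Y q" and e: "p 1 = q 0"
  have pq: "pathin Y (loop_concat p q)" by (rule pathin_loop_concat[OF p q e])
  obtain g where g: "horizontal {0..1} (loop_concat p q) g" using horizontal_exists_path[OF pq] by blast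
  have "horizontal {0..1} (loop_concat p q \<circ> (\<lambda>t. t/2)) (g \<circ> (\<lambda>t. t/2))"
    by (rule horizontal_compose[OF g]) (auto intro!: continuous_intros)
  then have 1: "horizontal {0..1} p (g \<circ> (\<lambda>t. t/2))"
    by (rule horizontal_cong) (auto simp: loop_concat_def)
  have "horizontal {0..1} (loop_concat p q \<circ> (\<lambda>t. t/2+1/2)) (g \<circ> (\<lambda>t. t/2+1/2))"
    by (rule horizontal_compose[OF g]) (auto intro!: continuous_intros)
  then have 2: "horizontal {0..1} q (g \<circ> (\<lambda>t. t/2+1/2))"
    by (rule horizontal_cong) (auto simp: loop_concat_def e field_simps)
  have "g 0 \<in> carrier G" "g (1/2) \<in> carrier G" "g 1 \<in> carrier G" using horizontal_closed[OF g] by auto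
  then show "holonomy (loop_concat p q) = holonomy p \<otimes> holonomy q"
    unfolding holonomy_eq[OF p 1] holonomy_eq[OF q 2] holonomy_eq[OF pq g] by (simp add: m_assoc)
next
  fix p q assume pq: "path_homotopic Y p q"
  then obtain H where H: "continuous_map (top_of_set ({0..1::real} \<times> {0..1})) Y H"
        "\<And>t. t\<in>{0..1} \<Longrightarrow> H (0, t) = p t \<and> H (1, t) = q t"
        "\<And>s. s\<in>{0..1} \<Longrightarrow> H (s, 0) = p 0 \<and> H (s, 1) = p 1"
    unfolding path_homotopic_iff by blast
  obtain g where g: "horizontal ({0..1::real} \<times> {0..1}) H g" using horizontal_exists_square[OF H(1)] by blast
  have r: "horizontal {0..1} (H \<circ> (\<lambda>t. (s, t))) (g \<circ> (\<lambda>t. (s, t)))" if "s \<in> {0..1}" for s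
    by (rule horizontal_compose[OF g]) (use that in \<open>auto intro!: continuous_intros\<close>)
  have c: "horizontal {0..1} (H \<circ> (\<lambda>t. (t, s))) (g \<circ> (\<lambda>t. (t, s)))" if "s \<in> {0..1}" for s
    by (rule horizontal_compose[OF g]) (use that in \<open>auto intro!: continuous_intros\<close>)
  have 1: "horizontal {0..1} p (g \<circ> (\<lambda>t. (0, t)))" "horizontal {0..1} q (g \<circ> (\<lambda>t. (1, t)))"
    by (rule horizontal_cong[OF r[of 0]] horizontal_cong[OF r[of 1]]; use H(2) in simp)+
  have gc: "g z \<in> carrier G" if "z \<in> {0..1} \<times> {0..1}" for z using horizontal_closed[OF g that] .
  have side: "g (1, s) = g (0, s)" if s: "s \<in> {0, 1}" for s
  proof -
    have x: "H (0, s) \<in> topspace Y" using H(1) s by (auto simp: continuous_map_def)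
    obtain W F where W: "(W, F) \<in> \<Phi>" "H (0, s) \<in> W" using chart_cover[OF x] by metis
    have e: "horizontal {0..1} (\<lambda>_. H (0, s)) (g \<circ> (\<lambda>t. (t, s)))"
      by (rule horizontal_cong[OF c[of s]]) (use H(2)[of s] H(3) s in \<open>auto simp: H(2)\<close>)
    have "inv ((g \<circ> (\<lambda>t. (t, s))) 0) \<otimes> (g \<circ> (\<lambda>t. (t, s))) 1
      = inv ((F \<circ> (\<lambda>_. H (0, s))) (0::real)) \<otimes> (F \<circ> (\<lambda>_. H (0, s))) (1::real)"
      by (rule horizontal_unique[OF e horizontal_chart[OF W(1)]]) (use W x in auto)
    then have "inv (g (0, s)) \<otimes> g (1, s) = \<one>" using chart_closed[OF W] by simp
    moreover have "g (0, s) \<in> carrier G" "g (1, s) \<in> carrier G" using gc s by auto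
    ultimately show ?thesis by (metis inv_closed inv_equality inv_inv)
  qed
  show "holonomy p = holonomy q"
    unfolding holonomy_eq[OF path_homotopic_pathin(1)[OF pq] 1(1)] holonomy_eq[OF path_homotopic_pathin(2)[OF pq] 1(2)]
    using side by simp
qed

end

section \<open>Gluing along closed subspaces\<close>

text \<open>Two spaces glued along a homeomorphism \<open>f\<close> between closed subspaces. Then both spaces embed as
  closed subspaces of the result (\<open>closedin_inl\<close>, \<open>closedin_inr\<close>).\<close>

locale gluing =
  fixes X :: "'x topology" and S :: "'x set" and f :: "'x \<Rightarrow> 'z" and Z :: "'z topology"
  assumes closed_left: "closedin X S" and closed_right: "closedin Z (f ` S)"
    and seam_homeo: "homeomorphic_map (subtopology X S) (subtopology Z (f ` S)) f"
begin

abbreviation "Y \<equiv> glue X S f Z"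
abbreviation "inl x \<equiv> glue_class S f (Inl x)"
abbreviation "inr y \<equiv> glue_class S f (Inr y)"

lemma S_subset: "S \<subseteq> topspace X" and fS_subset: "f ` S \<subseteq> topspace Z"
  using closed_left closed_right closedin_subset by blast+

lemma inj_seam: "x \<in> S \<Longrightarrow> x' \<in> S \<Longrightarrow> f x = f x' \<longleftrightarrow> x = x'"
  using homeomorphic_imp_injective_map[OF seam_homeo] S_subset by (auto simp: inj_on_def)

lemma mem_classes:
  "Inl a \<in> inl x \<longleftrightarrow> a = x" "Inr b \<in> inl x \<longleftrightarrow> x \<in> S \<and> b = f x"
  "Inl a \<in> inr y \<longleftrightarrow> a \<in> S \<and> f a = y" "Inr b \<in> inr y \<longleftrightarrow> b = y"
  by (auto simp: glue_class_def)

lemma inl_eq_inl [simp]: "inl x = inl x' \<longleftrightarrow> x = x'"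
  using mem_classes(1)[of x x] mem_classes(1)[of x x'] by auto

lemma inr_eq_inr [simp]: "inr y = inr y' \<longleftrightarrow> y = y'"
  using mem_classes(4)[of y y] mem_classes(4)[of y y'] by auto

lemma inl_eq_inr: "inl x = inr y \<longleftrightarrow> x \<in> S \<and> y = f x"
proof
  assume "inl x = inr y"
  then show "x \<in> S \<and> y = f x" using mem_classes(1)[of x x] mem_classes(3)[of x y] by simp
next
  assume *: "x \<in> S \<and> y = f x"
  have "z \<in> inl x \<longleftrightarrow> z \<in> inr y" for z
    using * inj_seam by (cases z) (auto simp: mem_classes)
  then show "inl x = inr y" by blast
qed

lemma inr_eq_inl: "inr y = inl x \<longleftrightarrow> x \<in> S \<and> y = f x"
  using inl_eq_inr[of x y] by (simp add: eq_commute)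

lemma inl_seam: "x \<in> S \<Longrightarrow> inl x = inr (f x)"
  by (simp add: inl_eq_inr)

lemma topspace_Y: "topspace Y = inl ` topspace X \<union> inr ` topspace Z"
  by (simp add: topspace_glue image_Un image_image)

lemma Y_cases:
  assumes "w \<in> topspace Y"
  obtains (seam) x where "x \<in> S" "inl x = w" | (left) x where "x \<in> topspace X" "x \<notin> S" "inl x = w"
    | (right) y where "y \<in> topspace Z" "y \<notin> f ` S" "inr y = w"
proof -
  consider x where "x \<in> topspace X" "w = inl x" | y where "y \<in> topspace Z" "w = inr y"
    using assms unfolding topspace_Y by auto
  then show thesis
  proof cases
    case 1 then show thesis using seam left by metis
  next
    case 2
    show thesis
    proof (cases "y \<in> f ` S")
      case True
      then obtain x where "x \<in> S" "y = f x" by auto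
      then show thesis using 2 seam inl_seam by metis
    next
      case False then show thesis using 2 right by metis
    qed
  qed
qed

lemma openin_preimages:
  assumes "openin Y W"
  shows "openin X {x \<in> topspace X. inl x \<in> W}" "openin Z {y \<in> topspace Z. inr y \<in> W}"
  using assms by (simp_all add: openin_glue glue_open_def)

lemma continuous_inl: "continuous_map X Y inl" and continuous_inr: "continuous_map Z Y inr"
  unfolding continuous_map topspace_Y using openin_preimages by simp_all

text \<open>Pairs of open sets that form the two halves of an open set of the glued space.\<close>

definition matching :: "'x set \<Rightarrow> 'z set \<Rightarrow> bool" where
  "matching U1 U2 \<longleftrightarrow> openin X U1 \<and> openin Z U2 \<and> (\<forall>x\<in>S. x \<in> U1 \<longleftrightarrow> f x \<in> U2)"

lemma matchingD:
  assumes "matching U1 U2"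
  shows "openin X U1" "openin Z U2" "x \<in> S \<Longrightarrow> x \<in> U1 \<longleftrightarrow> f x \<in> U2" "U1 \<subseteq> topspace X" "U2 \<subseteq> topspace Z"
  using assms openin_subset unfolding matching_def by auto

lemma matching_preimages:
  assumes "matching U1 U2"
  shows "inl x \<in> inl ` U1 \<union> inr ` U2 \<longleftrightarrow> x \<in> U1" "inr y \<in> inl ` U1 \<union> inr ` U2 \<longleftrightarrow> y \<in> U2"
  using matchingD(3)[OF assms] by (simp_all add: image_iff inl_eq_inr inr_eq_inl) blast+

lemma openin_matching:
  assumes "matching U1 U2" shows "openin Y (inl ` U1 \<union> inr ` U2)"
proof -
  have "{x \<in> topspace X. inl x \<in> inl ` U1 \<union> inr ` U2} = U1"
    "{y \<in> topspace Z. inr y \<in> inl ` U1 \<union> inr ` U2} = U2"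
    using matching_preimages[OF assms] matchingD(4,5)[OF assms] by auto
  moreover have "inl ` U1 \<union> inr ` U2 \<subseteq> topspace Y"
    using matchingD(4,5)[OF assms] by (auto simp: topspace_Y)
  ultimately show ?thesis
    using matchingD(1,2)[OF assms] topspace_glue[of X S f Z] by (simp add: openin_glue glue_open_def)
qed

text \<open>The two sides of a neighbourhood of a seam point are cut down so as to meet the seam in the
  same set; off the seam one side is empty.\<close>

lemma matching_nbhd:
  assumes w: "w \<in> topspace Y" and N: "openin X N1" "openin Z N2"
    and wN: "\<And>x. x \<in> topspace X \<Longrightarrow> inl x = w \<Longrightarrow> x \<in> N1" "\<And>y. y \<in> topspace Z \<Longrightarrow> inr y = w \<Longrightarrow> y \<in> N2"
  shows "\<exists>U1 U2. matching U1 U2 \<and> U1 \<subseteq> N1 \<and> U2 \<subseteq> N2 \<and> w \<in> inl ` U1 \<union> inr ` U2"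
proof -
  from w show ?thesis
  proof (cases rule: Y_cases)
    case (left x)
    have "matching (N1 - S) {}"
      unfolding matching_def using N closed_left by (auto intro: openin_diff)
    then show ?thesis using left wN(1) by (intro exI[of _ "N1 - S"] exI[of _ "{}"]) auto
  next
    case (right y)
    have "matching {} (N2 - f ` S)"
      unfolding matching_def using N closed_right by (auto intro: openin_diff)
    then show ?thesis using right wN(2) by (intro exI[of _ "{}"] exI[of _ "N2 - f ` S"]) auto
  next
    case (seam x)
    have x: "x \<in> topspace X" "f x \<in> topspace Z" using seam S_subset fS_subset by auto
    \<comment> \<open>The common trace on the seam; \<open>O1\<close> and \<open>O2\<close> are open sets with this trace.\<close>
    define D where "D = {d \<in> S. d \<in> N1 \<and> f d \<in> N2}"
    have "openin (subtopology X S) {d \<in> topspace (subtopology X S). f d \<in> N2 \<inter> f ` S}"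
      by (rule openin_continuous_map_preimage[OF homeomorphic_imp_continuous_map[OF seam_homeo]])
        (simp add: N openin_subtopology_Int)
    moreover have "openin (subtopology X S) (N1 \<inter> S)" by (simp add: N openin_subtopology_Int)
    ultimately have "openin (subtopology X S) ((N1 \<inter> S) \<inter> {d \<in> topspace (subtopology X S). f d \<in> N2 \<inter> f ` S})"
      by (rule openin_Int[rotated])
    moreover have "(N1 \<inter> S) \<inter> {d \<in> topspace (subtopology X S). f d \<in> N2 \<inter> f ` S} = D"
      using S_subset by (auto simp: D_def)
    ultimately have D: "openin (subtopology X S) D" by simp
    then obtain O1 where O1: "openin X O1" "D = O1 \<inter> S" unfolding openin_subtopology by auto
    have "openin (subtopology Z (f ` S)) (f ` D)"
      using homeomorphic_imp_open_map[OF seam_homeo] D by (simp add: open_map_def)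
    then obtain O2 where O2: "openin Z O2" "f ` D = O2 \<inter> f ` S" unfolding openin_subtopology by auto
    have fD: "f d \<in> f ` D \<longleftrightarrow> d \<in> D" if "d \<in> S" for d
      using inj_seam that by (auto simp: D_def)
    have m: "matching (N1 \<inter> O1) (N2 \<inter> O2)"
      unfolding matching_def
    proof (intro conjI ballI openin_Int N O1(1) O2(1))
      fix d assume d: "d \<in> S"
      have "d \<in> N1 \<inter> O1 \<longleftrightarrow> d \<in> D" using d O1(2) by (auto simp: D_def)
      moreover have "f d \<in> f ` D \<longleftrightarrow> f d \<in> O2" using d unfolding O2(2) by simp
      moreover have "f d \<in> f ` D \<longrightarrow> f d \<in> N2" by (auto simp: D_def)
      ultimately show "d \<in> N1 \<inter> O1 \<longleftrightarrow> f d \<in> N2 \<inter> O2" using fD[OF d] by blast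
    qed
    have "x \<in> D" using wN(1)[OF x(1) seam(2)] wN(2)[OF x(2)] seam inl_seam[OF seam(1)] by (simp add: D_def)
    then have "x \<in> N1 \<inter> O1" using O1(2) by (auto simp: D_def)
    with m show ?thesis using seam(2) by (intro exI[of _ "N1 \<inter> O1"] exI[of _ "N2 \<inter> O2"]) auto
  qed
qed

lemma closed_seam_image: "closedin X C \<Longrightarrow> closedin Z (f ` (C \<inter> S))"
proof -
  assume C: "closedin X C"
  have "closedin (subtopology X S) (C \<inter> S)" using C by (auto simp: closedin_subtopology)
  then have "closedin (subtopology Z (f ` S)) (f ` (C \<inter> S))"
    using homeomorphic_imp_closed_map[OF seam_homeo] by (simp add: closed_map_def)
  then show ?thesis using closed_right by (rule closedin_trans_full)
qed

lemma closed_seam_preimage: "closedin Z C \<Longrightarrow> closedin X {x \<in> S. f x \<in> C}"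
proof -
  assume C: "closedin Z C"
  have "continuous_map (subtopology X S) Z f"
    using homeomorphic_imp_continuous_map[OF seam_homeo] by (simp add: continuous_map_in_subtopology)
  then have "closedin (subtopology X S) {x \<in> topspace (subtopology X S). f x \<in> C}"
    using C by (rule closedin_continuous_map_preimage)
  moreover have "{x \<in> topspace (subtopology X S). f x \<in> C} = {x \<in> S. f x \<in> C}" using S_subset by auto
  ultimately show ?thesis using closed_left by (metis closedin_trans_full)
qed

lemma closedin_inl: "closedin X C \<Longrightarrow> closedin Y (inl ` C)"
proof -
  assume C: "closedin X C"
  have m: "matching (topspace X - C) (topspace Z - f ` (C \<inter> S))"
    unfolding matching_def using C closed_seam_image[OF C] S_subset fS_subset inj_seam
    by (auto intro!: openin_diff)
  have "topspace Y - inl ` C = inl ` (topspace X - C) \<union> inr ` (topspace Z - f ` (C \<inter> S))"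
    using inl_seam S_subset closedin_subset[OF C] unfolding topspace_Y
    by (auto simp: inl_eq_inr inr_eq_inl image_iff)
  then show ?thesis
    using openin_matching[OF m] closedin_subset[OF C] by (auto simp: closedin_def topspace_Y)
qed

lemma closedin_inr: "closedin Z C \<Longrightarrow> closedin Y (inr ` C)"
proof -
  assume C: "closedin Z C"
  have m: "matching (topspace X - {x \<in> S. f x \<in> C}) (topspace Z - C)"
    unfolding matching_def using C closed_seam_preimage[OF C] S_subset fS_subset
    by (auto intro!: openin_diff)
  have "topspace Y - inr ` C = inl ` (topspace X - {x \<in> S. f x \<in> C}) \<union> inr ` (topspace Z - C)"
    using closedin_subset[OF C] unfolding topspace_Y
    by (auto simp: inl_eq_inr inr_eq_inl image_iff)
  then show ?thesis
    using openin_matching[OF m] closedin_subset[OF C] by (auto simp: closedin_def topspace_Y)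
qed

lemma homeomorphic_inl: "homeomorphic_map X (subtopology Y (inl ` topspace X)) inl"
proof (rule bijective_closed_imp_homeomorphic_map)
  show "continuous_map X (subtopology Y (inl ` topspace X)) inl"
    using continuous_inl by (simp add: continuous_map_in_subtopology)
  show "closed_map X (subtopology Y (inl ` topspace X)) inl"
    unfolding closed_map_def using closedin_inl closedin_subset
    by (metis closedin_subset_topspace image_mono)
qed (auto simp: topspace_Y inj_on_def)

lemma homeomorphic_inr: "homeomorphic_map Z (subtopology Y (inr ` topspace Z)) inr"
proof (rule bijective_closed_imp_homeomorphic_map)
  show "continuous_map Z (subtopology Y (inr ` topspace Z)) inr"
    using continuous_inr by (simp add: continuous_map_in_subtopology)
  show "closed_map Z (subtopology Y (inr ` topspace Z)) inr"
    unfolding closed_map_def using closedin_inr closedin_subset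
    by (metis closedin_subset_topspace image_mono)
qed (auto simp: topspace_Y inj_on_def)

end

section \<open>Spaces with convex patches\<close>

text \<open>The local property of 3-manifolds with boundary that is used: small half balls are convex.\<close>

definition convex_patches :: "'a topology \<Rightarrow> bool" where
  "convex_patches X \<longleftrightarrow> (\<forall>V x. openin X V \<and> x \<in> V \<longrightarrow> (\<exists>N K m k. openin X N \<and> x \<in> N \<and> N \<subseteq> V \<and>
     convex (K :: (real ^ 3) set) \<and> homeomorphic_maps (top_of_set K) (subtopology X N) m k))"

lemma convex_patchE:
  assumes "convex_patches X" "openin X V" "x \<in> V"
  obtains N K m k where "openin X N" "x \<in> N" "N \<subseteq> V" "convex (K :: (real ^ 3) set)"
     "continuous_map (top_of_set K) X m" "m ` K \<subseteq> N" "continuous_map (subtopology X N) (top_of_set K) k"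
     "\<And>y. y \<in> N \<Longrightarrow> k y \<in> K" "\<And>y. y \<in> N \<Longrightarrow> m (k y) = y"
proof -
  obtain N K m k where *: "openin X N" "x \<in> N" "N \<subseteq> V" "convex (K :: (real ^ 3) set)"
     "homeomorphic_maps (top_of_set K) (subtopology X N) m k"
    using assms unfolding convex_patches_def by metis
  have t: "topspace (subtopology X N) = N" using openin_subset[OF *(1)] by auto
  show thesis
  proof (rule that[OF *(1-4)])
    show "continuous_map (top_of_set K) X m" "m ` K \<subseteq> N" "continuous_map (subtopology X N) (top_of_set K) k"
      using *(5) by (auto simp: homeomorphic_maps_def continuous_map_in_subtopology)
    show "k y \<in> K" "m (k y) = y" if "y \<in> N" for y
      using *(5) t that unfolding homeomorphic_maps_def by (auto simp: continuous_map_in_subtopology)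
  qed
qed

lemma convex_patches_path_connected:
  assumes "convex_patches X" "openin X V" "x \<in> V"
  shows "\<exists>N. openin X N \<and> x \<in> N \<and> N \<subseteq> V \<and>
    (\<forall>y\<in>N. \<exists>q. pathin X q \<and> (\<forall>t\<in>{0..1}. q t \<in> N) \<and> q 0 = x \<and> q 1 = y)"
proof (rule convex_patchE[OF assms], goal_cases)
  case (1 N K m k)
  have "\<exists>q. pathin X q \<and> (\<forall>t\<in>{0..1}. q t \<in> N) \<and> q 0 = x \<and> q 1 = y" if y: "y \<in> N" for y
  proof (intro exI[of _ "m \<circ> linepath (k x) (k y)"] conjI ballI)
    have p: "pathin (top_of_set K) (linepath (k x) (k y))" using 1 y by (intro pathin_linepath) auto
    show "pathin X (m \<circ> linepath (k x) (k y))" by (rule pathin_compose[OF p 1(5)])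
    fix t :: real assume "t \<in> {0..1}"
    then show "(m \<circ> linepath (k x) (k y)) t \<in> N"
      using p 1(6) unfolding pathin_top_of_set by (simp add: image_subset_iff)
  qed (use 1 y in \<open>auto simp: linepath_0' linepath_1'\<close>)
  then show ?case using 1 by blast
qed

text \<open>On \<open>N\<close> the transport is the coboundary of a function on points.\<close>

definition (in group) potential ::
    "'x topology \<Rightarrow> ((real \<Rightarrow> 'x) \<Rightarrow> 'a) \<Rightarrow> 'x set \<Rightarrow> ('x \<Rightarrow> 'a) \<Rightarrow> bool" where
  "potential X \<tau> N F \<longleftrightarrow> (\<forall>y\<in>N. F y \<in> carrier G) \<and>
     (\<forall>q. pathin X q \<and> (\<forall>t\<in>{0..1}. q t \<in> N) \<longrightarrow> \<tau> q = inv (F (q 0)) \<otimes> F (q 1))"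

lemma (in group) potentialD:
  assumes "potential X \<tau> N F"
  shows "y \<in> N \<Longrightarrow> F y \<in> carrier G"
    and "pathin X q \<Longrightarrow> (\<And>t. t \<in> {0..1} \<Longrightarrow> q t \<in> N) \<Longrightarrow> \<tau> q = inv (F (q 0)) \<otimes> F (q 1)"
  using assms unfolding potential_def by auto

lemma (in group) potential_mono:
  assumes "potential X \<tau> N F" "M \<subseteq> N" "\<And>y. y \<in> M \<Longrightarrow> F' y = F y" shows "potential X \<tau> M F'"
  unfolding potential_def
proof (intro conjI ballI allI impI)
  fix y assume "y \<in> M" then show "F' y \<in> carrier G" using assms potentialD(1)[OF assms(1)] by auto
next
  fix q assume q: "pathin X q \<and> (\<forall>t\<in>{0..1}. q t \<in> M)"
  then have e: "q 0 \<in> M" "q 1 \<in> M" by auto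
  have "\<tau> q = inv (F (q 0)) \<otimes> F (q 1)"
    by (rule potentialD(2)[OF assms(1)]) (use q assms(2) in auto)
  then show "\<tau> q = inv (F' (q 0)) \<otimes> F' (q 1)"
    unfolding assms(3)[OF e(1)] assms(3)[OF e(2)] .
qed

text \<open>Within a convex patch the value on a path depends only on the end points.\<close>

lemma (in group) potential_exists:
  assumes X: "convex_patches X" "openin X V" "x \<in> V" and \<tau>: "path_transport G X \<tau>"
  shows "\<exists>N F. openin X N \<and> x \<in> N \<and> N \<subseteq> V \<and> potential X \<tau> N F \<and> F x = \<one>"
proof (rule convex_patchE[OF X], goal_cases)
  case (1 N K m k)
  have l: "pathin X (m \<circ> linepath a b)" if "a \<in> K" "b \<in> K" for a b
    by (rule pathin_compose[OF pathin_linepath[OF 1(4) that] 1(5)])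
  define F where "F y = \<tau> (m \<circ> linepath (k x) (k y))" for y
  have "potential X \<tau> N F"
    unfolding potential_def
  proof (intro conjI ballI allI impI)
    show F: "F y \<in> carrier G" if "y \<in> N" for y
      unfolding F_def using that 1(2,8) by (intro transport_closed[OF \<tau>] l)
    fix q assume q: "pathin X q \<and> (\<forall>t\<in>{0..1}. q t \<in> N)"
    have e: "q 0 \<in> N" "q 1 \<in> N" using q by auto
    have "pathin (subtopology X N) q" using q by (simp add: pathin_subtopology)
    then have kq: "pathin (top_of_set K) (k \<circ> q)" by (rule pathin_compose[OF _ 1(7)])
    have "\<tau> q = \<tau> (m \<circ> (k \<circ> q))"
      by (rule transport_cong[OF \<tau>, symmetric]) (use q 1(9) in auto)
    also have "\<dots> = \<tau> (m \<circ> linepath (k (q 0)) (k (q 1)))"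
      by (rule transport_convex[OF \<tau> 1(4,5) kq pathin_linepath[OF 1(4)]])
        (use e 1(8) in \<open>simp_all add: linepath_0' linepath_1'\<close>)
    finally have t: "\<tau> q = \<tau> (m \<circ> linepath (k (q 0)) (k (q 1)))" .
    have "F (q 1) = F (q 0) \<otimes> \<tau> q"
      unfolding F_def t using e 1(2,8) by (intro transport_line[OF \<tau> 1(4,5)])
    then show "\<tau> q = inv (F (q 0)) \<otimes> F (q 1)"
      using F[OF e(1)] transport_closed[OF \<tau>] q by simp
  qed
  moreover have "F x = \<one>"
    unfolding F_def by (rule transport_closed_path[OF \<tau> 1(4,5) pathin_linepath[OF 1(4)]])
      (use 1(2,8) in \<open>simp_all add: linepath_0' linepath_1'\<close>)
  ultimately show ?case using 1(1-3) by (intro exI[of _ N] exI[of _ F]) simp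
qed

section \<open>Gluing transports\<close>

locale glued_transports = group G + gluing X S f Z
  for G :: "('g, 'm) monoid_scheme" (structure)
    and X :: "'x topology" and S :: "'x set" and f :: "'x \<Rightarrow> 'z" and Z :: "'z topology" +
  fixes \<tau>1 :: "(real \<Rightarrow> 'x) \<Rightarrow> 'g" and \<tau>2 :: "(real \<Rightarrow> 'z) \<Rightarrow> 'g"
  assumes transport1: "path_transport G X \<tau>1" and transport2: "path_transport G Z \<tau>2"
    and patches1: "convex_patches X" and patches2: "convex_patches Z"
    and seam_connected: "locally_path_connected_space (subtopology X S)"
    and agree: "\<And>p. pathin (subtopology X S) p \<Longrightarrow> \<tau>1 p = \<tau>2 (f \<circ> p)"
begin

definition charts :: "(('x + 'z) set set \<times> (('x + 'z) set \<Rightarrow> 'g)) set" where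
  "charts = {(W, F). openin Y W \<and> (\<forall>w\<in>W. F w \<in> carrier G) \<and>
     potential X \<tau>1 {x \<in> topspace X. inl x \<in> W} (\<lambda>x. F (inl x)) \<and>
     potential Z \<tau>2 {y \<in> topspace Z. inr y \<in> W} (\<lambda>y. F (inr y))}"

lemma chart_of_matching:
  assumes m: "matching U1 U2" and F: "potential X \<tau>1 U1 F1" "potential Z \<tau>2 U2 F2"
    and e: "\<And>x. x \<in> S \<Longrightarrow> x \<in> U1 \<Longrightarrow> F1 x = F2 (f x)"
  shows "\<exists>F. (inl ` U1 \<union> inr ` U2, F) \<in> charts"
proof -
  let ?W = "inl ` U1 \<union> inr ` U2"
  define F where "F w = (if w \<in> inl ` U1 then F1 (the_inv_into U1 inl w) else F2 (the_inv_into U2 inr w))" for w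
  have inj: "the_inv_into A inl (inl x) = x" if "x \<in> A" for A x
    using that by (intro the_inv_into_f_f) (auto simp: inj_on_def)
  have inj': "the_inv_into A inr (inr x) = x" if "x \<in> A" for A x
    using that by (intro the_inv_into_f_f) (auto simp: inj_on_def)
  have Fl: "F (inl x) = F1 x" if "x \<in> U1" for x
    using that by (simp add: F_def inj)
  have Fr: "F (inr y) = F2 y" if y: "y \<in> U2" for y
  proof (cases "inr y \<in> inl ` U1")
    case True
    then obtain x where x: "x \<in> U1" "inr y = inl x" by auto
    then have "x \<in> S" "y = f x" using inl_eq_inr[of x y] by auto
    then show ?thesis using Fl[OF x(1)] x e by simp
  next
    case False
    then show ?thesis using y by (simp add: F_def inj')
  qed
  have "{x \<in> topspace X. inl x \<in> ?W} = U1" "{y \<in> topspace Z. inr y \<in> ?W} = U2"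
    using matching_preimages[OF m] matchingD(4,5)[OF m] by auto
  moreover have "potential X \<tau>1 U1 (\<lambda>x. F (inl x))" by (rule potential_mono[OF F(1)]) (use Fl in auto)
  moreover have "potential Z \<tau>2 U2 (\<lambda>x. F (inr x))" by (rule potential_mono[OF F(2)]) (use Fr in auto)
  moreover have "F w \<in> carrier G" if "w \<in> ?W" for w
    using that Fl Fr potentialD(1)[OF F(1)] potentialD(1)[OF F(2)] by auto
  ultimately show ?thesis
    unfolding charts_def using openin_matching[OF m] by (intro exI[of _ F]) simp
qed

text \<open>At a seam point the two potentials are normalized to one there; they then agree along any
  path-connected piece of the seam, because the two transports do.\<close>

lemma charts_cover:
  assumes w: "w \<in> topspace Y" shows "\<exists>W F. (W, F) \<in> charts \<and> w \<in> W"
proof -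
  from w have "\<exists>N1 F1 N2 F2. openin X N1 \<and> openin Z N2 \<and> potential X \<tau>1 N1 F1 \<and> potential Z \<tau>2 N2 F2 \<and>
    (\<forall>x\<in>topspace X. inl x = w \<longrightarrow> x \<in> N1) \<and> (\<forall>y\<in>topspace Z. inr y = w \<longrightarrow> y \<in> N2) \<and>
    (\<forall>d\<in>S. d \<in> N1 \<and> f d \<in> N2 \<longrightarrow> F1 d = F2 (f d))"
  proof (cases rule: Y_cases)
    case (left x)
    obtain N1 F1 where N1: "openin X N1" "x \<in> N1" "N1 \<subseteq> topspace X" "potential X \<tau>1 N1 F1" "F1 x = \<one>"
      using potential_exists[OF patches1 openin_topspace left(1) transport1] by metis
    have "potential Z \<tau>2 {} undefined" unfolding potential_def by auto
    then show ?thesis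
      using N1 left by (intro exI[of _ N1] exI[of _ F1] exI[of _ "{}"] exI[of _ undefined])
        (auto simp: inl_eq_inr inr_eq_inl)
  next
    case (right y)
    obtain N2 F2 where N2: "openin Z N2" "y \<in> N2" "N2 \<subseteq> topspace Z" "potential Z \<tau>2 N2 F2" "F2 y = \<one>"
      using potential_exists[OF patches2 openin_topspace right(1) transport2] by metis
    have "potential X \<tau>1 {} undefined" unfolding potential_def by auto
    then show ?thesis
      using N2 right by (intro exI[of _ "{}"] exI[of _ undefined] exI[of _ N2] exI[of _ F2])
        (auto simp: inl_eq_inr)
  next
    case (seam x)
    have x: "x \<in> topspace X" "f x \<in> topspace Z" using seam S_subset fS_subset by auto
    obtain N1 F1 where N1: "openin X N1" "x \<in> N1" "N1 \<subseteq> topspace X" "potential X \<tau>1 N1 F1" "F1 x = \<one>"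
      using potential_exists[OF patches1 openin_topspace x(1) transport1] by metis
    obtain N2 F2 where N2: "openin Z N2" "f x \<in> N2" "N2 \<subseteq> topspace Z" "potential Z \<tau>2 N2 F2" "F2 (f x) = \<one>"
      using potential_exists[OF patches2 openin_topspace x(2) transport2] by metis
    have f: "continuous_map (subtopology X S) Z f"
      using homeomorphic_imp_continuous_map[OF seam_homeo]
      by (simp add: continuous_map_in_subtopology)
    have "openin (subtopology X S) (N1 \<inter> S)" by (simp add: N1 openin_subtopology_Int)
    moreover have "openin (subtopology X S) {d \<in> topspace (subtopology X S). f d \<in> N2}"
      by (rule openin_continuous_map_preimage[OF f N2(1)])
    ultimately have D0: "openin (subtopology X S) ({d \<in> topspace (subtopology X S). f d \<in> N2} \<inter> (N1 \<inter> S))"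
      by (rule openin_Int[rotated])
    have x0: "x \<in> {d \<in> topspace (subtopology X S). f d \<in> N2} \<inter> (N1 \<inter> S)"
      using seam x N1 N2 by simp
    obtain D where D: "openin (subtopology X S) D" "path_connectedin (subtopology X S) D" "x \<in> D"
      "D \<subseteq> {d \<in> topspace (subtopology X S). f d \<in> N2} \<inter> (N1 \<inter> S)"
      using seam_connected[unfolded locally_path_connected_space, rule_format, OF conjI[OF D0 x0]]
      by (elim exE conjE)
    obtain O1 where O1: "openin X O1" "D = O1 \<inter> S" using D(1) unfolding openin_subtopology by auto
    have eq: "F1 d = F2 (f d)" if d: "d \<in> D" for d
    proof -
      obtain q where q: "pathin (subtopology X S) q" "q ` {0..1} \<subseteq> D" "q 0 = x" "q 1 = d"
        using D(2,3) d unfolding path_connectedin by blast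
      have qD: "q t \<in> D" if "t \<in> {0..1}" for t using q(2) that by blast
      have "pathin X q" using q(1) by (simp add: pathin_subtopology)
      then have "\<tau>1 q = inv (F1 (q 0)) \<otimes> F1 (q 1)"
        by (rule potentialD(2)[OF N1(4)]) (use qD D(4) in blast)
      moreover have "\<tau>2 (f \<circ> q) = inv (F2 ((f \<circ> q) 0)) \<otimes> F2 ((f \<circ> q) 1)"
        by (rule potentialD(2)[OF N2(4) pathin_compose[OF q(1) f]]) (use qD D(4) in auto)
      moreover have "F1 d \<in> carrier G" "F2 (f d) \<in> carrier G"
        using potentialD(1)[OF N1(4)] potentialD(1)[OF N2(4)] d D(4) by auto
      ultimately show ?thesis using agree[OF q(1)] q(3,4) N1(5) N2(5) by simp
    qed
    have xO: "x \<in> O1" using O1(2) D(3) by auto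
    have "potential X \<tau>1 (N1 \<inter> O1) F1" by (rule potential_mono[OF N1(4)]) auto
    moreover have "openin X (N1 \<inter> O1)" using N1(1) O1(1) by (rule openin_Int)
    moreover have "x' \<in> N1 \<inter> O1" if "inl x' = w" for x' using that seam(2) N1(2) xO by auto
    moreover have "y' \<in> N2" if "inr y' = w" for y' proof -
      have "inl x = inr y'" using that seam(2) by simp
      then show ?thesis using N2(2) by (simp add: inl_eq_inr)
    qed
    moreover have "F1 d = F2 (f d)" if "d \<in> S" "d \<in> N1 \<inter> O1" for d using eq that O1(2) by blast
    ultimately show ?thesis
      using N2(1,4) by (intro exI[of _ "N1 \<inter> O1"] exI[of _ F1] exI[of _ N2] exI[of _ F2] conjI) simp_all
  qed
  then obtain N1 F1 N2 F2 where N: "openin X N1" "openin Z N2" "potential X \<tau>1 N1 F1" "potential Z \<tau>2 N2 F2"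
    "\<forall>x\<in>topspace X. inl x = w \<longrightarrow> x \<in> N1" "\<forall>y\<in>topspace Z. inr y = w \<longrightarrow> y \<in> N2"
    "\<forall>d\<in>S. d \<in> N1 \<and> f d \<in> N2 \<longrightarrow> F1 d = F2 (f d)" by (elim exE conjE)
  have "\<exists>U1 U2. matching U1 U2 \<and> U1 \<subseteq> N1 \<and> U2 \<subseteq> N2 \<and> w \<in> inl ` U1 \<union> inr ` U2"
    by (rule matching_nbhd[OF w N(1,2)]) (use N(5,6) in simp_all)
  then obtain U1 U2 where U: "matching U1 U2" "U1 \<subseteq> N1" "U2 \<subseteq> N2" "w \<in> inl ` U1 \<union> inr ` U2"
    by (elim exE conjE)
  have "F1 x = F2 (f x)" if "x \<in> S" "x \<in> U1" for x
    using N(7) matchingD(3)[OF U(1)] U(2,3) that by blast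
  with chart_of_matching[OF U(1) potential_mono[OF N(3) U(2) refl] potential_mono[OF N(4) U(3) refl]]
  have "\<exists>F. (inl ` U1 \<union> inr ` U2, F) \<in> charts" by blast
  then show ?thesis using U(4) by blast
qed

text \<open>Nearby points are joined by paths inside \<open>V\<close>, and both potentials compute the same transport
  along them.\<close>

lemma potentials_proportional:
  assumes patches: "convex_patches T" and V: "openin T V" "x \<in> V"
    and F: "potential T \<tau> V F" "potential T \<tau> V F'"
  shows "\<exists>N. openin T N \<and> x \<in> N \<and> N \<subseteq> V \<and> (\<forall>y\<in>N. F' y = (F' x \<otimes> inv (F x)) \<otimes> F y)"
proof -
  obtain N where N: "openin T N" "x \<in> N" "N \<subseteq> V"
    "\<forall>y\<in>N. \<exists>q. pathin T q \<and> (\<forall>t\<in>{0..1}. q t \<in> N) \<and> q 0 = x \<and> q 1 = y"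
    using convex_patches_path_connected[OF patches V] by metis
  have "F' y = (F' x \<otimes> inv (F x)) \<otimes> F y" if y: "y \<in> N" for y
  proof -
    obtain q where q: "pathin T q" "\<forall>t\<in>{0..1}. q t \<in> N" "q 0 = x" "q 1 = y" using N(4) y by metis
    have "\<tau> q = inv (F x) \<otimes> F y" unfolding q(3,4)[symmetric]
      by (rule potentialD(2)[OF F(1) q(1)]) (use q(2) N(3) in auto)
    moreover have "\<tau> q = inv (F' x) \<otimes> F' y" unfolding q(3,4)[symmetric]
      by (rule potentialD(2)[OF F(2) q(1)]) (use q(2) N(3) in auto)
    ultimately have "F' x \<otimes> (inv (F x) \<otimes> F y) = F' x \<otimes> (inv (F' x) \<otimes> F' y)" by simp
    moreover have "F x \<in> carrier G" "F y \<in> carrier G" "F' x \<in> carrier G" "F' y \<in> carrier G"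
      using potentialD(1)[OF F(1)] potentialD(1)[OF F(2)] y N V by auto
    ultimately show ?thesis by (simp add: m_assoc)
  qed
  then show ?thesis using N by blast
qed

text \<open>On each side the two potentials have a constant ratio near \<open>w\<close>, and at a seam point both constants
  equal the ratio at \<open>w\<close> itself.\<close>

lemma charts_overlap:
  assumes c: "(W, F) \<in> charts" "(W', F') \<in> charts" and w: "w \<in> W" "w \<in> W'"
  shows "\<exists>N c. openin Y N \<and> w \<in> N \<and> N \<subseteq> W \<inter> W' \<and> c \<in> carrier G \<and> (\<forall>v\<in>N. F' v = c \<otimes> F v)"
proof -
  have o: "openin Y (W \<inter> W')" using c by (auto simp: charts_def)
  have wY: "w \<in> topspace Y" using openin_subset[OF o] w by auto
  let ?V1 = "{x \<in> topspace X. inl x \<in> W \<inter> W'}" and ?V2 = "{y \<in> topspace Z. inr y \<in> W \<inter> W'}"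
  define d where "d = F' w \<otimes> inv (F w)"
  have p: "potential X \<tau>1 ?V1 (\<lambda>x. F (inl x))" "potential X \<tau>1 ?V1 (\<lambda>x. F' (inl x))"
    "potential Z \<tau>2 ?V2 (\<lambda>x. F (inr x))" "potential Z \<tau>2 ?V2 (\<lambda>x. F' (inr x))"
    by (rule potential_mono[of X \<tau>1 "{x \<in> topspace X. inl x \<in> W}" "\<lambda>x. F (inl x)"]
        potential_mono[of X \<tau>1 "{x \<in> topspace X. inl x \<in> W'}" "\<lambda>x. F' (inl x)"]
        potential_mono[of Z \<tau>2 "{y \<in> topspace Z. inr y \<in> W}" "\<lambda>y. F (inr y)"]
        potential_mono[of Z \<tau>2 "{y \<in> topspace Z. inr y \<in> W'}" "\<lambda>y. F' (inr y)"],
        use c in \<open>auto simp: charts_def\<close>)+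
  have "\<exists>N1. openin X N1 \<and> (\<forall>x\<in>topspace X. inl x = w \<longrightarrow> x \<in> N1) \<and> N1 \<subseteq> ?V1 \<and>
    (\<forall>x\<in>N1. F' (inl x) = d \<otimes> F (inl x))"
  proof (cases "\<exists>x\<in>topspace X. inl x = w")
    case True
    then obtain x where x: "x \<in> topspace X" "inl x = w" by blast
    then have xV: "x \<in> ?V1" using w by simp
    obtain N where N: "openin X N" "x \<in> N" "N \<subseteq> ?V1"
      "\<forall>y\<in>N. F' (inl y) = (F' (inl x) \<otimes> inv (F (inl x))) \<otimes> F (inl y)"
      using potentials_proportional[OF patches1 openin_preimages(1)[OF o] xV p(1,2)] by (elim exE conjE)
    have "x' \<in> N" if "inl x' = w" for x' using that x(2) N(2) by (metis inl_eq_inl)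
    then show ?thesis using N(1,3,4) x(2) by (intro exI[of _ N] conjI) (simp_all add: d_def)
  next
    case False
    then show ?thesis by (intro exI[of _ "{}"] conjI) simp_all
  qed
  then obtain N1 where N1: "openin X N1" "\<forall>x\<in>topspace X. inl x = w \<longrightarrow> x \<in> N1" "N1 \<subseteq> ?V1"
    "\<forall>x\<in>N1. F' (inl x) = d \<otimes> F (inl x)" by (elim exE conjE)
  have "\<exists>N2. openin Z N2 \<and> (\<forall>x\<in>topspace Z. inr x = w \<longrightarrow> x \<in> N2) \<and> N2 \<subseteq> ?V2 \<and>
    (\<forall>x\<in>N2. F' (inr x) = d \<otimes> F (inr x))"
  proof (cases "\<exists>x\<in>topspace Z. inr x = w")
    case True
    then obtain x where x: "x \<in> topspace Z" "inr x = w" by blast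
    then have xV: "x \<in> ?V2" using w by simp
    obtain N where N: "openin Z N" "x \<in> N" "N \<subseteq> ?V2"
      "\<forall>y\<in>N. F' (inr y) = (F' (inr x) \<otimes> inv (F (inr x))) \<otimes> F (inr y)"
      using potentials_proportional[OF patches2 openin_preimages(2)[OF o] xV p(3,4)] by (elim exE conjE)
    have "x' \<in> N" if "inr x' = w" for x' using that x(2) N(2) by (metis inr_eq_inr)
    then show ?thesis using N(1,3,4) x(2) by (intro exI[of _ N] conjI) (simp_all add: d_def)
  next
    case False
    then show ?thesis by (intro exI[of _ "{}"] conjI) simp_all
  qed
  then obtain N2 where N2: "openin Z N2" "\<forall>x\<in>topspace Z. inr x = w \<longrightarrow> x \<in> N2" "N2 \<subseteq> ?V2"
    "\<forall>x\<in>N2. F' (inr x) = d \<otimes> F (inr x)" by (elim exE conjE)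
  have "\<exists>U1 U2. matching U1 U2 \<and> U1 \<subseteq> N1 \<and> U2 \<subseteq> N2 \<and> w \<in> inl ` U1 \<union> inr ` U2"
    by (rule matching_nbhd[OF wY N1(1) N2(1)]) (use N1(2) N2(2) in simp_all)
  then obtain U1 U2 where U: "matching U1 U2" "U1 \<subseteq> N1" "U2 \<subseteq> N2" "w \<in> inl ` U1 \<union> inr ` U2"
    by (elim exE conjE)
  have "d \<in> carrier G" using c w unfolding d_def charts_def by auto
  moreover have "inl ` U1 \<union> inr ` U2 \<subseteq> W \<inter> W'" using U N1(3) N2(3) by auto
  moreover have "\<forall>v\<in>inl ` U1 \<union> inr ` U2. F' v = d \<otimes> F v" using U N1(4) N2(4) by auto
  ultimately show ?thesis
    using openin_matching[OF U(1)] U(4) by blast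
qed

sublocale flat: flat_structure G Y charts
proof
  show "openin Y W" if "(W, F) \<in> charts" for W F using that by (simp add: charts_def)
  show "F x \<in> carrier G" if "(W, F) \<in> charts" "x \<in> W" for W F x using that by (simp add: charts_def)
qed (rule charts_cover charts_overlap; assumption)+

text \<open>Van Kampen's theorem for two closed pieces. The holonomy restricts to the given transport on each
  side because both are computed by the same potential on short paths.\<close>

theorem glued_transport:
  shows "path_transport G Y flat.holonomy"
    and "pathin X p \<Longrightarrow> flat.holonomy (inl \<circ> p) = \<tau>1 p"
    and "pathin Z q \<Longrightarrow> flat.holonomy (inr \<circ> q) = \<tau>2 q"
proof -
  show T: "path_transport G Y flat.holonomy" by (rule flat.path_transport_holonomy)
  have c: "\<exists>W F. openin Y W \<and> w \<in> W \<and> (W, F) \<in> charts" if "w \<in> topspace Y" for w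
    using charts_cover[OF that] flat.chart_open by blast
  show "flat.holonomy (inl \<circ> p) = \<tau>1 p" if "pathin X p"
  proof (rule transports_agree_locally[OF transport_compose[OF T continuous_inl] transport1 _ that])
    fix x assume x: "x \<in> topspace X"
    obtain W F where W: "openin Y W" "inl x \<in> W" "(W, F) \<in> charts"
      using c[of "inl x"] x by (auto simp: topspace_Y)
    have "flat.holonomy (inl \<circ> q) = \<tau>1 q" if q: "pathin X q" "\<forall>t\<in>{0..1}. q t \<in> {x \<in> topspace X. inl x \<in> W}" for q
    proof -
      have "flat.holonomy (inl \<circ> q) = inv (F ((inl \<circ> q) 0)) \<otimes> F ((inl \<circ> q) 1)"
        by (rule flat.holonomy_chart[OF pathin_compose[OF q(1) continuous_inl] W(3)]) (use q in auto)
      moreover have "\<tau>1 q = inv (F (inl (q 0))) \<otimes> F (inl (q 1))"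
        by (rule potentialD(2)[of X \<tau>1 "{x \<in> topspace X. inl x \<in> W}" "\<lambda>x. F (inl x)", OF _ q(1)])
          (use W(3) q in \<open>auto simp: charts_def\<close>)
      ultimately show ?thesis by simp
    qed
    then show "\<exists>N. openin X N \<and> x \<in> N \<and> (\<forall>q. pathin X q \<longrightarrow> (\<forall>t\<in>{0..1}. q t \<in> N) \<longrightarrow> flat.holonomy (inl \<circ> q) = \<tau>1 q)"
      using openin_preimages(1)[OF W(1)] x W(2)
      by (intro exI[of _ "{x \<in> topspace X. inl x \<in> W}"]) simp
  qed
  show "flat.holonomy (inr \<circ> q) = \<tau>2 q" if "pathin Z q"
  proof (rule transports_agree_locally[OF transport_compose[OF T continuous_inr] transport2 _ that])
    fix x assume x: "x \<in> topspace Z"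
    obtain W F where W: "openin Y W" "inr x \<in> W" "(W, F) \<in> charts"
      using c[of "inr x"] x by (auto simp: topspace_Y)
    have "flat.holonomy (inr \<circ> q) = \<tau>2 q" if q: "pathin Z q" "\<forall>t\<in>{0..1}. q t \<in> {x \<in> topspace Z. inr x \<in> W}" for q
    proof -
      have "flat.holonomy (inr \<circ> q) = inv (F ((inr \<circ> q) 0)) \<otimes> F ((inr \<circ> q) 1)"
        by (rule flat.holonomy_chart[OF pathin_compose[OF q(1) continuous_inr] W(3)]) (use q in auto)
      moreover have "\<tau>2 q = inv (F (inr (q 0))) \<otimes> F (inr (q 1))"
        by (rule potentialD(2)[of Z \<tau>2 "{x \<in> topspace Z. inr x \<in> W}" "\<lambda>x. F (inr x)", OF _ q(1)])
          (use W(3) q in \<open>auto simp: charts_def\<close>)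
      ultimately show ?thesis by simp
    qed
    then show "\<exists>N. openin Z N \<and> x \<in> N \<and> (\<forall>q. pathin Z q \<longrightarrow> (\<forall>t\<in>{0..1}. q t \<in> N) \<longrightarrow> flat.holonomy (inr \<circ> q) = \<tau>2 q)"
      using openin_preimages(2)[OF W(1)] x W(2)
      by (intro exI[of _ "{x \<in> topspace Z. inr x \<in> W}"]) simp
  qed
qed

end

section \<open>Manifolds with torus boundary\<close>

lemma convex_patches_of_atlas:
  assumes A: "smooth_atlas X A" shows "convex_patches X"
  unfolding convex_patches_def
proof (intro allI impI, elim conjE)
  fix V x assume V: "openin X V" "x \<in> V"
  have "x \<in> topspace X" using V openin_subset by blast
  then have "x \<in> \<Union> (fst ` A)" using A by (simp add: smooth_atlas_def)
  then obtain U c where Uc: "(U, c) \<in> A" "x \<in> U" by force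
  have "is_chart X (U, c)" using A Uc(1) by (simp add: smooth_atlas_def)
  then have U: "openin X U" "openin (top_of_set half_space3) (c ` U)"
    and c: "homeomorphic_map (subtopology X U) (top_of_set (c ` U)) c" by (auto simp: is_chart_def)
  have tU: "topspace (subtopology X U) = U" using openin_subset[OF U(1)] by auto
  obtain k where k: "homeomorphic_maps (subtopology X U) (top_of_set (c ` U)) c k"
    using c unfolding homeomorphic_map_maps by blast
  have kc: "k (c y) = y" if "y \<in> U" for y using k tU that unfolding homeomorphic_maps_def by blast
  have "openin (subtopology X U) (V \<inter> U)" using V(1) by (simp add: openin_subtopology_Int)
  then have "openin (top_of_set (c ` U)) (c ` (V \<inter> U))"
    using homeomorphic_imp_open_map[OF c] by (simp add: open_map_def)
  then have "openin (top_of_set half_space3) (c ` (V \<inter> U))" using U(2) openin_trans by blast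
  moreover have "c x \<in> c ` (V \<inter> U)" using V Uc by blast
  ultimately obtain e where e: "e > 0" "ball (c x) e \<inter> half_space3 \<subseteq> c ` (V \<inter> U)"
    unfolding openin_contains_ball by blast
  define K where "K = ball (c x) e \<inter> half_space3"
  have KU: "K \<subseteq> c ` (V \<inter> U)" using e by (simp add: K_def)
  have "half_space3 = {x :: real ^ 3. inner (axis 1 1) x \<ge> 0}"
    by (simp add: half_space3_def inner_axis')
  then have "convex half_space3" using convex_halfspace_ge[of 0 "axis 1 1 :: real ^ 3"] by simp
  then have "convex K" unfolding K_def by (intro convex_Int convex_ball)
  define N where "N = {y \<in> topspace (subtopology X U). c y \<in> K}"
  have "openin (top_of_set half_space3) K" unfolding K_def by (simp add: openin_open_Int inf_commute)
  then have "openin (top_of_set (c ` U)) K"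
    by (rule openin_subset_trans) (use KU openin_imp_subset[OF U(2)] in auto)
  then have "openin (subtopology X U) N"
    unfolding N_def by (rule openin_continuous_map_preimage[OF homeomorphic_imp_continuous_map[OF c]])
  then have N: "openin X N" using U(1) openin_trans_full by blast
  have NU: "N \<subseteq> U" using tU by (auto simp: N_def)
  have NV: "N \<subseteq> V"
  proof
    fix y assume y: "y \<in> N"
    then obtain y' where y': "y' \<in> V" "y' \<in> U" "c y = c y'" using KU unfolding N_def by blast
    then have "y = y'" using kc[of y] kc[of y'] y NU by (metis subsetD)
    then show "y \<in> V" using y'(1) by simp
  qed
  have ck: "c (k z) = z" "k z \<in> N" if z: "z \<in> K" for z
  proof -
    obtain y where y: "y \<in> U" "z = c y" using z KU by auto
    then show "c (k z) = z" "k z \<in> N" using kc z tU by (auto simp: N_def)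
  qed
  have tN: "topspace (subtopology X N) = N" using openin_subset[OF N] by auto
  have "homeomorphic_maps (top_of_set K) (subtopology X N) k c"
    unfolding homeomorphic_maps_def
  proof (intro conjI ballI)
    have "continuous_map (top_of_set (c ` U)) X k"
      using k by (simp add: homeomorphic_maps_def continuous_map_in_subtopology)
    then have "continuous_map (top_of_set K) X k"
      by (rule continuous_map_from_subtopology_mono) (use KU in auto)
    then show "continuous_map (top_of_set K) (subtopology X N) k"
      using ck(2) by (auto simp: continuous_map_in_subtopology)
    have "continuous_map (subtopology X U) euclidean c"
      using homeomorphic_imp_continuous_map[OF c] by (simp add: continuous_map_in_subtopology)
    then have "continuous_map (subtopology X N) euclidean c"
      by (rule continuous_map_from_subtopology_mono) (rule NU)
    then show "continuous_map (subtopology X N) (top_of_set K) c"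
      by (auto simp: continuous_map_in_subtopology N_def)
  next
    fix z assume "z \<in> topspace (top_of_set K)" then show "c (k z) = z" using ck by simp
  next
    fix y assume "y \<in> topspace (subtopology X N)" then show "k (c y) = y" using tN kc NU by blast
  qed
  moreover have "c x \<in> half_space3" using openin_imp_subset[OF U(2)] Uc(2) by blast
  then have "x \<in> N" using Uc(2) e(1) tU unfolding N_def K_def by simp
  ultimately show "\<exists>N K m k. openin X N \<and> x \<in> N \<and> N \<subseteq> V \<and>
     convex (K :: (real ^ 3) set) \<and> homeomorphic_maps (top_of_set K) (subtopology X N) m k"
    using N NV \<open>convex K\<close> by (intro exI[of _ N] exI[of _ K] exI[of _ k] exI[of _ c] conjI)
qed

lemma torus_boundary_closed:
  assumes "Hausdorff_space X" "torus_boundary X A" shows "closedin X (mfd_boundary X A)"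
proof -
  have "compact (circle \<times> circle)" by (intro compact_Times compact_sphere)
  then have "compact_space (top_of_set (circle \<times> circle))"
    by (simp add: compact_space_subtopology compactin_euclidean_iff)
  then have "compact_space (subtopology X (mfd_boundary X A))"
    using assms(2) homeomorphic_compact_space unfolding torus_boundary_def boundary_torus_def by blast
  moreover have "mfd_boundary X A \<subseteq> topspace X" by (auto simp: mfd_boundary_def)
  ultimately show ?thesis using assms(1) by (intro compactin_imp_closedin) (auto simp: compactin_subspace)
qed

lemma locally_path_connected_torus: "locally_path_connected_space (top_of_set (circle \<times> circle))"
proof -
  have "locally path_connected (circle \<times> circle)"
    by (rule locally_Times[OF locally_path_connected_sphere locally_path_connected_sphere])
      (simp add: path_connected_Times)
  then show ?thesis
    unfolding locally_path_connected locally_path_connected_space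
    by (simp add: path_connectedin_subtopology) (metis openin_imp_subset)
qed

lemma path_connected_torus: "path_connected_space (top_of_set (circle \<times> circle))"
proof -
  have "path_connected (sphere (0::complex) 1)" by (intro path_connected_sphere) (simp add: DIM_complex)
  then have "path_connected (circle \<times> circle)" by (intro path_connected_Times)
  then show ?thesis by (metis path_connectedin_absolute path_connectedin_euclidean path_connectedin_topspace topspace_euclidean_subtopology path_connectedin_subtopology order_refl)
qed

section \<open>One-parameter subgroups of \<open>SU(2)\<close>\<close>

text \<open>The unit quaternion \<open>a + b j\<close>, if \<open>|a|\<^sup>2 + |b|\<^sup>2 = 1\<close>.\<close>

definition su2 :: "complex \<Rightarrow> complex \<Rightarrow> complex ^ 2 ^ 2" where
  "su2 a b = (\<chi> i j. if i = 1 then if j = 1 then a else b else if j = 1 then - cnj b else cnj a)"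

lemma su2_nth: "su2 a b $ 1 $ 1 = a" "su2 a b $ 1 $ 2 = b" "su2 a b $ 2 $ 1 = - cnj b" "su2 a b $ 2 $ 2 = cnj a"
  by (simp_all add: su2_def)

lemma su2_mult: "su2 a b ** su2 c d = su2 (a * c - b * cnj d) (a * d + b * cnj c)"
  by (simp add: vec_eq_iff forall_2 matrix_matrix_mult_def sum_2 su2_nth)

lemma su2_in_SU2:
  assumes "a * cnj a + b * cnj b = 1" shows "su2 a b \<in> carrier SU2"
  using assms
  by (simp add: SU2_def vec_eq_iff forall_2 matrix_matrix_mult_def sum_2 su2_nth conj_transpose_def
     mat_def det_2 mult.commute) (simp add: algebra_simps)

lemma SU2_eq_su2:
  assumes A: "A \<in> carrier SU2"
  obtains a b where "A = su2 a b" "a * cnj a + b * cnj b = 1"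
proof -
  define a b c d where "a = A $ 1 $ 1" and "b = A $ 1 $ 2" and "c = A $ 2 $ 1" and "d = A $ 2 $ 2"
  have M: "A ** conj_transpose A = mat 1" and D: "a * d - b * c = 1"
    using A by (simp_all add: SU2_def det_2 a_def b_def c_def d_def)
  have 1: "a * cnj a + b * cnj b = 1"
    using arg_cong[OF M, of "\<lambda>M. M $ 1 $ 1"]
    by (simp add: matrix_matrix_mult_def sum_2 conj_transpose_def mat_def a_def b_def)
  have 2: "c * cnj a + d * cnj b = 0"
    using arg_cong[OF M, of "\<lambda>M. M $ 2 $ 1"]
    by (simp add: matrix_matrix_mult_def sum_2 conj_transpose_def mat_def a_def b_def c_def d_def)
  have "d = d * (a * cnj a + b * cnj b)" by (simp add: 1)
  also have "\<dots> = (a * d - b * c) * cnj a + b * (c * cnj a + d * cnj b)" by (simp add: algebra_simps)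
  finally have "d = cnj a" by (simp add: 2 D)
  moreover have "c = c * (a * cnj a + b * cnj b)" by (simp add: 1)
  then have "c = a * (c * cnj a + d * cnj b) - (a * d - b * c) * cnj b" by (simp add: algebra_simps)
  then have "c = - cnj b" by (simp add: 2 D)
  ultimately have "A = su2 a b"
    by (simp add: vec_eq_iff forall_2 su2_nth a_def b_def c_def d_def)
  then show thesis using 1 that by blast
qed

text \<open>Write the matrix as \<open>cos \<theta> + J sin \<theta>\<close> with \<open>J\<close> a unit imaginary quaternion.\<close>

lemma SU2_one_parameter:
  assumes A: "A \<in> carrier SU2"
  shows "\<exists>E :: real \<Rightarrow> complex ^ 2 ^ 2. (\<forall>t. E t \<in> carrier SU2) \<and>
    (\<forall>s t. E (s + t) = E s \<otimes>\<^bsub>SU2\<^esub> E t) \<and> E 1 = A"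
proof -
  obtain a b where ab: "A = su2 a b" "a * cnj a + b * cnj b = 1" by (rule SU2_eq_su2[OF A])
  have n: "(Re a)\<^sup>2 + (Im a)\<^sup>2 + (Re b)\<^sup>2 + (Im b)\<^sup>2 = 1"
    using arg_cong[OF ab(2), of Re] by (simp add: power2_eq_square)
  then have "(Re a)\<^sup>2 \<le> 1" by (smt (verit) zero_le_power2)
  then have Ra: "\<bar>Re a\<bar> \<le> 1" by (simp add: abs_square_le_1)
  define \<theta> where "\<theta> = arccos (Re a)"
  have cos: "cos \<theta> = Re a" using Ra by (simp add: \<theta>_def cos_arccos abs_le_iff)
  then have s2: "(sin \<theta>)\<^sup>2 = (Im a)\<^sup>2 + (Re b)\<^sup>2 + (Im b)\<^sup>2" using n sin_cos_squared_add[of \<theta>] by simp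
  obtain j :: real and \<beta> :: complex where j: "j\<^sup>2 + (Re \<beta>)\<^sup>2 + (Im \<beta>)\<^sup>2 = 1"
    "sin \<theta> * j = Im a" "of_real (sin \<theta>) * \<beta> = b"
  proof (cases "sin \<theta> = 0")
    case True
    then have "Im a = 0" "Re b = 0" "Im b = 0"
      using s2 by (smt (verit) zero_le_power2 zero_eq_power2)+
    \<comment> \<open>The matrix is \<open>1\<close> or \<open>-1\<close>, and every \<open>J\<close> will do.\<close>
    then show thesis using that[of 1 0] True by (simp add: complex_eq_iff)
  next
    case False
    show thesis
    proof (rule that[of "Im a / sin \<theta>" "b / of_real (sin \<theta>)"])
      have "(Im a / sin \<theta>)\<^sup>2 + (Re b / sin \<theta>)\<^sup>2 + (Im b / sin \<theta>)\<^sup>2 = ((Im a)\<^sup>2 + (Re b)\<^sup>2 + (Im b)\<^sup>2) / (sin \<theta>)\<^sup>2"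
        by (simp add: power_divide add_divide_distrib)
      also have "\<dots> = 1" unfolding s2[symmetric] using False by simp
      finally show "(Im a / sin \<theta>)\<^sup>2 + (Re (b / of_real (sin \<theta>)))\<^sup>2 + (Im (b / of_real (sin \<theta>)))\<^sup>2 = 1" by simp
    qed (use False in auto)
  qed
  define E where "E t = su2 (Complex (cos (\<theta> * t)) (j * sin (\<theta> * t))) (of_real (sin (\<theta> * t)) * \<beta>)" for t
  have "E t \<in> carrier SU2" for t
    unfolding E_def
  proof (rule su2_in_SU2)
    have "(cos (\<theta> * t))\<^sup>2 + (j * sin (\<theta> * t))\<^sup>2 + ((sin (\<theta> * t) * Re \<beta>)\<^sup>2 + (sin (\<theta> * t) * Im \<beta>)\<^sup>2)
      = (cos (\<theta> * t))\<^sup>2 + (sin (\<theta> * t))\<^sup>2 * (j\<^sup>2 + (Re \<beta>)\<^sup>2 + (Im \<beta>)\<^sup>2)"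
      by (simp add: algebra_simps power_mult_distrib)
    also have "\<dots> = 1" using j(1) by simp
    finally show "Complex (cos (\<theta> * t)) (j * sin (\<theta> * t)) * cnj (Complex (cos (\<theta> * t)) (j * sin (\<theta> * t))) +
      of_real (sin (\<theta> * t)) * \<beta> * cnj (of_real (sin (\<theta> * t)) * \<beta>) = 1"
      by (simp add: complex_eq_iff power2_eq_square algebra_simps)
  qed
  moreover have "E (s + t) = E s \<otimes>\<^bsub>SU2\<^esub> E t" for s t
  proof -
    have *: "j * j = 1 - (Re \<beta> * Re \<beta> + Im \<beta> * Im \<beta>)" using j(1) by (simp add: power2_eq_square)
    have "E s ** E t = E (s + t)"
      unfolding E_def su2_mult
    proof (rule arg_cong2[of _ _ _ _ su2])
      have "cos (\<theta> * s) * cos (\<theta> * t) - (j * j) * (sin (\<theta> * s) * sin (\<theta> * t)) - (Re \<beta> * Re \<beta> + Im \<beta> * Im \<beta>) * (sin (\<theta> * s) * sin (\<theta> * t))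
        = cos (\<theta> * s) * cos (\<theta> * t) - sin (\<theta> * s) * sin (\<theta> * t)"
        unfolding * by (simp add: algebra_simps)
      then show "Complex (cos (\<theta> * s)) (j * sin (\<theta> * s)) * Complex (cos (\<theta> * t)) (j * sin (\<theta> * t)) -
        of_real (sin (\<theta> * s)) * \<beta> * cnj (of_real (sin (\<theta> * t)) * \<beta>) =
        Complex (cos (\<theta> * (s + t))) (j * sin (\<theta> * (s + t)))"
        by (simp add: complex_eq_iff distrib_left cos_add sin_add algebra_simps)
      show "Complex (cos (\<theta> * s)) (j * sin (\<theta> * s)) * (of_real (sin (\<theta> * t)) * \<beta>) +
        of_real (sin (\<theta> * s)) * \<beta> * cnj (Complex (cos (\<theta> * t)) (j * sin (\<theta> * t))) =
        of_real (sin (\<theta> * (s + t))) * \<beta>"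
        by (simp add: complex_eq_iff distrib_left sin_add algebra_simps)
    qed
    then show ?thesis by (simp add: SU2_def)
  qed
  moreover have "E 1 = A"
  proof -
    have "Complex (cos (\<theta> * 1)) (j * sin (\<theta> * 1)) = a" using cos j(2) by (simp add: complex_eq_iff mult.commute)
    then show ?thesis unfolding E_def ab(1) using j(3) by simp
  qed
  ultimately show ?thesis by (intro exI[of _ E]) simp
qed

section \<open>Transports on the torus\<close>

abbreviation torus :: "(complex \<times> complex) set" where
  "torus \<equiv> circle \<times> circle"

lemma circle_path_lift:
  assumes "continuous_on {0..1::real} p" "p ` {0..1} \<subseteq> circle"
  shows "\<exists>\<theta> :: real \<Rightarrow> real. continuous_on {0..1} \<theta> \<and> (\<forall>t\<in>{0..1}. p t = cis (2 * pi * \<theta> t))"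
proof -
  have n: "norm (p t) = 1" if "t \<in> {0..1}" for t using assms(2) that by (auto simp: image_subset_iff)
  have "contractible {0..1::real}" by (intro convex_imp_contractible) simp
  moreover have "p t \<noteq> 0" if "t \<in> {0..1}" for t using n[OF that] by auto
  ultimately obtain g where g: "continuous_on {0..1} g" "\<And>t. t \<in> {0..1} \<Longrightarrow> p t = exp (g t)"
    using continuous_logarithm_on_contractible[OF assms(1)] by metis
  have "p t = cis (2 * pi * (Im (g t) / (2 * pi)))" if "t \<in> {0..1}" for t
  proof -
    have "exp (Re (g t)) = 1" using n[OF that] g(2)[OF that] by simp
    then show ?thesis using g(2)[OF that] by (simp add: exp_eq_polar)
  qed
  moreover have "continuous_on {0..1} (\<lambda>t. Im (g t) / (2 * pi))" by (intro continuous_intros g(1)) auto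
  ultimately show ?thesis by blast
qed

definition torus_cover :: "real \<times> real \<Rightarrow> complex \<times> complex" where
  "torus_cover v = (cis (2 * pi * fst v), cis (2 * pi * snd v))"

lemma continuous_torus_cover: "continuous_map (top_of_set UNIV) (top_of_set torus) torus_cover"
  unfolding torus_cover_def by (intro continuous_map_I) (auto intro!: continuous_intros)

text \<open>The deck group of the universal cover of the torus, that is \<open>\<int> \<times> \<int>\<close>.\<close>

definition periods :: "(real \<times> real) set" where
  "periods = {w. \<forall>v. torus_cover (v + w) = torus_cover v}"

lemma periodsD: "w \<in> periods \<Longrightarrow> torus_cover (v + w) = torus_cover v"
  unfolding periods_def by blast

lemma periods_zero: "0 \<in> periods" and periods_add: "v \<in> periods \<Longrightarrow> w \<in> periods \<Longrightarrow> v + w \<in> periods"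
  and periods_minus: "v \<in> periods \<Longrightarrow> - v \<in> periods"
proof -
  show "0 \<in> periods" by (simp add: periods_def)
  show "v + w \<in> periods" if "v \<in> periods" "w \<in> periods"
  proof -
    have "torus_cover (u + (v + w)) = torus_cover u" for u
      using periodsD[OF that(1), of u] periodsD[OF that(2), of "u + v"] by (simp only: add.assoc)
    then show ?thesis unfolding periods_def by blast
  qed
  show "- v \<in> periods" if "v \<in> periods"
  proof -
    have "torus_cover (u + - v) = torus_cover u" for u
      using periodsD[OF that, of "u + - v"] by simp
    then show ?thesis unfolding periods_def by blast
  qed
qed

lemma cis_2pi_eq: "cis (2 * pi * a) = cis (2 * pi * b) \<longleftrightarrow> (\<exists>n. a = b + of_int n)"
proof
  assume "cis (2 * pi * a) = cis (2 * pi * b)"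
  then have "exp (\<i> * complex_of_real (2 * pi * a)) = exp (\<i> * complex_of_real (2 * pi * b))"
    by (simp only: cis_conv_exp)
  then obtain n :: int where "\<i> * complex_of_real (2 * pi * a) = \<i> * complex_of_real (2 * pi * b) + of_int (2 * n) * pi * \<i>"
    unfolding exp_eq by blast
  then have "\<i> * complex_of_real (2 * pi * a) = \<i> * complex_of_real (2 * pi * b + of_int (2 * n) * pi)"
    by (simp add: algebra_simps)
  then have "2 * pi * a = 2 * pi * b + of_int (2 * n) * pi"
    unfolding mult_cancel_left of_real_eq_iff by simp
  then have "2 * pi * a = 2 * pi * (b + of_int n)" by (simp add: algebra_simps)
  then have "a = b + of_int n" by simp
  then show "\<exists>n. a = b + of_int n" by blast
next
  assume "\<exists>n. a = b + of_int n"
  then obtain n :: int where "a = b + of_int n" by blast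
  then have "cis (2 * pi * a) = cis (2 * pi * b) * cis (2 * pi * of_int n)"
    by (simp only: distrib_left cis_mult)
  moreover have "cis (2 * pi * of_int n) = 1" by (rule cis_multiple_2pi) simp
  ultimately show "cis (2 * pi * a) = cis (2 * pi * b)" by simp
qed

lemma periods_of_eq:
  assumes "torus_cover v = torus_cover w"
  shows "\<exists>m n. v - w = (of_int m, of_int n)" "v - w \<in> periods"
proof -
  obtain m n where mn: "fst v = fst w + of_int m" "snd v = snd w + of_int n"
    using assms by (auto simp: torus_cover_def cis_2pi_eq)
  then show "\<exists>m n. v - w = (of_int m, of_int n)" by (intro exI[of _ m] exI[of _ n]) (simp add: prod_eq_iff)
  have "torus_cover (u + (v - w)) = torus_cover u" for u
    using mn by (auto simp: torus_cover_def cis_2pi_eq)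
  then show "v - w \<in> periods" by (simp add: periods_def)
qed

text \<open>Pulled back to the plane, a transport depends only on the end points of a path and is
  invariant under the deck group; so on loops it is determined by the two generators.\<close>

lemma (in group) torus_transports_agree:
  assumes \<tau>: "path_transport G (top_of_set torus) \<tau>" and \<sigma>: "path_transport G (top_of_set torus) \<sigma>"
    and \<mu>: "\<tau> (\<lambda>t. (cis (2 * pi * t), 1)) = \<sigma> (\<lambda>t. (cis (2 * pi * t), 1))"
    and \<lambda>: "\<tau> (\<lambda>t. (1, cis (2 * pi * t))) = \<sigma> (\<lambda>t. (1, cis (2 * pi * t)))"
    and p: "pathin (top_of_set torus) p" "p 0 = (1, 1)" "p 1 = (1, 1)"
  shows "\<tau> p = \<sigma> p"
proof -
  note T = continuous_torus_cover
  \<comment> \<open>The transport in the plane from the origin to \<open>w\<close>; it is a homomorphism on the periods.\<close>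
  define k where "k \<omega> w = \<omega> (torus_cover \<circ> linepath 0 w)" for \<omega> :: "(real \<Rightarrow> complex \<times> complex) \<Rightarrow> 'a" and w
  have kc: "k \<omega> w \<in> carrier G" if "path_transport G (top_of_set torus) \<omega>" for \<omega> w
    unfolding k_def by (intro transport_closed[OF that] pathin_compose[OF _ T] pathin_linepath) auto
  have k_add: "k \<omega> (v + w) = k \<omega> v \<otimes> k \<omega> w"
    if "path_transport G (top_of_set torus) \<omega>" "v \<in> periods" for \<omega> v w
  proof -
    have "torus_cover (linepath v (v + w) t) = torus_cover (linepath 0 w t)" for t
    proof -
      have "linepath v (v + w) t = linepath 0 w t + v" by (simp add: linepath_def algebra_simps)
      then show ?thesis using periodsD[OF that(2)] by simp
    qed
    then have "torus_cover \<circ> linepath v (v + w) = torus_cover \<circ> linepath 0 w" by auto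
    then show ?thesis
      unfolding k_def using transport_line[OF that(1) convex_UNIV T, of 0 v "v + w"] by simp
  qed
  \<comment> \<open>The periods on which the two homomorphisms agree form a subgroup.\<close>
  define D where "D = {w \<in> periods. k \<tau> w = k \<sigma> w}"
  have D_add: "v + w \<in> D" if "v \<in> D" "w \<in> D" for v w
    using that k_add[OF \<tau>] k_add[OF \<sigma>] by (simp add: D_def periods_add)
  have D_0: "0 \<in> D"
  proof -
    have "k \<omega> 0 = \<one>" if "path_transport G (top_of_set torus) \<omega>" for \<omega>
      using k_add[OF that periods_zero, of 0] kc[OF that, of 0] by (metis add_0 l_cancel_one')
    then show ?thesis using \<tau> \<sigma> by (simp add: D_def periods_zero)
  qed
  have D_minus: "- w \<in> D" if w: "w \<in> D" for w
  proof -
    have w': "- w \<in> periods" using w by (simp add: D_def periods_minus)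
    have "k \<omega> (- w) = inv (k \<omega> w)" if o: "path_transport G (top_of_set torus) \<omega>" and "k \<omega> 0 = \<one>" for \<omega>
      using k_add[OF o w', of w] kc[OF o] that(2) by (metis add.left_inverse inv_equality)
    moreover have "k \<tau> 0 = \<one>" "k \<sigma> 0 = \<one>"
      using k_add[OF \<tau> periods_zero, of 0] kc[OF \<tau>, of 0] k_add[OF \<sigma> periods_zero, of 0] kc[OF \<sigma>, of 0]
      by (metis add_0 l_cancel_one')+
    ultimately show ?thesis using \<tau> \<sigma> w w' by (simp add: D_def)
  qed
  have D_int: "of_int n *\<^sub>R w \<in> D" if w: "w \<in> D" for n w
  proof (induction n rule: int_induct[where k = 0])
    case base then show ?case using D_0 by simp
  next
    case (step1 i) then show ?case using D_add[OF _ w] by (simp add: scaleR_add_left)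
  next
    case (step2 i) then show ?case using D_add[OF _ D_minus[OF w]] by (simp add: scaleR_diff_left)
  qed
  have 10: "(1, 0) \<in> D"
  proof -
    have "torus_cover \<circ> linepath 0 (1, 0) = (\<lambda>t. (cis (2 * pi * t), 1))"
      by (auto simp: torus_cover_def linepath_def)
    moreover have "(1, 0) \<in> periods" using periods_of_eq(2)[of "(1,0)" 0] by (simp add: torus_cover_def)
    ultimately show ?thesis using \<mu> by (simp add: D_def k_def)
  qed
  have 01: "(0, 1) \<in> D"
  proof -
    have "torus_cover \<circ> linepath 0 (0, 1) = (\<lambda>t. (1, cis (2 * pi * t)))"
      by (auto simp: torus_cover_def linepath_def)
    moreover have "(0, 1) \<in> periods" using periods_of_eq(2)[of "(0,1)" 0] by (simp add: torus_cover_def)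
    ultimately show ?thesis using \<lambda> by (simp add: D_def k_def)
  qed
  have D_pair: "(of_int m, of_int n) \<in> D" for m n
    using D_add[OF D_int[OF 10, of m] D_int[OF 01, of n]] by simp
  have pc: "continuous_on {0..1} p" "p ` {0..1} \<subseteq> torus" using p(1) by (simp_all add: pathin_top_of_set)
  obtain \<theta>1 where \<theta>1: "continuous_on {0..1} \<theta>1" "\<forall>t\<in>{0..1}. fst (p t) = cis (2 * pi * \<theta>1 t)"
    using circle_path_lift[of "\<lambda>t. fst (p t)"] pc by (fastforce intro: continuous_intros)
  obtain \<theta>2 where \<theta>2: "continuous_on {0..1} \<theta>2" "\<forall>t\<in>{0..1}. snd (p t) = cis (2 * pi * \<theta>2 t)"
    using circle_path_lift[of "\<lambda>t. snd (p t)"] pc by (fastforce intro: continuous_intros)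
  define \<theta> where "\<theta> t = (\<theta>1 t, \<theta>2 t)" for t
  have \<theta>: "continuous_on {0..1} \<theta>" "\<And>t. t \<in> {0..1} \<Longrightarrow> torus_cover (\<theta> t) = p t"
    unfolding \<theta>_def torus_cover_def using \<theta>1 \<theta>2 by (auto intro!: continuous_intros simp: prod_eq_iff)
  have z: "torus_cover 0 = (1, 1)" by (simp add: torus_cover_def)
  have "\<theta> 0 - 0 \<in> periods" by (rule periods_of_eq(2)) (use \<theta>(2)[of 0] p(2) z in simp)
  then have per: "- \<theta> 0 \<in> periods" by (simp add: periods_minus)
  \<comment> \<open>The lift starts at a period; translate it to the origin.\<close>
  define \<beta> where "\<beta> t = \<theta> t + - \<theta> 0" for t
  have \<beta>: "torus_cover (\<beta> t) = p t" if "t \<in> {0..1}" for t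
    using periodsD[OF per, of "\<theta> t"] \<theta>(2)[OF that] unfolding \<beta>_def by simp
  have \<beta>c: "pathin (top_of_set UNIV) \<beta>"
    unfolding pathin_top_of_set \<beta>_def by (auto intro!: continuous_intros \<theta>(1))
  obtain m n where mn: "\<beta> 1 - 0 = (of_int m, of_int n)"
    using periods_of_eq(1)[of "\<beta> 1" 0] \<beta>[of 1] p(3) z by auto
  have key: "\<omega> p = k \<omega> (of_int m, of_int n)" if o: "path_transport G (top_of_set torus) \<omega>" for \<omega>
  proof -
    have "\<omega> p = \<omega> (torus_cover \<circ> \<beta>)"
      by (rule transport_cong[OF o p(1), symmetric]) (use \<beta> in simp)
    also have "\<dots> = \<omega> (torus_cover \<circ> linepath 0 (\<beta> 1))"
      by (rule transport_convex[OF o convex_UNIV T \<beta>c pathin_linepath])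
        (auto simp: linepath_0' linepath_1' \<beta>_def)
    finally show ?thesis using mn by (simp add: k_def)
  qed
  show ?thesis using key[OF \<tau>] key[OF \<sigma>] D_pair[of m n] by (simp add: D_def)
qed

text \<open>Representations that agree at one base point give isomorphic flat bundles: compare the fibres by
  transport to the base point.\<close>

lemma (in group) gauge_of_loops:
  assumes X: "path_connected_space X" and x: "x \<in> topspace X"
    and \<tau>: "path_transport G X \<tau>" and \<sigma>: "path_transport G X \<sigma>"
    and loops: "\<And>p. pathin X p \<Longrightarrow> p 0 = x \<Longrightarrow> p 1 = x \<Longrightarrow> \<tau> p = \<sigma> p"
  shows "\<exists>u. (\<forall>y\<in>topspace X. u y \<in> carrier G) \<and>
    (\<forall>p. pathin X p \<longrightarrow> \<tau> p = inv (u (p 0)) \<otimes> \<sigma> p \<otimes> u (p 1))"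
proof -
  have "\<forall>y\<in>topspace X. \<exists>c. pathin X c \<and> c 0 = x \<and> c 1 = y"
    using X x unfolding path_connected_space_def by blast
  then obtain c where c: "\<And>y. y \<in> topspace X \<Longrightarrow> pathin X (c y) \<and> c y 0 = x \<and> c y 1 = y"
    unfolding bchoice_iff by blast
  define u where "u y = inv (\<sigma> (c y)) \<otimes> \<tau> (c y)" for y
  have cl: "\<tau> (c y) \<in> carrier G" "\<sigma> (c y) \<in> carrier G" if "y \<in> topspace X" for y
    using c[OF that] transport_closed[OF \<tau>] transport_closed[OF \<sigma>] by auto
  have "\<tau> p = inv (u (p 0)) \<otimes> \<sigma> p \<otimes> u (p 1)" if p: "pathin X p" for p
  proof -
    have e: "p 0 \<in> topspace X" "p 1 \<in> topspace X"
      using path_start_in_topspace[OF p] path_finish_in_topspace[OF p] by auto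
    let ?a = "c (p 0)" and ?b = "c (p 1)"
    have ab: "pathin X ?a" "?a 0 = x" "?a 1 = p 0" "pathin X ?b" "?b 0 = x" "?b 1 = p 1"
      using c[OF e(1)] c[OF e(2)] by auto
    let ?l = "loop_concat (loop_concat ?a p) (reverse_path ?b)"
    have ap: "pathin X (loop_concat ?a p)" using ab p by (intro pathin_loop_concat) auto
    have rb: "pathin X (reverse_path ?b)" using ab by (intro pathin_reverse)
    have val: "\<omega> ?l = \<omega> ?a \<otimes> \<omega> p \<otimes> inv (\<omega> ?b)" if o: "path_transport G X \<omega>" for \<omega>
    proof -
      have "\<omega> ?l = \<omega> (loop_concat ?a p) \<otimes> \<omega> (reverse_path ?b)"
        by (rule transport_concat[OF o ap rb]) (simp add: ab)
      moreover have "\<omega> (loop_concat ?a p) = \<omega> ?a \<otimes> \<omega> p"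
        by (rule transport_concat[OF o ab(1) p]) (simp add: ab)
      ultimately show ?thesis using transport_reverse[OF o ab(4)] by simp
    qed
    have "\<tau> ?l = \<sigma> ?l"
      using ab by (intro loops pathin_loop_concat[OF ap rb]) simp_all
    then have "\<tau> ?a \<otimes> \<tau> p \<otimes> inv (\<tau> ?b) = \<sigma> ?a \<otimes> \<sigma> p \<otimes> inv (\<sigma> ?b)"
      unfolding val[OF \<tau>] val[OF \<sigma>] .
    then have "inv (\<tau> ?a) \<otimes> (\<tau> ?a \<otimes> \<tau> p \<otimes> inv (\<tau> ?b)) \<otimes> \<tau> ?b = inv (\<tau> ?a) \<otimes> (\<sigma> ?a \<otimes> \<sigma> p \<otimes> inv (\<sigma> ?b)) \<otimes> \<tau> ?b" by simp
    then show ?thesis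
      using cl[OF e(1)] cl[OF e(2)] transport_closed[OF \<tau> p] transport_closed[OF \<sigma> p]
      by (simp add: u_def m_assoc inv_mult_group)
  qed
  moreover have "\<forall>y\<in>topspace X. u y \<in> carrier G" using cl by (simp add: u_def)
  ultimately show ?thesis by (intro exI[of _ u]) simp
qed

section \<open>Transports from first homology\<close>

text \<open>An element of infinite order in an abelian group \<open>A\<close> is detected by a homomorphism to the
  rationals, because it stays nonzero in \<open>A \<otimes> \<rat>\<close>. Here \<open>A\<close> is a free abelian group modulo \<open>B\<close>, and the
  free group is embedded in the space of rational-valued functions on its basis, where linear
  functionals extend from subspaces.\<close>

lemma rational_functional_on_chains:
  fixes B :: "('c \<Rightarrow>\<^sub>0 int) set"
  assumes B0: "0 \<in> B" and B_add: "\<And>a b. a \<in> B \<Longrightarrow> b \<in> B \<Longrightarrow> a + b \<in> B"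
    and B_cmul: "\<And>k a. a \<in> B \<Longrightarrow> frag_cmul k a \<in> B"
    and c: "\<And>n. n > 0 \<Longrightarrow> frag_cmul n c \<notin> B"
  shows "\<exists>H :: ('c \<Rightarrow>\<^sub>0 int) \<Rightarrow> rat. (\<forall>a b. H (a + b) = H a + H b) \<and> (\<forall>b\<in>B. H b = 0) \<and> H c = 1"
proof -
  define sc where "sc = (\<lambda>(r::rat) (f::'c \<Rightarrow> rat) x. r * f x)"
  interpret P: vector_space_pair sc "(*) :: rat \<Rightarrow> rat \<Rightarrow> rat"
    by unfold_locales (auto simp: sc_def fun_eq_iff algebra_simps)
  define emb where "emb a = (\<lambda>x. of_int (Poly_Mapping.lookup a x) :: rat)" for a :: "'c \<Rightarrow>\<^sub>0 int"
  have emb_add: "emb (a + b) = emb a + emb b" for a b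
    by (simp add: emb_def fun_eq_iff lookup_add)
  have emb_cmul: "emb (frag_cmul k a) = sc (of_int k) (emb a)" for k a
    by (simp add: emb_def sc_def fun_eq_iff)
  have emb_inj: "a = b" if "emb a = emb b" for a b
    using that by (intro poly_mapping_eqI) (simp add: emb_def fun_eq_iff)
  define Q where "Q = {v. \<exists>n b. n > 0 \<and> b \<in> B \<and> sc (of_int n) v = emb b}"
  have QI: "v \<in> Q" if "n > 0" "b \<in> B" "sc (of_int n) v = emb b" for v n b
    using that unfolding Q_def by blast
  \<comment> \<open>Clearing denominators: a rational combination of members of \<open>B\<close> has a positive multiple in \<open>B\<close>.\<close>
  have "P.vs1.subspace Q"
  proof (rule P.vs1.subspaceI)
    show "0 \<in> Q" by (rule QI[of 1 0]) (simp_all add: B0 emb_def sc_def fun_eq_iff)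
    fix v assume "v \<in> Q"
    then obtain n b where v: "n > 0" "b \<in> B" "sc (of_int n) v = emb b" unfolding Q_def by blast
    show "v + w \<in> Q" if wQ: "w \<in> Q" for w
    proof -
      obtain m d where w: "m > 0" "d \<in> B" "sc (of_int m) w = emb d" using wQ unfolding Q_def by blast
      show ?thesis
      proof (rule QI)
        show "n * m > 0" using v w by simp
        show "frag_cmul m b + frag_cmul n d \<in> B" using v w by (intro B_add B_cmul)
        have "sc (of_int (n * m)) (v + w) = sc (of_int m) (sc (of_int n) v) + sc (of_int n) (sc (of_int m) w)"
          by (simp add: sc_def fun_eq_iff algebra_simps)
        then show "sc (of_int (n * m)) (v + w) = emb (frag_cmul m b + frag_cmul n d)"
          by (simp add: v w emb_add emb_cmul)
      qed
    qed
    show "sc r v \<in> Q" for r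
    proof -
      obtain p q where pq: "quotient_of r = (p, q)" by (cases "quotient_of r")
      then have q: "q > 0" "r = of_int p / of_int q"
        using quotient_of_denom_pos quotient_of_div by auto
      show ?thesis
      proof (rule QI)
        show "q * n > 0" using q v by simp
        show "frag_cmul p b \<in> B" using v by (intro B_cmul)
        have "sc (of_int (q * n)) (sc r v) = sc (of_int p) (sc (of_int n) v)"
          using q by (simp add: sc_def fun_eq_iff)
        then show "sc (of_int (q * n)) (sc r v) = emb (frag_cmul p b)" by (simp add: v emb_cmul)
      qed
    qed
  qed
  moreover have "emb ` B \<subseteq> Q"
    using QI[of 1] by (auto simp: sc_def)
  ultimately have span: "P.vs1.span (emb ` B) \<subseteq> Q" by (rule P.vs1.span_minimal[rotated])
  have "emb c \<notin> Q"
  proof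
    assume "emb c \<in> Q"
    then obtain n b where v: "n > 0" "b \<in> B" "sc (of_int n) (emb c) = emb b" unfolding Q_def by blast
    then have "frag_cmul n c = b" by (intro emb_inj) (simp add: emb_cmul)
    then show False using c[OF v(1)] v(2) by simp
  qed
  then have cs: "emb c \<notin> P.vs1.span (emb ` B)" using span by blast
  obtain D where D: "D \<subseteq> emb ` B" "\<not> P.vs1.dependent D" "emb ` B \<subseteq> P.vs1.span D"
    using P.vs1.maximal_independent_subset[of "emb ` B"] .
  have cD: "emb c \<notin> P.vs1.span D" using cs P.vs1.span_mono[OF D(1)] by blast
  then have ins: "\<not> P.vs1.dependent (insert (emb c) D)" using D(2) by (rule P.vs1.independent_insertI)
  obtain g where g: "Vector_Spaces.linear sc (*) g" "\<forall>x\<in>insert (emb c) D. g x = (if x = emb c then 1 else 0)"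
    using P.linear_independent_extend[OF ins, of "\<lambda>x. if x = emb c then 1 else 0"] by blast
  interpret g: Vector_Spaces.linear sc "(*) :: rat \<Rightarrow> rat \<Rightarrow> rat" g by (rule g(1))
  have gD: "g x = 0" if "x \<in> D" for x
    using g(2) that cD P.vs1.span_base[OF that] by auto
  have g0: "g x = 0" if "x \<in> P.vs1.span D" for x
    using P.linear_eq_0_on_span[OF g(1) gD that] .
  show ?thesis
  proof (intro exI[of _ "\<lambda>a. g (emb a)"] conjI allI ballI)
    show "g (emb (a + b)) = g (emb a) + g (emb b)" for a b by (simp add: emb_add g.add)
    show "g (emb b) = 0" if "b \<in> B" for b using that D(3) g0 by blast
    show "g (emb c) = 1" using g(2) by simp
  qed
qed

text \<open>A path as a singular 1-simplex; \<open>v 1\<close> is the barycentric coordinate of the end point.\<close>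

definition path_simplex :: "(real \<Rightarrow> 'a) \<Rightarrow> (nat \<Rightarrow> real) \<Rightarrow> 'a" where
  "path_simplex p = restrict (\<lambda>v. p (v 1)) (standard_simplex 1)"

lemma standard_simplex_1: "v \<in> standard_simplex 1 \<Longrightarrow> v 0 = 1 - v 1 \<and> v 1 \<in> {0..1}"
  by (auto simp: standard_simplex_def)

lemma path_simplex_cong: "(\<And>t. t \<in> {0..1} \<Longrightarrow> p t = q t) \<Longrightarrow> path_simplex p = path_simplex q"
  unfolding path_simplex_def using standard_simplex_1 by (intro restrict_ext) blast

lemma continuous_barycentric:
  "continuous_map (subtopology (powertop_real UNIV) S) euclidean (\<lambda>v :: nat \<Rightarrow> real. f v)"
  if "continuous_on S f" for f :: "(nat \<Rightarrow> real) \<Rightarrow> 'v::topological_space"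
  using that by (simp add: euclidean_product_topology)

lemma continuous_on_coordinate: "continuous_on S (\<lambda>v :: nat \<Rightarrow> real. v i)"
  by (rule continuous_on_subset[OF continuous_on_product_coordinates subset_UNIV])

lemma singular_simplex_path:
  assumes "pathin X p" shows "singular_simplex 1 X (path_simplex p)"
  unfolding singular_simplex_def
proof
  have "continuous_map (subtopology (powertop_real UNIV) (standard_simplex 1)) (top_of_set {0..1}) (\<lambda>v. v 1 :: real)"
    unfolding continuous_map_in_subtopology
    by (intro conjI continuous_barycentric continuous_on_coordinate)
      (use standard_simplex_1 in auto)
  from continuous_map_compose[OF this assms[unfolded pathin_def]]
  show "continuous_map (subtopology (powertop_real UNIV) (standard_simplex 1)) X (path_simplex p)"
    by (rule continuous_map_eq) (auto simp: path_simplex_def)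
qed (simp add: path_simplex_def)

lemma curve_class_eq:
  "curve_class X \<gamma> = homologous_rel_set 1 X {} (frag_of (path_simplex (\<lambda>t. \<gamma> (cis (2 * pi * t)))))"
  by (simp add: curve_class_def path_simplex_def)

text \<open>The faces of the singular triangle with vertices \<open>a\<close>, \<open>b\<close>, \<open>c\<close> are the paths along its sides.\<close>

lemma triangle_relboundary:
  fixes K :: "'v::real_normed_vector set"
  assumes K: "convex K" and m: "continuous_map (top_of_set K) X m" and abc: "a \<in> K" "b \<in> K" "c \<in> K"
  shows "singular_relboundary 1 X {} (frag_of (path_simplex (m \<circ> linepath b c))
     - frag_of (path_simplex (m \<circ> linepath a c)) + frag_of (path_simplex (m \<circ> linepath a b)))"
proof -
  define A where "A v = v 0 *\<^sub>R a + v 1 *\<^sub>R b + v 2 *\<^sub>R c" for v :: "nat \<Rightarrow> real"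
  define \<sigma> where "\<sigma> = restrict (m \<circ> A) (standard_simplex 2)"
  have AK: "A v \<in> K" if "v \<in> standard_simplex 2" for v
  proof -
    have v: "0 \<le> v 0" "0 \<le> v 1" "0 \<le> v 2" "v 0 + v 1 + v 2 = 1"
      using that by (auto simp: standard_simplex_def numeral_2_eq_2)
    have "(\<Sum>i\<in>{0,1,2::nat}. v i *\<^sub>R (if i = 0 then a else if i = 1 then b else c)) \<in> K"
      by (rule convex_sum[OF _ K]) (use v abc in \<open>auto simp: add.assoc\<close>)
    then show ?thesis by (simp add: A_def add.assoc)
  qed
  have "continuous_on (standard_simplex 2) A"
    unfolding A_def by (intro continuous_intros continuous_on_coordinate)
  then have "continuous_map (subtopology (powertop_real UNIV) (standard_simplex 2)) (top_of_set K) A"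
    unfolding continuous_map_in_subtopology using AK by (intro conjI continuous_barycentric) auto
  from continuous_map_compose[OF this m]
  have "continuous_map (subtopology (powertop_real UNIV) (standard_simplex 2)) X \<sigma>"
    by (rule continuous_map_eq) (auto simp: \<sigma>_def)
  then have \<sigma>: "singular_simplex 2 X \<sigma>" by (simp add: singular_simplex_def \<sigma>_def)
  have face: "singular_face 2 k \<sigma> = path_simplex (m \<circ> l)"
    if k: "k \<le> 2" and l: "\<And>v. v \<in> standard_simplex 1 \<Longrightarrow> A (simplical_face k v) = l (v 1)" for k l
  proof -
    have "\<sigma> (simplical_face k v) = m (l (v 1))" if v: "v \<in> standard_simplex 1" for v
    proof -
      have "simplical_face k v \<in> standard_simplex 2"
        by (rule simplical_face_in_standard_simplex) (use k v in auto)
      then show ?thesis using l[OF v] by (simp add: \<sigma>_def)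
    qed
    then have "restrict (\<sigma> \<circ> simplical_face k) (standard_simplex 1) = restrict (\<lambda>v. (m \<circ> l) (v 1)) (standard_simplex 1)"
      by (intro restrict_ext) simp
    moreover have "2 - Suc 0 = 1" by simp
    ultimately show ?thesis unfolding singular_face_def path_simplex_def by (simp only:)
  qed
  have "singular_face 2 0 \<sigma> = path_simplex (m \<circ> linepath b c)"
    by (rule face) (use standard_simplex_1 in \<open>auto simp: A_def simplical_face_def linepath_def\<close>)
  moreover have "singular_face 2 1 \<sigma> = path_simplex (m \<circ> linepath a c)"
    by (rule face) (use standard_simplex_1 in \<open>auto simp: A_def simplical_face_def linepath_def\<close>)
  moreover have "singular_face 2 2 \<sigma> = path_simplex (m \<circ> linepath a b)"
    by (rule face) (use standard_simplex_1 in \<open>auto simp: A_def simplical_face_def linepath_def\<close>)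
  moreover have "chain_boundary 2 (frag_of \<sigma>) = frag_of (singular_face 2 0 \<sigma>) - frag_of (singular_face 2 1 \<sigma>)
      + frag_of (singular_face 2 2 \<sigma>)"
    by (simp add: chain_boundary_of numeral_2_eq_2)
  ultimately have "chain_boundary 2 (frag_of \<sigma>) = frag_of (path_simplex (m \<circ> linepath b c))
     - frag_of (path_simplex (m \<circ> linepath a c)) + frag_of (path_simplex (m \<circ> linepath a b))" by simp
  moreover have "singular_chain 2 X (frag_of \<sigma>)" using \<sigma> by (simp add: singular_chain_of)
  ultimately show ?thesis
    unfolding singular_relboundary_def by (intro exI[of _ "frag_of \<sigma>"]) (simp add: numeral_2_eq_2)
qed

lemma homology_class_pow:
  assumes "singular_relcycle 1 X {} a"
  shows "homologous_rel_set 1 X {} a [^]\<^bsub>homology_group 1 X\<^esub> (n::nat) =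
    homologous_rel_set 1 X {} (frag_cmul (int n) a)"
proof -
  interpret G: group "homology_group 1 X" by (rule group_relative_homology_group)
  have mult: "homologous_rel_set 1 X {} a \<otimes>\<^bsub>homology_group 1 X\<^esub> homologous_rel_set 1 X {} b
    = homologous_rel_set 1 X {} (a + b)" for a b
  proof -
    have "(\<Union>r\<in>homologous_rel_set 1 X {} a. \<Union>s\<in>homologous_rel_set 1 X {} b. {r + s}) = homologous_rel_set 1 X {} (a + b)"
    proof (intro equalityI subsetI)
      fix t assume "t \<in> homologous_rel_set 1 X {} (a + b)"
      then have "homologous_rel 1 X {} a (t - b)" by (simp add: homologous_rel_def algebra_simps)
      moreover have "homologous_rel 1 X {} b b" by (rule homologous_rel_refl)
      ultimately show "t \<in> (\<Union>r\<in>homologous_rel_set 1 X {} a. \<Union>s\<in>homologous_rel_set 1 X {} b. {r + s})"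
        by (intro UN_I[of "t - b"] UN_I[of b]) simp_all
    qed (auto intro: homologous_rel_add)
    then show ?thesis using mult_relative_homology_group[of 1 X "{}"] by simp
  qed
  have one: "\<one>\<^bsub>homology_group 1 X\<^esub> = singular_relboundary_set 1 X {}"
    using one_relative_homology_group[of 1 X "{}"] by simp
  show ?thesis
  proof (induction n)
    case 0
    have "homologous_rel_set 1 X {} (0 :: 'a chain) = singular_relboundary_set 1 X {}"
      unfolding homologous_rel_set_eq_relboundary by (rule singular_relboundary_0)
    then show ?case by (simp add: one)
  next
    case (Suc n)
    then show ?case by (simp add: mult[unfolded One_nat_def] frag_cmul_distrib add.commute)
  qed
qed

lemma curve_class_pow_eq_one:
  assumes "continuous_map (top_of_set circle) X \<gamma>"
  shows "curve_class X \<gamma> [^]\<^bsub>homology_group 1 X\<^esub> (n::nat) = \<one>\<^bsub>homology_group 1 X\<^esub> \<longleftrightarrow>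
    singular_relboundary 1 X {} (frag_cmul (int n) (frag_of (path_simplex (\<lambda>t. \<gamma> (cis (2 * pi * t))))))"
proof -
  let ?p = "\<lambda>t. \<gamma> (cis (2 * pi * t))"
  have c: "continuous_map (top_of_set {0..1::real}) (top_of_set circle) (\<lambda>t. cis (2 * pi * t))"
    by (intro continuous_map_I) (auto intro!: continuous_intros)
  have "pathin X (\<gamma> \<circ> (\<lambda>t. cis (2 * pi * t)))"
    unfolding pathin_def by (rule continuous_map_compose[OF c assms])
  then have p: "pathin X ?p" by (simp add: o_def)
  have "singular_relcycle 1 X {} (frag_of (path_simplex ?p))"
    unfolding singular_relcycle_def
  proof
    show "singular_chain 1 X (frag_of (path_simplex ?p))"
      using singular_simplex_path[OF p] by (simp add: singular_chain_of)
    have "singular_face 1 0 (path_simplex ?p) = singular_face 1 1 (path_simplex ?p)"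
      unfolding singular_face_def
    proof (rule restrict_ext)
      fix v :: "nat \<Rightarrow> real" assume v: "v \<in> standard_simplex (1 - Suc 0)"
      have "simplical_face 0 v \<in> standard_simplex 1" "simplical_face 1 v \<in> standard_simplex 1"
        using simplical_face_in_standard_simplex[of 1 0 v] simplical_face_in_standard_simplex[of 1 1 v] v by auto
      moreover have "v 0 = 1" using v by (simp add: standard_simplex_def)
      ultimately show "(path_simplex ?p \<circ> simplical_face 0) v = (path_simplex ?p \<circ> simplical_face 1) v"
        by (simp add: path_simplex_def simplical_face_def)
    qed
    then have "chain_boundary 1 (frag_of (path_simplex ?p)) = 0"
      by (simp add: chain_boundary_of)
    then show "(chain_boundary 1 (frag_of (path_simplex ?p)), 0) \<in> mod_subset (1 - 1) (subtopology X {})" by simp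
  qed
  note pow = homology_class_pow[OF this, of n]
  have one: "\<one>\<^bsub>homology_group 1 X\<^esub> = singular_relboundary_set 1 X {}"
    using one_relative_homology_group[of 1 X "{}"] by simp
  show ?thesis unfolding curve_class_eq pow one by (rule homologous_rel_set_eq_relboundary)
qed

text \<open>The homomorphism \<open>H\<^sub>1(X) \<rightarrow> \<rat>\<close> evaluated on the 1-simplex of a path. Concatenation is a degenerate
  triangle, and a homotopy square consists of two triangles, so both transport laws follow from the
  vanishing on boundaries. Torsion classes go to zero since the target is torsion-free.\<close>

lemma real_transport_of_homology:
  assumes \<mu>: "continuous_map (top_of_set circle) X \<mu>"
    and nt: "\<And>n::nat. n > 0 \<Longrightarrow> curve_class X \<mu> [^]\<^bsub>homology_group 1 X\<^esub> n \<noteq> \<one>\<^bsub>homology_group 1 X\<^esub>"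
  shows "\<exists>h :: (real \<Rightarrow> 'a) \<Rightarrow> real.
    (\<forall>p q. pathin X p \<longrightarrow> pathin X q \<longrightarrow> p 1 = q 0 \<longrightarrow> h (loop_concat p q) = h p + h q) \<and>
    (\<forall>p q. path_homotopic X p q \<longrightarrow> h p = h q) \<and>
    h (\<lambda>t. \<mu> (cis (2 * pi * t))) = 1 \<and>
    (\<forall>\<gamma>. \<forall>n>0::nat. continuous_map (top_of_set circle) X \<gamma> \<longrightarrow>
       curve_class X \<gamma> [^]\<^bsub>homology_group 1 X\<^esub> n = \<one>\<^bsub>homology_group 1 X\<^esub> \<longrightarrow> h (\<lambda>t. \<gamma> (cis (2 * pi * t))) = 0)"
proof -
  let ?B = "singular_relboundary_set 1 X {}"
  let ?c = "frag_of (path_simplex (\<lambda>t. \<mu> (cis (2 * pi * t))))"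
  have "\<exists>H :: ('a chain) \<Rightarrow> rat. (\<forall>a b. H (a + b) = H a + H b) \<and> (\<forall>b\<in>?B. H b = 0) \<and> H ?c = 1"
  proof (rule rational_functional_on_chains)
    fix n :: int assume n: "n > 0"
    then show "frag_cmul n ?c \<notin> ?B"
      using nt[of "nat n"] curve_class_pow_eq_one[OF \<mu>, of "nat n"] by simp
  next
    fix k :: int and a :: "'a chain" assume "a \<in> ?B"
    then obtain d where d: "singular_chain 2 X d" "chain_boundary 2 d = a"
      by (auto simp: singular_boundary numeral_2_eq_2)
    then have "singular_chain 2 X (frag_cmul k d)" "chain_boundary 2 (frag_cmul k d) = frag_cmul k a"
      by (simp_all add: singular_chain_cmul chain_boundary_cmul)
    then show "frag_cmul k a \<in> ?B"
      by (auto simp: singular_boundary numeral_2_eq_2 intro!: exI[of _ "frag_cmul k d"])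
  qed (simp_all add: singular_relboundary_0 singular_relboundary_add)
  then obtain H :: "('a chain) \<Rightarrow> rat" where H: "\<And>a b. H (a + b) = H a + H b"
    "\<And>b. singular_relboundary 1 X {} b \<Longrightarrow> H b = 0" "H ?c = 1" by blast
  have H_diff: "H (a - b) = H a - H b" for a b using H(1)[of "a - b" b] by simp
  have H_0: "H 0 = 0" using H(1)[of 0 0] by simp
  have H_cmul: "H (frag_cmul (int n) a) = of_nat n * H a" for n a
    by (induction n) (simp_all add: H_0 H(1) frag_cmul_distrib algebra_simps)
  define h :: "(real \<Rightarrow> 'a) \<Rightarrow> real" where "h p = of_rat (H (frag_of (path_simplex p)))" for p
  have h_cong: "h p = h q" if "\<And>t. t \<in> {0..1} \<Longrightarrow> p t = q t" for p q
    using path_simplex_cong[of p q] that by (simp add: h_def)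
  have line: "h (m \<circ> linepath a c) = h (m \<circ> linepath a b) + h (m \<circ> linepath b c)"
    if "convex K" "continuous_map (top_of_set K) X m" "a \<in> K" "b \<in> K" "c \<in> K"
    for K :: "'v::real_normed_vector set" and m a b c
    using H(2)[OF triangle_relboundary[OF that]] by (simp add: h_def H(1) H_diff of_rat_diff flip: of_rat_add)
  have const: "h (\<lambda>_. x) = 0" if "x \<in> topspace X" for x
    using line[of "UNIV :: real set" "\<lambda>_. x" 0 0 0] that by (simp add: o_def)
  show ?thesis
  proof (intro exI[of _ h] conjI allI impI)
    fix p q assume p: "pathin X p" and q: "pathin X q" and e: "p 1 = q 0"
    let ?m = "loop_concat p q"
    have m: "continuous_map (top_of_set {0..1}) X ?m" using pathin_loop_concat[OF p q e] by (simp add: pathin_def)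
    have "h (?m \<circ> linepath 0 1) = h (?m \<circ> linepath 0 (1/2)) + h (?m \<circ> linepath (1/2) 1)"
      by (rule line[OF _ m]) auto
    moreover have "h (?m \<circ> linepath 0 1) = h ?m" by (rule h_cong) (simp add: linepath_def)
    moreover have "h (?m \<circ> linepath 0 (1/2)) = h p"
      by (rule h_cong) (simp add: linepath_def loop_concat_def)
    moreover have "h (?m \<circ> linepath (1/2) 1) = h q"
      by (rule h_cong) (auto simp: linepath_def loop_concat_def e field_simps)
    ultimately show "h ?m = h p + h q" by simp
  next
    fix p q assume pq: "path_homotopic X p q"
    then obtain F where F: "continuous_map (top_of_set ({0..1::real} \<times> {0..1})) X F"
        "\<And>t. t\<in>{0..1} \<Longrightarrow> F (0, t) = p t \<and> F (1, t) = q t"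
        "\<And>s. s\<in>{0..1} \<Longrightarrow> F (s, 0) = p 0 \<and> F (s, 1) = p 1"
      unfolding path_homotopic_iff by blast
    have K: "convex ({0..1::real} \<times> {0..1::real})" by (intro convex_Times) auto
    have pp: "p 0 \<in> topspace X" "p 1 \<in> topspace X"
      using path_homotopic_pathin(1)[OF pq] path_start_in_topspace path_finish_in_topspace by auto
    have "h (F \<circ> linepath (0,0) (1,1)) = h (F \<circ> linepath (0,0) (0,1)) + h (F \<circ> linepath (0,1) (1,1))"
      by (rule line[OF K F(1)]) auto
    moreover have "h (F \<circ> linepath (0,0) (0,1)) = h p" by (rule h_cong) (simp add: linepath_def F(2))
    moreover have "h (F \<circ> linepath (0,1) (1,1)) = h (\<lambda>_. p 1)" by (rule h_cong) (simp add: linepath_def F(3))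
    moreover have "h (F \<circ> linepath (0,0) (1,1)) = h (F \<circ> linepath (0,0) (1,0)) + h (F \<circ> linepath (1,0) (1,1))"
      by (rule line[OF K F(1)]) auto
    moreover have "h (F \<circ> linepath (0,0) (1,0)) = h (\<lambda>_. p 0)" by (rule h_cong) (simp add: linepath_def F(3))
    moreover have "h (F \<circ> linepath (1,0) (1,1)) = h q" by (rule h_cong) (simp add: linepath_def F(2))
    ultimately show "h p = h q" using const[OF pp(1)] const[OF pp(2)] by simp
  next
    show "h (\<lambda>t. \<mu> (cis (2 * pi * t))) = 1" by (simp add: h_def H(3))
  next
    fix \<gamma> and n :: nat
    assume n: "n > 0" and \<gamma>: "continuous_map (top_of_set circle) X \<gamma>"
      and "curve_class X \<gamma> [^]\<^bsub>homology_group 1 X\<^esub> n = \<one>\<^bsub>homology_group 1 X\<^esub>"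
    then have "H (frag_cmul (int n) (frag_of (path_simplex (\<lambda>t. \<gamma> (cis (2 * pi * t)))))) = 0"
      by (intro H(2)) (simp add: curve_class_pow_eq_one)
    then show "h (\<lambda>t. \<gamma> (cis (2 * pi * t))) = 0" using n by (simp add: H_cmul h_def)
  qed
qed

section \<open>Dehn fillings\<close>

abbreviation solid_torus :: "(complex \<times> complex) set" where
  "solid_torus \<equiv> circle \<times> cball 0 1"

lemma torus_subset_solid: "torus \<subseteq> solid_torus"
  by auto

lemma continuous_disc:
  "a \<in> circle \<Longrightarrow> continuous_map (top_of_set (cball 0 1)) (top_of_set solid_torus) (\<lambda>b. (a, b))"
  by (intro continuous_map_I) (auto intro!: continuous_intros)

lemma (in group) transport_conjugated:
  assumes o: "path_transport G W \<omega>" and p: "pathin W a" "pathin W b" "pathin W c" "a 0 = b 0" "b 1 = c 0"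
  shows "\<exists>d. pathin W d \<and> d 0 = a 1 \<and> d 1 = c 1 \<and> \<omega> d = inv (\<omega> a) \<otimes> \<omega> b \<otimes> \<omega> c"
proof -
  let ?ab = "loop_concat (reverse_path a) b"
  have ra: "pathin W (reverse_path a)" by (rule pathin_reverse[OF p(1)])
  have ab: "pathin W ?ab" by (rule pathin_loop_concat[OF ra p(2)]) (simp add: p)
  have "pathin W (loop_concat ?ab c)" by (rule pathin_loop_concat[OF ab p(3)]) (simp add: p)
  moreover have "\<omega> (loop_concat ?ab c) = \<omega> ?ab \<otimes> \<omega> c" by (rule transport_concat[OF o ab p(3)]) (simp add: p)
  moreover have "\<omega> ?ab = \<omega> (reverse_path a) \<otimes> \<omega> b" by (rule transport_concat[OF o ra p(2)]) (simp add: p)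
  ultimately show ?thesis
    using transport_reverse[OF o p(1)] by (intro exI[of _ "loop_concat ?ab c"]) simp
qed

text \<open>Every path in the solid torus with ends on the boundary can be pushed to the boundary: contract the
  disc factor to the boundary point \<open>1\<close>, and correct at both ends by arcs in the boundary circles of
  meridian discs.\<close>

lemma (in group) solid_torus_path:
  assumes o: "path_transport G (top_of_set solid_torus) \<omega>" and r: "pathin (top_of_set solid_torus) r"
    and e: "r 0 \<in> torus" "r 1 \<in> torus"
  shows "\<exists>q. pathin (top_of_set torus) q \<and> q 0 = r 0 \<and> q 1 = r 1 \<and> \<omega> q = \<omega> r"
proof -
  let ?V = "top_of_set solid_torus"
  have rc: "continuous_on {0..1} r" "r ` {0..1} \<subseteq> solid_torus" using r by (simp_all add: pathin_top_of_set)
  have rm: "r t \<in> solid_torus" if "t \<in> {0..1}" for t using rc(2) that by blast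
  \<comment> \<open>Each end is joined inside its meridian disc to the point \<open>1\<close> of the boundary circle; the
    choice of the path in the disc does not matter.\<close>
  have side: "\<exists>c. pathin (top_of_set torus) c \<and> c 0 = x \<and> c 1 = (fst x, 1) \<and>
      \<omega> c = \<omega> (\<lambda>s. (fst x, linepath (snd x) 1 s))" if x: "x \<in> torus" for x
  proof -
    have "path_connected (sphere (0::complex) 1)" by (intro path_connected_sphere) simp
    moreover have "snd x \<in> circle" "1 \<in> circle" using x by auto
    ultimately obtain \<alpha> where \<alpha>: "path \<alpha>" "path_image \<alpha> \<subseteq> circle" "pathstart \<alpha> = snd x" "pathfinish \<alpha> = 1"
      unfolding path_connected_def by meson
    have \<alpha>c: "continuous_on {0..1} \<alpha>" "\<alpha> ` {0..1} \<subseteq> circle" "\<alpha> 0 = snd x" "\<alpha> 1 = 1"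
      using \<alpha> by (auto simp: path_def path_image_def pathstart_def pathfinish_def)
    have fx: "fst x \<in> circle" using x by auto
    have "\<omega> ((\<lambda>b. (fst x, b)) \<circ> \<alpha>) = \<omega> ((\<lambda>b. (fst x, b)) \<circ> linepath (snd x) 1)"
    proof (rule transport_convex[OF o _ continuous_disc[OF fx]])
      show "pathin (top_of_set (cball 0 1)) \<alpha>"
        using \<alpha>c(1,2) sphere_cball by (auto simp: pathin_top_of_set)
      show "pathin (top_of_set (cball 0 1)) (linepath (snd x) 1)"
        using x by (intro pathin_linepath) auto
    qed (simp_all add: \<alpha>c linepath_0' linepath_1')
    moreover have "pathin (top_of_set torus) ((\<lambda>b. (fst x, b)) \<circ> \<alpha>)"
      unfolding pathin_top_of_set o_def using \<alpha>c(1,2) fx by (auto intro!: continuous_intros)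
    ultimately show ?thesis
      using \<alpha>c(3,4) by (intro exI[of _ "(\<lambda>b. (fst x, b)) \<circ> \<alpha>"]) (simp add: o_def)
  qed
  obtain c0 where c0: "pathin (top_of_set torus) c0" "c0 0 = r 0" "c0 1 = (fst (r 0), 1)"
    "\<omega> c0 = \<omega> (\<lambda>s. (fst (r 0), linepath (snd (r 0)) 1 s))" using side[OF e(1)] by (elim exE conjE)
  obtain c1 where c1: "pathin (top_of_set torus) c1" "c1 0 = r 1" "c1 1 = (fst (r 1), 1)"
    "\<omega> c1 = \<omega> (\<lambda>s. (fst (r 1), linepath (snd (r 1)) 1 s))" using side[OF e(2)] by (elim exE conjE)
  define top where "top t = (fst (r t), 1 :: complex)" for t
  have top: "pathin (top_of_set torus) top"
    unfolding pathin_top_of_set top_def using rc by (auto intro!: continuous_intros)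
  let ?m = "\<lambda>z. (fst (r (snd z)), linepath (snd (r (snd z))) 1 (fst z))"
  have "continuous_map (top_of_set ({0..1::real} \<times> {0..1::real})) ?V ?m"
  proof (rule continuous_map_I)
    show "continuous_on ({0..1} \<times> {0..1}) ?m"
      unfolding linepath_def
      by (intro continuous_intros continuous_on_compose2[OF rc(1)]) auto
    show "?m ` ({0..1} \<times> {0..1}) \<subseteq> solid_torus"
    proof (rule image_subsetI)
      fix z :: "real \<times> real" assume z: "z \<in> {0..1} \<times> {0..1}"
      have "snd z \<in> {0..1}" "fst z \<in> {0..1}" using z by auto
      then have r1: "fst (r (snd z)) \<in> circle" "snd (r (snd z)) \<in> cball 0 1" using rm by (auto simp: mem_Times_iff)
      have "linepath (snd (r (snd z))) 1 (fst z) \<in> cball 0 1"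
        using pathin_linepath[of "cball (0::complex) 1" "snd (r (snd z))" 1] r1(2) \<open>fst z \<in> {0..1}\<close>
        unfolding pathin_top_of_set by (simp add: image_subset_iff)
      then show "?m z \<in> solid_torus" using r1(1) by simp
    qed
  qed
  from transport_square[OF o this]
  have "\<omega> r \<otimes> \<omega> c1 = \<omega> c0 \<otimes> \<omega> top"
    unfolding c0(4) c1(4) top_def by (simp add: linepath_0' linepath_1')
  moreover have tt: "pathin ?V c" if "pathin (top_of_set torus) c" for c
    using that torus_subset_solid unfolding pathin_top_of_set by blast
  ultimately have 1: "\<omega> r = \<omega> c0 \<otimes> \<omega> top \<otimes> inv (\<omega> c1)"
    using transport_closed[OF o] c0(1) c1(1) top r inv_solve_right by (metis m_closed)
  have o': "path_transport G (top_of_set torus) \<omega>"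
    using transport_compose[OF o, of "top_of_set torus" id] continuous_map_I[of torus id solid_torus] torus_subset_solid
    by (simp add: continuous_on_id)
  have rc0: "pathin (top_of_set torus) (reverse_path c0)" "pathin (top_of_set torus) (reverse_path c1)"
    using c0(1) c1(1) by (auto intro: pathin_reverse)
  obtain q where "pathin (top_of_set torus) q" "q 0 = reverse_path c0 1" "q 1 = reverse_path c1 1"
    "\<omega> q = inv (\<omega> (reverse_path c0)) \<otimes> \<omega> top \<otimes> \<omega> (reverse_path c1)"
    using transport_conjugated[OF o' rc0(1) top rc0(2)] c0(3) c1(3) by (auto simp: top_def)
  moreover have "\<omega> c0 \<in> carrier G" using transport_closed[OF o' c0(1)] .
  ultimately show ?thesis
    using 1 transport_reverse[OF o' c0(1)] transport_reverse[OF o' c1(1)] c0(2) c1(2)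
    by (intro exI[of _ q]) simp
qed

text \<open>At \<open>s = 1\<close> the inner half of each meridian disc is stretched over the disc and the outer half is
  retracted to the boundary circle; at \<open>s = 0\<close> nothing moves. The maximum keeps the stretching factor
  at \<open>2\<close> on the inner half.\<close>

definition push :: "real \<Rightarrow> complex \<times> complex \<Rightarrow> complex \<times> complex" where
  "push s v = (fst v, (1 + s * (1 / max (norm (snd v)) (1/2) - 1)) *\<^sub>R snd v)"

lemma push_0 [simp]: "push 0 v = v"
  by (simp add: push_def)

lemma push_torus: "v \<in> torus \<Longrightarrow> push s v = v"
  by (auto simp: push_def)

lemma push_1_torus: "v \<in> solid_torus \<Longrightarrow> norm (snd v) \<ge> 1/2 \<Longrightarrow> push 1 v \<in> torus"
  by (cases "snd v = 0") (auto simp: push_def max_absorb1)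

lemma push_solid:
  assumes "s \<in> {0..1}" "v \<in> solid_torus" shows "push s v \<in> solid_torus"
proof -
  let ?b = "snd v" and ?k = "1 / max (norm (snd v)) (1/2)"
  have "?k * norm ?b \<le> 1" by (simp add: divide_le_eq max_def)
  moreover have "norm ?b \<le> 1" using assms(2) by auto
  ultimately have "(1 - s) * norm ?b + s * (?k * norm ?b) \<le> 1"
    using assms(1) by (intro convex_bound_le) auto
  moreover have "norm ((1 + s * (?k - 1)) *\<^sub>R ?b) = (1 - s) * norm ?b + s * (?k * norm ?b)"
  proof -
    have "?k \<ge> 0" by (simp add: max_def)
    then have "0 \<le> s * ?k" using assms(1) by (intro mult_nonneg_nonneg) auto
    then have "1 + s * (?k - 1) = (1 - s) + s * ?k" "(1 - s) + s * ?k \<ge> 0"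
      using assms(1) by (simp add: algebra_simps, simp)
    then show ?thesis by (simp only: norm_scaleR abs_of_nonneg) (simp add: algebra_simps)
  qed
  ultimately show ?thesis using assms(2) by (auto simp: push_def)
qed

lemma continuous_push:
  assumes "continuous_on T l" "continuous_on T u"
  shows "continuous_on T (\<lambda>z. push (u z) (l z))"
proof -
  have nz: "max (norm x) (1/2) \<noteq> 0" for x :: complex
    using max.cobounded2[of "1/2" "norm x"] by linarith
  show ?thesis
    unfolding push_def using nz by (intro continuous_intros assms) blast
qed

locale solid_torus_filling = group G + gluing "top_of_set solid_torus" torus \<psi> Z
  for G :: "('g, 'm) monoid_scheme" (structure)
    and \<psi> :: "complex \<times> complex \<Rightarrow> 'z" and Z :: "'z topology" +
  fixes \<tau> :: "(real \<Rightarrow> (complex \<times> complex + 'z) set) \<Rightarrow> 'g"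
  assumes transport: "path_transport G Y \<tau>"
begin

abbreviation "V \<equiv> top_of_set solid_torus"

lemma transport_V: "path_transport G V (\<lambda>r. \<tau> (inl \<circ> r))"
  by (rule transport_compose[OF transport continuous_inl])

lemma transport_Z: "path_transport G Z (\<lambda>q. \<tau> (inr \<circ> q))"
  by (rule transport_compose[OF transport continuous_inr])

text \<open>A loop in the boundary of the meridian disc at \<open>1\<close> bounds in the filling.\<close>

lemma meridian_trivial:
  assumes "pathin (top_of_set circle) c" "c 0 = c 1"
  shows "\<tau> (inr \<circ> (\<lambda>t. \<psi> (1, c t))) = \<one>"
proof -
  have c: "c t \<in> circle" if "t \<in> {0..1}" for t
    using assms(1) that by (simp add: pathin_top_of_set image_subset_iff)
  have d: "pathin (top_of_set (cball 0 1)) c"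
    using assms(1) sphere_cball unfolding pathin_top_of_set by blast
  have "\<tau> (inl \<circ> ((\<lambda>b. (1, b)) \<circ> c)) = \<one>"
    by (rule transport_closed_path[OF transport_V _ continuous_disc d assms(2)]) auto
  moreover have "\<tau> (inr \<circ> (\<lambda>t. \<psi> (1, c t))) = \<tau> (inl \<circ> ((\<lambda>b. (1, b)) \<circ> c))"
  proof (rule transport_cong[OF transport])
    show "pathin Y (inl \<circ> ((\<lambda>b. (1, b)) \<circ> c))"
      using continuous_inl continuous_disc[of 1] d by (intro pathin_compose[OF _ continuous_inl] pathin_compose[OF d]) auto
    show "(inr \<circ> (\<lambda>t. \<psi> (1, c t))) t = (inl \<circ> ((\<lambda>b. (1, b)) \<circ> c)) t" if "t \<in> {0..1}" for t
      using c[OF that] by (simp add: inl_seam)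
  qed
  ultimately show ?thesis by simp
qed

lemma solid_path_to_Z:
  assumes r: "pathin V r" "r 0 \<in> torus" "r 1 \<in> torus"
  shows "\<exists>q. pathin Z q \<and> q 0 = \<psi> (r 0) \<and> q 1 = \<psi> (r 1) \<and> \<tau> (inr \<circ> q) = \<tau> (inl \<circ> r)"
proof -
  obtain q where q: "pathin (top_of_set torus) q" "q 0 = r 0" "q 1 = r 1" "\<tau> (inl \<circ> q) = \<tau> (inl \<circ> r)"
    using solid_torus_path[OF transport_V r] by (elim exE conjE)
  have "subtopology V torus = top_of_set torus"
    using torus_subset_solid by (simp add: subtopology_subtopology inf.absorb2)
  then have "continuous_map (top_of_set torus) Z \<psi>"
    using homeomorphic_imp_continuous_map[OF seam_homeo] by (simp add: continuous_map_in_subtopology)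
  then have p: "pathin Z (\<psi> \<circ> q)" by (rule pathin_compose[OF q(1)])
  have "\<tau> (inl \<circ> q) = \<tau> (inr \<circ> (\<psi> \<circ> q))"
  proof (rule transport_cong[OF transport pathin_compose[OF p continuous_inr]])
    show "(inl \<circ> q) t = (inr \<circ> (\<psi> \<circ> q)) t" if "t \<in> {0..1}" for t
    proof -
      have "q t \<in> torus" using q(1) that unfolding pathin_top_of_set by blast
      then show ?thesis by (simp add: inl_seam)
    qed
  qed
  then show ?thesis using p q by (intro exI[of _ "\<psi> \<circ> q"]) simp
qed

text \<open>Subpaths of a path in the filling may end outside \<open>Z\<close>; tethers move their end points to \<open>Z\<close>. For
  points of \<open>Z\<close> the constant tether is admitted, since they need not be joined to the solid torus.\<close>

definition tether :: "(complex \<times> complex + 'z) set \<Rightarrow> 'z \<Rightarrow> 'g \<Rightarrow> bool" where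
  "tether w y g \<longleftrightarrow> y \<in> topspace Z \<and> ((w = inr y \<and> g = \<one>) \<or>
     (\<exists>r. pathin V r \<and> w = inl (r 0) \<and> r 1 \<in> torus \<and> y = \<psi> (r 1) \<and> g = \<tau> (inl \<circ> r)))"

lemma tether_inr:
  assumes "tether (inr y0) y g" "y0 \<in> topspace Z"
  shows "\<exists>q. pathin Z q \<and> q 0 = y0 \<and> q 1 = y \<and> \<tau> (inr \<circ> q) = g"
proof -
  consider "y0 = y" "g = \<one>"
    | r where "pathin V r" "inr y0 = inl (r 0)" "r 1 \<in> torus" "y = \<psi> (r 1)" "g = \<tau> (inl \<circ> r)"
    using assms(1) unfolding tether_def by auto
  then show ?thesis
  proof cases
    case 1
    then show ?thesis using transport_const[OF transport_Z assms(2)] assms(2) by (intro exI[of _ "\<lambda>_. y"]) simp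
  next
    case (2 r)
    have "r 0 \<in> torus" "y0 = \<psi> (r 0)" using 2(2) by (simp_all add: inr_eq_inl)
    then show ?thesis using solid_path_to_Z[OF 2(1) _ 2(3)] 2(4,5) by simp
  qed
qed

lemma tether_inl:
  assumes "tether (inl v) y g" "v \<in> solid_torus"
  shows "\<exists>r. pathin V r \<and> r 0 = v \<and> r 1 \<in> torus \<and> y = \<psi> (r 1) \<and> \<tau> (inl \<circ> r) = g"
proof -
  consider "inl v = inr y" "g = \<one>"
    | r where "pathin V r" "inl v = inl (r 0)" "r 1 \<in> torus" "y = \<psi> (r 1)" "g = \<tau> (inl \<circ> r)"
    using assms(1) unfolding tether_def by auto
  then show ?thesis
  proof cases
    case 1
    then have "v \<in> torus" "y = \<psi> v" by (simp_all add: inl_eq_inr)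
    then show ?thesis using transport_const[OF transport_V, of v] assms(2) 1(2) by (intro exI[of _ "\<lambda>_. v"]) simp
  next
    case (2 r)
    then show ?thesis by (intro exI[of _ r]) simp
  qed
qed

lemma tether_exists:
  assumes "w \<in> topspace Y" shows "\<exists>y g. tether w y g"
proof -
  consider y where "y \<in> topspace Z" "w = inr y" | v where "v \<in> solid_torus" "w = inl v"
    using assms unfolding topspace_Y by auto
  then show ?thesis
  proof cases
    case 1 then show ?thesis unfolding tether_def by blast
  next
    case (2 v)
    have v: "fst v \<in> circle" "snd v \<in> cball 0 1" using 2(1) by auto
    have "pathin V ((\<lambda>b. (fst v, b)) \<circ> linepath (snd v) 1)"
      by (rule pathin_compose[OF pathin_linepath continuous_disc[OF v(1)]]) (use v in auto)
    moreover have t: "(fst v, 1) \<in> torus" using v by auto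
    moreover have "\<psi> (fst v, 1) \<in> topspace Z" using t fS_subset by blast
    ultimately have "tether w (\<psi> (fst v, 1)) (\<tau> (inl \<circ> ((\<lambda>b. (fst v, b)) \<circ> linepath (snd v) 1)))"
      unfolding tether_def 2(2)
      by (intro conjI disjI2 exI[of _ "(\<lambda>b. (fst v, b)) \<circ> linepath (snd v) 1"]) (simp_all add: linepath_0' linepath_1')
    then show ?thesis by blast
  qed
qed

definition linv :: "(complex \<times> complex + 'z) set \<Rightarrow> complex \<times> complex" where
  "linv w = the_inv_into solid_torus inl w"

lemma linv_inl [simp]: "v \<in> solid_torus \<Longrightarrow> linv (inl v) = v"
  unfolding linv_def by (intro the_inv_into_f_f) (auto simp: inj_on_def)

lemma continuous_linv: "continuous_map (subtopology Y (inl ` solid_torus)) V linv"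
proof -
  obtain k where k: "homeomorphic_maps V (subtopology Y (inl ` solid_torus)) inl k"
    using homeomorphic_inl unfolding homeomorphic_map_maps by auto
  then have "continuous_map (subtopology Y (inl ` solid_torus)) V k" by (simp add: homeomorphic_maps_def)
  then show ?thesis
    by (rule continuous_map_eq) (use k in \<open>auto simp: homeomorphic_maps_def\<close>)
qed

definition pushed :: "real \<Rightarrow> (complex \<times> complex + 'z) set \<Rightarrow> (complex \<times> complex + 'z) set" where
  "pushed s w = (if w \<in> inl ` solid_torus then inl (push s (linv w)) else w)"

lemma pushed_inl: "v \<in> solid_torus \<Longrightarrow> pushed s (inl v) = inl (push s v)"
  by (simp add: pushed_def)

lemma pushed_inr: "pushed s (inr y) = inr y"
proof (cases "inr y \<in> inl ` solid_torus")
  case True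
  then obtain v where v: "v \<in> solid_torus" "inr y = inl v" by blast
  then have "v \<in> torus" by (simp add: inr_eq_inl)
  then show ?thesis using v by (simp add: pushed_inl push_torus)
qed (simp add: pushed_def)

lemma pathin_of_inl:
  assumes "pathin Y p" "\<And>t. t \<in> {0..1} \<Longrightarrow> p t \<in> inl ` solid_torus"
  shows "\<exists>r. pathin V r \<and> (\<forall>t\<in>{0..1}. p t = inl (r t))"
proof -
  have "pathin (subtopology Y (inl ` solid_torus)) p" using assms by (simp add: pathin_subtopology)
  then have "pathin V (linv \<circ> p)" by (rule pathin_compose[OF _ continuous_linv])
  moreover have "p t = inl ((linv \<circ> p) t)" if t: "t \<in> {0..1}" for t
  proof -
    obtain v where "v \<in> solid_torus" "p t = inl v" using assms(2)[OF t] by (rule imageE)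
    then show ?thesis by simp
  qed
  ultimately show ?thesis by (intro exI[of _ "linv \<circ> p"] conjI ballI)
qed

lemma pathin_of_inr:
  assumes "pathin Y p" "\<And>t. t \<in> {0..1} \<Longrightarrow> p t \<in> inr ` topspace Z"
  shows "\<exists>q. pathin Z q \<and> (\<forall>t\<in>{0..1}. p t = inr (q t))"
proof -
  obtain k where k: "homeomorphic_maps Z (subtopology Y (inr ` topspace Z)) inr k"
    using homeomorphic_inr unfolding homeomorphic_map_maps by auto
  have "pathin (subtopology Y (inr ` topspace Z)) p" using assms by (simp add: pathin_subtopology)
  moreover have "continuous_map (subtopology Y (inr ` topspace Z)) Z k" using k by (simp add: homeomorphic_maps_def)
  ultimately have "pathin Z (k \<circ> p)" by (rule pathin_compose)
  moreover have "p t = inr ((k \<circ> p) t)" if t: "t \<in> {0..1}" for t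
  proof -
    obtain y where y: "y \<in> topspace Z" "p t = inr y" using assms(2)[OF t] by (rule imageE)
    then have "k (inr y) = y" using k unfolding homeomorphic_maps_def by blast
    then show ?thesis using y(2) by simp
  qed
  ultimately show ?thesis by (intro exI[of _ "k \<circ> p"] conjI ballI)
qed

lemma continuous_pushed:
  assumes p: "pathin Y p"
  shows "continuous_map (top_of_set ({0..1} \<times> {0..1})) Y (\<lambda>z. pushed (fst z) (p (snd z)))"
proof -
  let ?Q = "{0..1::real} \<times> {0..1::real}"
  have ps: "continuous_map (top_of_set ?Q) Y (p \<circ> snd)"
    by (rule continuous_map_compose[OF _ p[unfolded pathin_def]]) (auto intro!: continuous_map_I continuous_intros)
  let ?L = "inl ` solid_torus" and ?R = "inr ` topspace Z" and ?F = "\<lambda>z. pushed (fst z) (p (snd z))"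
  define T where "T R = {z \<in> ?Q. p (snd z) \<in> R}" for R
  have TQ: "T R \<subseteq> ?Q" for R unfolding T_def by (rule Collect_subset)
  have clo: "closedin (top_of_set ?Q) (T R)" if "closedin Y R" for R
    using closedin_continuous_map_preimage[OF ps that] by (simp add: T_def)
  have sub: "subtopology (top_of_set ?Q) (T R) = top_of_set (T R)" for R
    using TQ[of R] by (simp only: subtopology_subtopology inf.absorb2)
  have pT: "continuous_map (top_of_set (T R)) Y (p \<circ> snd)" for R
    by (rule continuous_map_from_subtopology_mono[OF ps TQ])
  have L: "continuous_map (top_of_set (T ?L)) Y ?F"
  proof -
    have pL: "p (snd z) \<in> ?L" if "z \<in> T ?L" for z using that unfolding T_def by blast
    have "continuous_map (top_of_set (T ?L)) (subtopology Y ?L) (p \<circ> snd)"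
      unfolding continuous_map_in_subtopology using pT[of ?L] pL by simp
    from continuous_map_compose[OF this continuous_linv]
    have l: "continuous_on (T ?L) (linv \<circ> (p \<circ> snd))" "(linv \<circ> (p \<circ> snd)) ` T ?L \<subseteq> solid_torus"
      unfolding continuous_map_in_subtopology image_subset_iff_funcset by simp_all
    have "continuous_map (top_of_set (T ?L)) V (\<lambda>z. push (fst z) ((linv \<circ> (p \<circ> snd)) z))"
    proof (rule continuous_map_I)
      show "continuous_on (T ?L) (\<lambda>z. push (fst z) ((linv \<circ> (p \<circ> snd)) z))"
        by (rule continuous_push[OF l(1) continuous_on_fst[OF continuous_on_id]])
      show "(\<lambda>z. push (fst z) ((linv \<circ> (p \<circ> snd)) z)) ` T ?L \<subseteq> solid_torus"
      proof (rule image_subsetI)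
        fix z assume z: "z \<in> T ?L"
        have "fst z \<in> {0..1}" using z TQ[of ?L] by (auto simp only: mem_Times_iff subset_iff)
        moreover have "(linv \<circ> (p \<circ> snd)) z \<in> solid_torus" using l(2) z by blast
        ultimately show "push (fst z) ((linv \<circ> (p \<circ> snd)) z) \<in> solid_torus" by (rule push_solid)
      qed
    qed
    from continuous_map_compose[OF this continuous_inl]
    show ?thesis
    proof (rule continuous_map_eq)
      fix z assume "z \<in> topspace (top_of_set (T ?L))"
      then have "p (snd z) \<in> ?L" using pL by simp
      then show "(inl \<circ> (\<lambda>z. push (fst z) ((linv \<circ> (p \<circ> snd)) z))) z = ?F z"
        by (simp only: pushed_def if_True o_apply)
    qed
  qed
  have R: "continuous_map (top_of_set (T ?R)) Y ?F"
  proof (rule continuous_map_eq[OF pT])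
    fix z assume "z \<in> topspace (top_of_set (T ?R))"
    then have "p (snd z) \<in> ?R" by (simp add: T_def)
    then obtain y where "p (snd z) = inr y" by (rule imageE)
    then show "(p \<circ> snd) z = ?F z" by (simp only: pushed_inr o_apply)
  qed
  show ?thesis
  proof (rule pasting_lemma_closed[of "{?L, ?R}" _ T _ "\<lambda>_. ?F"])
    show "closedin (top_of_set ?Q) (T A)" if "A \<in> {?L, ?R}" for A
      using that closedin_inl[of solid_torus] closedin_inr[of "topspace Z"] by (intro clo) auto
    show "continuous_map (subtopology (top_of_set ?Q) (T A)) Y ?F" if "A \<in> {?L, ?R}" for A
      unfolding sub using that L R by blast
  next
    fix z assume z: "z \<in> topspace (top_of_set ?Q)"
    have "p (snd z) \<in> topspace Y" using path_image_subset_topspace[OF p] z by auto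
    then have "z \<in> T ?L \<or> z \<in> T ?R" using z unfolding topspace_Y T_def by simp
    then show "\<exists>A. A \<in> {?L, ?R} \<and> z \<in> T A \<and> ?F z = ?F z" by blast
  qed simp_all
qed

text \<open>Pushing the filling outwards moves every path into pieces that lie in the solid torus or in \<open>Z\<close>;
  a piece in the solid torus whose ends are tethered to \<open>Z\<close> can be replaced by a path on the torus.\<close>

lemma path_to_Z:
  assumes p: "pathin Y p" "p 0 = inr y0" "p 1 = inr y1" and y: "y0 \<in> topspace Z" "y1 \<in> topspace Z"
  shows "\<exists>q. pathin Z q \<and> q 0 = y0 \<and> q 1 = y1 \<and> \<tau> (inr \<circ> q) = \<tau> p"
proof -
  have pY: "p t \<in> topspace Y" if "t \<in> {0..1}" for t using path_image_subset_topspace[OF p(1)] that by auto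
  define p' where "p' = (\<lambda>t. pushed 1 (p t))"
  have m: "continuous_map (top_of_set ({0..1} \<times> {0..1})) Y (\<lambda>z. pushed (fst z) (p (snd z)))"
    by (rule continuous_pushed[OF p(1)])
  have p': "pathin Y p'"
  proof -
    have "continuous_map (top_of_set {0..1::real}) (top_of_set ({0..1} \<times> {0..1})) (\<lambda>t. (1::real, t))"
      by (intro continuous_map_I) (auto intro!: continuous_intros)
    from continuous_map_compose[OF this m] show ?thesis by (simp add: pathin_def p'_def o_def)
  qed
  have ends: "p' 0 = inr y0" "p' 1 = inr y1" by (simp_all add: p'_def p pushed_inr)
  have eq: "\<tau> p = \<tau> p'"
  proof -
    have p0: "pushed 0 w = w" if "w \<in> topspace Y" for w using that by (auto simp: pushed_def)
    have "\<tau> (\<lambda>t. pushed 0 (p t)) \<otimes> \<tau> (\<lambda>s. pushed s (p 1)) = \<tau> (\<lambda>s. pushed s (p 0)) \<otimes> \<tau> p'"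
      using transport_square[OF transport m] by (simp add: p'_def)
    moreover have "\<tau> (\<lambda>t. pushed 0 (p t)) = \<tau> p"
      by (rule transport_cong[OF transport p(1)]) (simp add: p0 pY)
    moreover have "\<tau> (\<lambda>s. pushed s (p 1)) = \<one>" "\<tau> (\<lambda>s. pushed s (p 0)) = \<one>"
      unfolding p(2,3) pushed_inr by (rule transport_const[OF transport]; use y in \<open>simp add: topspace_Y\<close>)+
    ultimately show ?thesis using transport_closed[OF transport p(1)] transport_closed[OF transport p'] by simp
  qed
  \<comment> \<open>With a tether chosen at each time, every subpath is closed up to a path between points of \<open>Z\<close>.\<close>
  have "\<forall>t\<in>{0..1}. \<exists>y. \<exists>g. tether (p' t) y g"
    using tether_exists path_image_subset_topspace[OF p'] by blast
  then obtain \<eta> where "\<forall>t\<in>{0..1}. \<exists>g. tether (p' t) (\<eta> t) g" unfolding bchoice_iff by blast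
  then obtain \<gamma> where tether: "\<And>t. t \<in> {0..1} \<Longrightarrow> tether (p' t) (\<eta> t) (\<gamma> t)" unfolding bchoice_iff by blast
  define P where "P a b \<longleftrightarrow> (\<exists>q. pathin Z q \<and> q 0 = \<eta> a \<and> q 1 = \<eta> b \<and>
    \<tau> (inr \<circ> q) = inv (\<gamma> a) \<otimes> \<tau> (p' \<circ> linepath a b) \<otimes> \<gamma> b)" for a b
  have sub: "pathin Y (p' \<circ> linepath a b)" if "a \<in> {0..1}" "b \<in> {0..1}" for a b
    by (rule pathin_subpath[OF p' that])
  have \<gamma>: "\<gamma> t \<in> carrier G" if "t \<in> {0..1}" for t
    using tether[OF that] transport_closed[OF transport_V] unfolding tether_def by auto
  have piece_Z: "P a b" if ab: "a \<in> {0..1}" "b \<in> {0..1}" and in_Z: "\<And>t. t \<in> {0..1} \<Longrightarrow> (p' \<circ> linepath a b) t \<in> inr ` topspace Z" for a b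
  proof -
    obtain q where q: "pathin Z q" "\<forall>t\<in>{0..1}. (p' \<circ> linepath a b) t = inr (q t)"
      using pathin_of_inr[OF sub[OF ab] in_Z] by blast
    have e: "p' a = inr (q 0)" "p' b = inr (q 1)"
      using q(2)[rule_format, of 0] q(2)[rule_format, of 1] by (simp_all add: linepath_0' linepath_1')
    have v: "\<tau> (inr \<circ> q) = \<tau> (p' \<circ> linepath a b)"
      by (rule transport_cong[OF transport sub[OF ab]]) (use q(2) in simp)
    obtain qa where qa: "pathin Z qa" "qa 0 = q 0" "qa 1 = \<eta> a" "\<tau> (inr \<circ> qa) = \<gamma> a"
      using tether_inr[of "q 0" "\<eta> a" "\<gamma> a"] tether[OF ab(1)] e(1) path_start_in_topspace[OF q(1)] by auto
    obtain qb where qb: "pathin Z qb" "qb 0 = q 1" "qb 1 = \<eta> b" "\<tau> (inr \<circ> qb) = \<gamma> b"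
      using tether_inr[of "q 1" "\<eta> b" "\<gamma> b"] tether[OF ab(2)] e(2) path_finish_in_topspace[OF q(1)] by auto
    show ?thesis
      using transport_conjugated[OF transport_Z qa(1) q(1) qb(1)] qa qb v unfolding P_def by simp
  qed
  have piece_V: "P a b" if ab: "a \<in> {0..1}" "b \<in> {0..1}" and in_V: "\<And>t. t \<in> {0..1} \<Longrightarrow> (p' \<circ> linepath a b) t \<in> inl ` solid_torus" for a b
  proof -
    obtain r where r: "pathin V r" "\<forall>t\<in>{0..1}. (p' \<circ> linepath a b) t = inl (r t)"
      using pathin_of_inl[OF sub[OF ab] in_V] by blast
    have e: "p' a = inl (r 0)" "p' b = inl (r 1)"
      using r(2)[rule_format, of 0] r(2)[rule_format, of 1] by (simp_all add: linepath_0' linepath_1')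
    have v: "\<tau> (inl \<circ> r) = \<tau> (p' \<circ> linepath a b)"
      by (rule transport_cong[OF transport sub[OF ab]]) (use r(2) in simp)
    obtain ra where ra: "pathin V ra" "ra 0 = r 0" "ra 1 \<in> torus" "\<eta> a = \<psi> (ra 1)" "\<tau> (inl \<circ> ra) = \<gamma> a"
      using tether_inl[of "r 0" "\<eta> a" "\<gamma> a"] tether[OF ab(1)] e(1) path_start_in_topspace[OF r(1)] by auto
    obtain rb where rb: "pathin V rb" "rb 0 = r 1" "rb 1 \<in> torus" "\<eta> b = \<psi> (rb 1)" "\<tau> (inl \<circ> rb) = \<gamma> b"
      using tether_inl[of "r 1" "\<eta> b" "\<gamma> b"] tether[OF ab(2)] e(2) path_finish_in_topspace[OF r(1)] by auto
    obtain d where d: "pathin V d" "d 0 = ra 1" "d 1 = rb 1"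
      "\<tau> (inl \<circ> d) = inv (\<tau> (inl \<circ> ra)) \<otimes> \<tau> (inl \<circ> r) \<otimes> \<tau> (inl \<circ> rb)"
      using transport_conjugated[OF transport_V ra(1) r(1) rb(1)] ra(2) rb(2) by auto
    show ?thesis
      using solid_path_to_Z[OF d(1)] d ra rb v unfolding P_def by simp
  qed
  have "P 0 1"
  proof (rule path_subdivision[OF p(1)])
    fix w assume "w \<in> p ` {0..1}"
    then have w: "w \<in> topspace Y" using pY by blast
    \<comment> \<open>Pushing keeps points off \<open>Z\<close> in the solid torus and moves points off the inner half of the
      solid torus into \<open>Z\<close>; both conditions are open.\<close>
    let ?core = "{v \<in> solid_torus. norm (snd v) \<le> 1/2}"
    define O1 where "O1 = topspace Y - inr ` topspace Z"
    define O2 where "O2 = topspace Y - inl ` ?core"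
    have open1: "openin Y O1" unfolding O1_def using closedin_inr[of "topspace Z"] by auto
    have "closedin V ?core"
    proof -
      have "?core = solid_torus \<inter> (UNIV \<times> cball 0 (1/2))" by auto
      moreover have "closed ((UNIV :: complex set) \<times> cball (0::complex) (1/2))" by (intro closed_Times) auto
      ultimately show ?thesis by (metis closedin_closed_Int)
    qed
    then have open2: "openin Y O2" unfolding O2_def using closedin_inl by auto
    have sub_in: "p (linepath a b t) \<in> N" if "a \<le> b" "p ` {a..b} \<subseteq> N" "t \<in> {0..1}" for a b t :: real and N
      using subpath_in_iff[OF that(1), of p N] that(2,3) by simp
    have in1: "pushed 1 v \<in> inl ` solid_torus" if v: "v \<in> O1" for v
    proof -
      obtain x where "x \<in> solid_torus" "v = inl x" using v unfolding O1_def topspace_Y by auto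
      then show ?thesis using push_solid[of 1 x] by (simp add: pushed_inl)
    qed
    have in2: "pushed 1 v \<in> inr ` topspace Z" if v: "v \<in> O2" for v
    proof -
      consider y where "y \<in> topspace Z" "v = inr y" | x where "x \<in> solid_torus" "v = inl x"
        using v unfolding O2_def topspace_Y by auto
      then show ?thesis
      proof cases
        case 1 then show ?thesis by (simp add: pushed_inr)
      next
        case (2 x)
        then have "norm (snd x) > 1/2" using v unfolding O2_def by auto
        then have t: "push 1 x \<in> torus" using push_1_torus[OF 2(1)] by simp
        have "pushed 1 v = inl (push 1 x)" unfolding 2(2) by (rule pushed_inl[OF 2(1)])
        also have "\<dots> = inr (\<psi> (push 1 x))" by (rule inl_seam[OF t])
        finally show ?thesis using subsetD[OF fS_subset imageI[OF t]] by (rule image_eqI)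
      qed
    qed
    show "\<exists>N. openin Y N \<and> w \<in> N \<and> (\<forall>a b. a \<in> {0..1} \<longrightarrow> b \<in> {0..1} \<longrightarrow> a \<le> b \<longrightarrow> p ` {a..b} \<subseteq> N \<longrightarrow> P a b)"
    proof (cases "w \<in> O1")
      case True
      show ?thesis
      proof (intro exI[of _ O1] conjI allI impI open1 True piece_V)
        show "(p' \<circ> linepath a b) t \<in> inl ` solid_torus" if "a \<le> b" "p ` {a..b} \<subseteq> O1" "t \<in> {0..1}" for a b t
          using in1[OF sub_in[OF that]] by (simp add: p'_def)
      qed
    next
      case False
      have wO: "w \<in> O2"
      proof -
        obtain y where y: "y \<in> topspace Z" "w = inr y" using False w unfolding O1_def by auto
        have "w \<notin> inl ` ?core"
        proof
          assume "w \<in> inl ` ?core"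
          then obtain x where x: "x \<in> ?core" "inr y = inl x" using y(2) by auto
          then have "x \<in> torus" by (simp add: inr_eq_inl)
          then show False using x(1) by auto
        qed
        then show ?thesis using w by (simp add: O2_def)
      qed
      show ?thesis
      proof (intro exI[of _ O2] conjI allI impI open2 wO piece_Z)
        show "(p' \<circ> linepath a b) t \<in> inr ` topspace Z" if "a \<le> b" "p ` {a..b} \<subseteq> O2" "t \<in> {0..1}" for a b t
          using in2[OF sub_in[OF that]] by (simp add: p'_def)
      qed
    qed
  next
    fix a b c :: real assume abc: "0 \<le> a" "a \<le> b" "b \<le> c" "c \<le> 1" and P: "P a b" "P b c"
    then have i: "a \<in> {0..1}" "b \<in> {0..1}" "c \<in> {0..1}" by auto
    obtain q where q: "pathin Z q" "q 0 = \<eta> a" "q 1 = \<eta> b" "\<tau> (inr \<circ> q) = inv (\<gamma> a) \<otimes> \<tau> (p' \<circ> linepath a b) \<otimes> \<gamma> b"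
      using P(1) unfolding P_def by (elim exE conjE)
    obtain q' where q': "pathin Z q'" "q' 0 = \<eta> b" "q' 1 = \<eta> c" "\<tau> (inr \<circ> q') = inv (\<gamma> b) \<otimes> \<tau> (p' \<circ> linepath b c) \<otimes> \<gamma> c"
      using P(2) unfolding P_def by (elim exE conjE)
    have j: "q 1 = q' 0" using q q' by simp
    have "\<tau> (inr \<circ> loop_concat q q') = \<tau> (inr \<circ> q) \<otimes> \<tau> (inr \<circ> q')"
      by (rule transport_concat[OF transport_Z q(1) q'(1) j])
    also have "\<dots> = inv (\<gamma> a) \<otimes> \<tau> (p' \<circ> linepath a c) \<otimes> \<gamma> c"
      unfolding q(4) q'(4) transport_subpath[OF transport p' i]
      using \<gamma>[OF i(1)] \<gamma>[OF i(2)] \<gamma>[OF i(3)] transport_closed[OF transport sub[OF i(1,2)]] transport_closed[OF transport sub[OF i(2,3)]]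
      by (simp add: m_assoc)
    finally show "P a c"
      unfolding P_def using pathin_loop_concat[OF q(1) q'(1) j] q(2) q'(3)
      by (intro exI[of _ "loop_concat q q'"]) simp
  qed
  moreover have "p' \<circ> linepath 0 1 = p'" by (auto simp: linepath_def)
  ultimately obtain q where q: "pathin Z q" "q 0 = \<eta> 0" "q 1 = \<eta> 1" "\<tau> (inr \<circ> q) = inv (\<gamma> 0) \<otimes> \<tau> p' \<otimes> \<gamma> 1"
    unfolding P_def by (simp only:) (elim exE conjE)
  obtain qa where qa: "pathin Z qa" "qa 0 = y0" "qa 1 = \<eta> 0" "\<tau> (inr \<circ> qa) = \<gamma> 0"
    using tether_inr[of y0 "\<eta> 0" "\<gamma> 0"] tether[of 0] ends(1) y(1) by auto
  obtain qb where qb: "pathin Z qb" "qb 0 = y1" "qb 1 = \<eta> 1" "\<tau> (inr \<circ> qb) = \<gamma> 1"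
    using tether_inr[of y1 "\<eta> 1" "\<gamma> 1"] tether[of 1] ends(2) y(2) by auto
  have rev: "pathin Z (reverse_path qa)" "pathin Z (reverse_path qb)" using qa(1) qb(1) by (auto intro: pathin_reverse)
  have "\<exists>d. pathin Z d \<and> d 0 = y0 \<and> d 1 = y1 \<and>
    \<tau> (inr \<circ> d) = inv (\<tau> (inr \<circ> reverse_path qa)) \<otimes> \<tau> (inr \<circ> q) \<otimes> \<tau> (inr \<circ> reverse_path qb)"
    using transport_conjugated[OF transport_Z rev(1) q(1) rev(2)] qa qb q by simp
  moreover have "\<tau> (inr \<circ> reverse_path qa) = inv (\<gamma> 0)" "\<tau> (inr \<circ> reverse_path qb) = inv (\<gamma> 1)"
    using transport_reverse[OF transport_Z qa(1)] transport_reverse[OF transport_Z qb(1)] qa qb by simp_all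
  ultimately show ?thesis
    unfolding q(4) eq using \<gamma>[of 0] \<gamma>[of 1] transport_closed[OF transport p'] by (simp add: m_assoc)
qed

end

section \<open>Filling along the longitude of the other side\<close>

interpretation SU2: group SU2
  by (rule group_SU2)

lemma SU2_abelian_transport:
  assumes Y: "SU2_abelian Y" and \<tau>: "path_transport SU2 Y \<tau>" and p: "p \<in> loops Y x" and q: "q \<in> loops Y x"
  shows "\<tau> p \<otimes>\<^bsub>SU2\<^esub> \<tau> q = \<tau> q \<otimes>\<^bsub>SU2\<^esub> \<tau> p"
proof -
  have x: "x \<in> topspace Y" using p path_start_in_topspace unfolding loops_def by fastforce
  let ?\<rho> = "\<lambda>a. \<tau> (SOME p. p \<in> a)" and ?c = "\<lambda>p. loop_homotopy Y x `` {p}"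
  have c: "?c r \<in> carrier (fundamental_group Y x)" if "r \<in> loops Y x" for r
    using that by (simp add: fundamental_group_def quotientI)
  have "?\<rho> (?c p) \<otimes>\<^bsub>SU2\<^esub> ?\<rho> (?c q) = ?\<rho> (?c q) \<otimes>\<^bsub>SU2\<^esub> ?\<rho> (?c p)"
    using Y[unfolded SU2_abelian_def, rule_format, OF x SU2.hom_of_transport(1)[OF \<tau>] c[OF p] c[OF q]] .
  then show ?thesis
    unfolding SU2.hom_of_transport(2)[OF \<tau> p] SU2.hom_of_transport(2)[OF \<tau> q] .
qed

text \<open>Composition with the inverse homeomorphism would contract the circle.\<close>

lemma circle_map_not_nullhomotopic:
  assumes k: "continuous_on circle k" "k ` circle = circle" "inj_on k circle"
  shows "\<not> homotopic_with (\<lambda>_. True) (top_of_set circle) (top_of_set circle) k (\<lambda>_. a)"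
proof
  assume h: "homotopic_with (\<lambda>_. True) (top_of_set circle) (top_of_set circle) k (\<lambda>_. a)"
  obtain k' where k': "homeomorphism circle circle k k'"
    using homeomorphism_compact[OF compact_sphere k] by blast
  then have "continuous_map (top_of_set circle) (top_of_set circle) k'"
    by (intro continuous_map_I) (auto simp: homeomorphism_def)
  then have "homotopic_with (\<lambda>_. True) (top_of_set circle) (top_of_set circle) (k \<circ> k') ((\<lambda>_. a) \<circ> k')"
    by (rule homotopic_with_compose_continuous_map_right[OF h]) simp
  then have "homotopic_with (\<lambda>_. True) (top_of_set circle) (top_of_set circle) id (\<lambda>_. a)"
    by (rule homotopic_with_eq) (use k' in \<open>auto simp: homeomorphism_def\<close>)
  then have "contractible (sphere (0::complex) 1)" unfolding contractible_def by blast
  then show False by (simp add: contractible_sphere)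
qed

text \<open>A torus with coordinates, in which curves \<open>S\<^sup>1 \<times> {b}\<close> are compared with \<open>{1} \<times> S\<^sup>1\<close>. They are told
  apart by the first coordinate: it restricts to a homeomorphism onto the circle on the former and is
  constant on the latter.\<close>

locale torus_curves =
  fixes T :: "'z topology" and \<Psi> :: "complex \<times> complex \<Rightarrow> 'z" and \<Psi>' :: "'z \<Rightarrow> complex \<times> complex"
  assumes maps: "homeomorphic_maps (top_of_set torus) T \<Psi> \<Psi>'"
begin

lemma continuous_\<Psi>: "continuous_map (top_of_set torus) T \<Psi>"
  and continuous_\<Psi>': "continuous_map T (top_of_set torus) \<Psi>'"
  and \<Psi>'_\<Psi>: "v \<in> torus \<Longrightarrow> \<Psi>' (\<Psi> v) = v"
  using maps unfolding homeomorphic_maps_def by auto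

lemma continuous_coordinate: "continuous_map T (top_of_set circle) (\<lambda>y. fst (\<Psi>' y))"
proof -
  have "continuous_map (top_of_set torus) (top_of_set circle) fst"
    by (rule continuous_map_I) (auto intro!: continuous_intros)
  from continuous_map_compose[OF continuous_\<Psi>' this] show ?thesis by (simp add: o_def)
qed

lemma parallel_param:
  assumes "b \<in> circle"
  shows "simple_closed_param T (\<lambda>z. \<Psi> (z, b))"
  unfolding simple_closed_param_def
proof
  have "continuous_map (top_of_set circle) (top_of_set torus) (\<lambda>z. (z, b))"
    by (rule continuous_map_I) (use assms in \<open>auto intro!: continuous_intros\<close>)
  from continuous_map_compose[OF this continuous_\<Psi>]
  show "continuous_map (top_of_set circle) T (\<lambda>z. \<Psi> (z, b))" by (simp add: o_def)
  show "inj_on (\<lambda>z. \<Psi> (z, b)) circle"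
  proof (rule inj_onI)
    fix z w assume zw: "z \<in> circle" "w \<in> circle" "\<Psi> (z, b) = \<Psi> (w, b)"
    then have "(z, b) = (w, b)" using \<Psi>'_\<Psi>[of "(z, b)"] \<Psi>'_\<Psi>[of "(w, b)"] assms by (metis mem_Sigma_iff)
    then show "z = w" by simp
  qed
qed

lemma parallel_is_slope:
  assumes b: "b \<in> circle" shows "is_slope T ((\<lambda>z. \<Psi> (z, b)) ` circle)"
  unfolding is_slope_def
proof (intro exI[of _ "\<lambda>z. \<Psi> (z, b)"] conjI refl parallel_param b notI)
  assume "\<exists>a. homotopic_with (\<lambda>_. True) (top_of_set circle) T (\<lambda>z. \<Psi> (z, b)) (\<lambda>_. a)"
  then obtain a where "homotopic_with (\<lambda>_. True) (top_of_set circle) T (\<lambda>z. \<Psi> (z, b)) (\<lambda>_. a)" by blast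
  from homotopic_with_compose_continuous_map_left[OF this continuous_coordinate, of "\<lambda>_. True"]
  have "homotopic_with (\<lambda>_. True) (top_of_set circle) (top_of_set circle)
    ((\<lambda>y. fst (\<Psi>' y)) \<circ> (\<lambda>z. \<Psi> (z, b))) ((\<lambda>y. fst (\<Psi>' y)) \<circ> (\<lambda>_. a))" by simp
  then have "homotopic_with (\<lambda>_. True) (top_of_set circle) (top_of_set circle) id (\<lambda>_. fst (\<Psi>' a))"
    by (rule homotopic_with_eq) (use \<Psi>'_\<Psi> b in auto)
  then show False using circle_map_not_nullhomotopic[of id] by (simp add: continuous_on_id)
qed

lemma parallel_not_isotopic:
  assumes b: "b \<in> circle"
  shows "\<not> isotopic_curves T (\<Psi> ` ({1} \<times> circle)) ((\<lambda>z. \<Psi> (z, b)) ` circle)"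
proof
  assume "isotopic_curves T (\<Psi> ` ({1} \<times> circle)) ((\<lambda>z. \<Psi> (z, b)) ` circle)"
  then obtain \<gamma> \<gamma>' where \<gamma>: "\<Psi> ` ({1} \<times> circle) = \<gamma> ` circle" "(\<lambda>z. \<Psi> (z, b)) ` circle = \<gamma>' ` circle"
    and h: "homotopic_with (\<lambda>h. inj_on h circle) (top_of_set circle) T \<gamma> \<gamma>'"
    unfolding isotopic_curves_def by blast
  let ?c = "\<lambda>y. fst (\<Psi>' y)"
  from homotopic_with_compose_continuous_map_left[OF h continuous_coordinate, of "\<lambda>_. True"]
  have h': "homotopic_with (\<lambda>_. True) (top_of_set circle) (top_of_set circle) (?c \<circ> \<gamma>) (?c \<circ> \<gamma>')" by simp
  have one: "?c (\<gamma> z) = 1" if "z \<in> circle" for z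
  proof -
    have "\<gamma> z \<in> \<Psi> ` ({1} \<times> circle)" using \<gamma>(1) that by blast
    then obtain v where v: "v \<in> {1} \<times> circle" "\<gamma> z = \<Psi> v" by (rule imageE)
    then have "v \<in> torus" "fst v = 1" by auto
    then show ?thesis using v(2) \<Psi>'_\<Psi> by simp
  qed
  have "homotopic_with (\<lambda>_. True) (top_of_set circle) (top_of_set circle) (?c \<circ> \<gamma>') (\<lambda>_. 1)"
    by (rule homotopic_with_eq[OF homotopic_with_symD[OF h']]) (use one in auto)
  moreover have "continuous_on circle (?c \<circ> \<gamma>')"
    using homotopic_with_imp_continuous_maps[OF h'] by (simp add: continuous_map_in_subtopology)
  moreover have im: "(?c \<circ> \<gamma>') ` circle = circle"
  proof -
    have "(?c \<circ> \<gamma>') ` circle = ?c ` ((\<lambda>z. \<Psi> (z, b)) ` circle)" by (simp only: image_comp \<gamma>(2))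
    also have "\<dots> = (\<lambda>z. z) ` circle" unfolding image_image
      by (rule image_cong) (use \<Psi>'_\<Psi> b in auto)
    finally show ?thesis by simp
  qed
  moreover have "inj_on (?c \<circ> \<gamma>') circle"
  proof (rule inj_onI)
    fix z w assume zw: "z \<in> circle" "w \<in> circle" "(?c \<circ> \<gamma>') z = (?c \<circ> \<gamma>') w"
    have "\<gamma>' z \<in> (\<lambda>z. \<Psi> (z, b)) ` circle" "\<gamma>' w \<in> (\<lambda>z. \<Psi> (z, b)) ` circle" using \<gamma>(2) zw by blast+
    then obtain z' w' where z': "z' \<in> circle" "\<gamma>' z = \<Psi> (z', b)" and w': "w' \<in> circle" "\<gamma>' w = \<Psi> (w', b)" by blast
    have "z' = w'" using zw(3) z' w' \<Psi>'_\<Psi>[of "(z', b)"] \<Psi>'_\<Psi>[of "(w', b)"] b by simp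
    then have "\<gamma>' z = \<gamma>' w" using z' w' by simp
    moreover have "inj_on \<gamma>' circle" using homotopic_with_imp_property[OF h] by simp
    ultimately show "z = w" using zw by (simp add: inj_on_eq_iff)
  qed
  ultimately show False using circle_map_not_nullhomotopic by blast
qed

text \<open>Any parametrization of \<open>{1} \<times> S\<^sup>1\<close> differs from the standard one by a homeomorphism of the circle.
  It extends to the torus, so a curve whose class is known to be torsion can be taken to be the
  standard meridian; this replaces a computation with degrees.\<close>

lemma reparametrize_meridian:
  assumes \<gamma>: "simple_closed_param T \<gamma>" "\<gamma> ` circle = \<Psi> ` ({1} \<times> circle)"
  shows "\<exists>g g'. homeomorphism circle circle g g' \<and> (\<forall>z\<in>circle. \<gamma> z = \<Psi> (1, g z))"
proof -
  define g where "g z = snd (\<Psi>' (\<gamma> z))" for z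
  have \<gamma>v: "\<exists>b\<in>circle. \<gamma> z = \<Psi> (1, b)" if "z \<in> circle" for z
    using \<gamma>(2) that by blast
  have g: "g z \<in> circle \<and> \<gamma> z = \<Psi> (1, g z)" if z: "z \<in> circle" for z
  proof -
    obtain b where b: "b \<in> circle" "\<gamma> z = \<Psi> (1, b)" using \<gamma>v[OF z] by blast
    then have "g z = b" using \<Psi>'_\<Psi>[of "(1, b)"] by (simp add: g_def)
    then show ?thesis using b by simp
  qed
  have "continuous_map (top_of_set circle) (top_of_set torus) (\<Psi>' \<circ> \<gamma>)"
    using \<gamma>(1) unfolding simple_closed_param_def by (intro continuous_map_compose[OF _ continuous_\<Psi>']) simp
  then have "continuous_on circle (\<Psi>' \<circ> \<gamma>)" by (simp add: continuous_map_in_subtopology)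
  then have "continuous_on circle g" using continuous_on_snd by (fastforce simp: g_def[abs_def] o_def)
  moreover have "inj_on g circle"
  proof (rule inj_onI)
    fix z w assume zw: "z \<in> circle" "w \<in> circle" "g z = g w"
    then have "\<gamma> z = \<gamma> w" using g[OF zw(1)] g[OF zw(2)] by simp
    then show "z = w" using \<gamma>(1) zw(1,2) unfolding simple_closed_param_def inj_on_def by blast
  qed
  moreover have "g ` circle = circle"
  proof (intro equalityI subsetI)
    fix b assume b: "b \<in> circle"
    then have "\<Psi> (1, b) \<in> \<gamma> ` circle" unfolding \<gamma>(2) by simp
    then obtain z where z: "z \<in> circle" "\<Psi> (1, b) = \<gamma> z" by (rule imageE)
    have "g z = b" using z(2)[symmetric] \<Psi>'_\<Psi>[of "(1, b)"] b by (simp add: g_def)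
    then show "b \<in> g ` circle" using z(1) by blast
  qed (use g in blast)
  ultimately obtain g' where "homeomorphism circle circle g g'"
    using homeomorphism_compact[OF compact_sphere] by blast
  then show ?thesis using g by blast
qed

end

lemma path_transport_of_real:
  assumes h: "\<And>p q. pathin Z p \<Longrightarrow> pathin Z q \<Longrightarrow> p 1 = q 0 \<Longrightarrow> h (loop_concat p q) = h p + h q"
    "\<And>p q. path_homotopic Z p q \<Longrightarrow> h p = (h q :: real)"
    and E: "\<And>t. E t \<in> carrier G" "\<And>s t. E (s + t) = E s \<otimes>\<^bsub>G\<^esub> E t"
  shows "path_transport G Z (\<lambda>p. E (h p))"
  unfolding path_transport_def using h E by metis

text \<open>The argument for one side \<open>X\<close>, with \<open>S\<close> its boundary torus and \<open>Z\<close> the other side. What is used of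
  the glued manifold is summarized by the hypothesis \<open>commute\<close>, which can be stated for either of its
  two sides.\<close>

lemma filling_SU2_abelian:
  fixes X :: "'a topology" and Z :: "'b topology"
  assumes closed: "closedin X S"
    and \<psi>: "homeomorphic_map (top_of_set torus) (subtopology X S) \<psi>"
    and f: "homeomorphic_map (subtopology X S) (subtopology Z S') f"
    and S': "S' \<subseteq> topspace Z"
    and torsion: "torsion_curve Z (subtopology Z S') (f ` \<psi> ` ({1} \<times> circle))"
    and unique: "\<And>C'. is_slope (subtopology Z S') C' \<Longrightarrow> torsion_curve Z (subtopology Z S') C' \<Longrightarrow>
       isotopic_curves (subtopology Z S') (f ` \<psi> ` ({1} \<times> circle)) C'"
    and commute: "\<And>\<tau>1 \<tau>2 x p q. path_transport SU2 X \<tau>1 \<Longrightarrow> path_transport SU2 Z \<tau>2 \<Longrightarrow>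
       (\<And>p. pathin (subtopology X S) p \<Longrightarrow> \<tau>1 p = \<tau>2 (f \<circ> p)) \<Longrightarrow>
       p \<in> loops X x \<Longrightarrow> q \<in> loops X x \<Longrightarrow> \<tau>1 p \<otimes>\<^bsub>SU2\<^esub> \<tau>1 q = \<tau>1 q \<otimes>\<^bsub>SU2\<^esub> \<tau>1 p"
  shows "SU2_abelian (glue (top_of_set solid_torus) torus \<psi> X)"
proof -
  let ?M = "glue (top_of_set solid_torus) torus \<psi> X" and ?T = "subtopology Z S'"
  have SX: "S \<subseteq> topspace X" using closed by (rule closedin_subset)
  have \<psi>S: "\<psi> ` torus = S" using homeomorphic_imp_surjective_map[OF \<psi>] SX by (simp add: inf.absorb2)
  have sub: "subtopology (top_of_set solid_torus) torus = top_of_set torus"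
    using torus_subset_solid by (simp add: subtopology_subtopology inf.absorb2)
  have glu: "gluing (top_of_set solid_torus) torus \<psi> X"
  proof
    show "closedin (top_of_set solid_torus) torus"
      using torus_subset_solid by (intro closed_subset closed_Times) auto
    show "closedin X (\<psi> ` torus)" unfolding \<psi>S by (rule closed)
    show "homeomorphic_map (subtopology (top_of_set solid_torus) torus) (subtopology X (\<psi> ` torus)) \<psi>"
      unfolding sub \<psi>S by (rule \<psi>)
  qed
  obtain \<Psi>' where \<Psi>': "homeomorphic_maps (top_of_set torus) ?T (f \<circ> \<psi>) \<Psi>'"
    using homeomorphic_map_compose[OF \<psi> f] unfolding homeomorphic_map_maps by blast
  interpret C: torus_curves ?T "f \<circ> \<psi>" \<Psi>' by unfold_locales (rule \<Psi>')
  have im: "f ` \<psi> ` ({1} \<times> circle) = (f \<circ> \<psi>) ` ({1} \<times> circle)" by (simp only: image_comp)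
  obtain \<gamma> n where \<gamma>: "simple_closed_param ?T \<gamma>" "(f \<circ> \<psi>) ` ({1} \<times> circle) = \<gamma> ` circle"
    and n: "n > 0" "curve_class Z \<gamma> [^]\<^bsub>homology_group 1 Z\<^esub> (n::nat) = \<one>\<^bsub>homology_group 1 Z\<^esub>"
    using torsion unfolding torsion_curve_def im by blast
  \<comment> \<open>Parametrize the seam so that the torsion curve itself is the standard meridian.\<close>
  obtain g g' where g: "homeomorphism circle circle g g'" "\<forall>z\<in>circle. \<gamma> z = (f \<circ> \<psi>) (1, g z)"
    using C.reparametrize_meridian[OF \<gamma>(1) \<gamma>(2)[symmetric]] by blast
  have gc: "continuous_on circle g" "continuous_on circle g'" "\<And>z. z \<in> circle \<Longrightarrow> g z \<in> circle"
    "\<And>z. z \<in> circle \<Longrightarrow> g' z \<in> circle" "\<And>z. z \<in> circle \<Longrightarrow> g (g' z) = z"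
    using g(1) unfolding homeomorphism_def by blast+
  have one: "1 \<in> circle" by simp
  define \<mu> where "\<mu> z = (f \<circ> \<psi>) (z, g 1)" for z
  have \<mu>: "continuous_map (top_of_set circle) Z \<mu>"
    using C.parallel_param[OF gc(3)[OF one]] unfolding simple_closed_param_def \<mu>_def[abs_def]
    by (simp add: continuous_map_in_subtopology)
  have \<gamma>c: "continuous_map (top_of_set circle) Z \<gamma>"
    using \<gamma>(1) by (simp add: simple_closed_param_def continuous_map_in_subtopology)
  have "curve_class Z \<mu> [^]\<^bsub>homology_group 1 Z\<^esub> m \<noteq> \<one>\<^bsub>homology_group 1 Z\<^esub>" if m: "m > 0" for m :: nat
  proof
    assume "curve_class Z \<mu> [^]\<^bsub>homology_group 1 Z\<^esub> m = \<one>\<^bsub>homology_group 1 Z\<^esub>"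
    then have "torsion_curve Z ?T (\<mu> ` circle)"
      unfolding torsion_curve_def using C.parallel_param[OF gc(3)[OF one]] m \<mu>_def[abs_def] by blast
    then have "isotopic_curves ?T ((f \<circ> \<psi>) ` ({1} \<times> circle)) (\<mu> ` circle)"
      unfolding im[symmetric] using C.parallel_is_slope[OF gc(3)[OF one]] unfolding \<mu>_def[abs_def] by (intro unique)
    then show False using C.parallel_not_isotopic[OF gc(3)[OF one]] unfolding \<mu>_def[abs_def] by blast
  qed
  from real_transport_of_homology[OF \<mu> this] obtain h :: "(real \<Rightarrow> 'b) \<Rightarrow> real" where
    h: "\<And>p q. pathin Z p \<Longrightarrow> pathin Z q \<Longrightarrow> p 1 = q 0 \<Longrightarrow> h (loop_concat p q) = h p + h q"
      "\<And>p q. path_homotopic Z p q \<Longrightarrow> h p = h q" "h (\<lambda>t. \<mu> (cis (2 * pi * t))) = 1"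
    and h_tor: "\<And>\<gamma> n. n > (0::nat) \<Longrightarrow> continuous_map (top_of_set circle) Z \<gamma> \<Longrightarrow>
       curve_class Z \<gamma> [^]\<^bsub>homology_group 1 Z\<^esub> n = \<one>\<^bsub>homology_group 1 Z\<^esub> \<Longrightarrow> h (\<lambda>t. \<gamma> (cis (2 * pi * t))) = 0"
    by blast
  have h0: "h (\<lambda>t. \<gamma> (cis (2 * pi * t))) = 0" by (rule h_tor[OF n(1) \<gamma>c n(2)])
  define \<psi>g where "\<psi>g v = \<psi> (fst v, g (snd v))" for v
  define inv\<psi>g where "inv\<psi>g y = (fst (\<Psi>' y), g' (snd (\<Psi>' y)))" for y
  have \<psi>c: "continuous_map (top_of_set torus) X \<psi>"
    using homeomorphic_imp_continuous_map[OF \<psi>] by (simp add: continuous_map_in_subtopology)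
  have fc: "continuous_map (subtopology X S) Z f"
    using homeomorphic_imp_continuous_map[OF f] by (simp add: continuous_map_in_subtopology)
  have gt: "continuous_map (top_of_set torus) (top_of_set torus) (\<lambda>v. (fst v, g (snd v)))"
    by (rule continuous_map_I)
      (auto intro!: continuous_intros continuous_on_compose2[OF gc(1)] gc(3))
  have g't: "continuous_map (top_of_set torus) (top_of_set torus) (\<lambda>v. (fst v, g' (snd v)))"
    by (rule continuous_map_I)
      (auto intro!: continuous_intros continuous_on_compose2[OF gc(2)] gc(4))
  have \<psi>gS: "continuous_map (top_of_set torus) (subtopology X S) \<psi>g"
    using continuous_map_compose[OF gt homeomorphic_imp_continuous_map[OF \<psi>]] by (simp add: \<psi>g_def[abs_def] o_def)
  then have \<psi>gc: "continuous_map (top_of_set torus) X \<psi>g" by (simp add: continuous_map_in_subtopology)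
  have f\<psi>gc: "continuous_map (top_of_set torus) Z (f \<circ> \<psi>g)" by (rule continuous_map_compose[OF \<psi>gS fc])
  have inv\<psi>gc: "continuous_map ?T (top_of_set torus) inv\<psi>g"
    using continuous_map_compose[OF C.continuous_\<Psi>' g't] by (simp add: inv\<psi>g_def[abs_def] o_def)
  have fS: "f x \<in> topspace ?T" if "x \<in> S" for x
    using homeomorphic_imp_surjective_map[OF f] that SX by auto
  have \<psi>g_inv: "\<psi>g (inv\<psi>g (f x)) = x" if x: "x \<in> S" for x
  proof -
    obtain v where v: "v \<in> torus" "x = \<psi> v" using x \<psi>S by blast
    have "\<Psi>' (f x) = v" using C.\<Psi>'_\<Psi>[OF v(1)] v(2) by simp
    moreover have "snd v \<in> circle" using v(1) by auto
    ultimately show ?thesis using v(2) gc(5) by (simp add: \<psi>g_def inv\<psi>g_def)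
  qed
  show ?thesis
    unfolding SU2_abelian_def
  proof (intro ballI)
    fix x0 \<rho> a b
    assume x0: "x0 \<in> topspace ?M" and \<rho>: "\<rho> \<in> hom (fundamental_group ?M x0) SU2"
      and ab: "a \<in> carrier (fundamental_group ?M x0)" "b \<in> carrier (fundamental_group ?M x0)"
    obtain \<tau> g0 where \<tau>: "path_transport SU2 ?M \<tau>" and g0: "g0 \<in> carrier SU2"
      and \<tau>\<rho>: "\<And>p. p \<in> loops ?M x0 \<Longrightarrow> \<tau> p = g0 \<otimes>\<^bsub>SU2\<^esub> \<rho> (loop_homotopy ?M x0 `` {p}) \<otimes>\<^bsub>SU2\<^esub> inv\<^bsub>SU2\<^esub> g0"
      using SU2.transport_of_hom[OF \<rho> x0] by blast
    interpret F: solid_torus_filling SU2 \<psi> X \<tau>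
      by (intro solid_torus_filling.intro group_SU2 glu solid_torus_filling_axioms.intro \<tau>)
    define \<tau>X where "\<tau>X q = \<tau> (F.inr \<circ> q)" for q
    have \<tau>X: "path_transport SU2 X \<tau>X" unfolding \<tau>X_def[abs_def] by (rule F.transport_Z)
    define lon0 where "lon0 = (\<lambda>t::real. (cis (2 * pi * t), 1 :: complex))"
    define mer0 where "mer0 = (\<lambda>t::real. (1 :: complex, cis (2 * pi * t)))"
    have lon0: "pathin (top_of_set torus) lon0"
      unfolding lon0_def pathin_top_of_set by (auto intro!: continuous_intros)
    have "\<tau>X (\<psi>g \<circ> lon0) \<in> carrier SU2"
      by (rule transport_closed[OF \<tau>X pathin_compose[OF lon0 \<psi>gc]])
    from SU2_one_parameter[OF this] obtain E :: "real \<Rightarrow> complex ^ 2 ^ 2"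
      where E: "\<And>t. E t \<in> carrier SU2" "\<And>s t. E (s + t) = E s \<otimes>\<^bsub>SU2\<^esub> E t" "E 1 = \<tau>X (\<psi>g \<circ> lon0)" by blast
    have E0: "E 0 = \<one>\<^bsub>SU2\<^esub>" using E(2)[of 0 0] E(1)[of 0] by (metis SU2.l_cancel_one' add_0)
    \<comment> \<open>An abelian transport on \<open>Z\<close> with the values of \<open>\<tau>X\<close> on both generators of the torus group.\<close>
    define \<sigma> where "\<sigma> q = E (h q)" for q
    have \<sigma>: "path_transport SU2 Z \<sigma>" unfolding \<sigma>_def[abs_def] by (rule path_transport_of_real[OF h(1,2) E(1,2)])
    have agree_lon: "\<tau>X (\<psi>g \<circ> lon0) = \<sigma> ((f \<circ> \<psi>g) \<circ> lon0)"
    proof -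
      have "(f \<circ> \<psi>g) \<circ> lon0 = (\<lambda>t. \<mu> (cis (2 * pi * t)))" by (simp add: \<mu>_def lon0_def \<psi>g_def fun_eq_iff)
      then show ?thesis using h(3) E(3) by (simp only: \<sigma>_def)
    qed
    have agree_mer: "\<tau>X (\<psi>g \<circ> mer0) = \<sigma> ((f \<circ> \<psi>g) \<circ> mer0)"
    proof -
      have "(f \<circ> \<psi>g) \<circ> mer0 = (\<lambda>t. \<gamma> (cis (2 * pi * t)))"
        using g(2) by (simp add: mer0_def \<psi>g_def fun_eq_iff)
      then have "\<sigma> ((f \<circ> \<psi>g) \<circ> mer0) = \<one>\<^bsub>SU2\<^esub>" using h0 E0 by (simp only: \<sigma>_def)
      moreover have "\<tau>X (\<psi>g \<circ> mer0) = \<tau> (F.inr \<circ> (\<lambda>t. \<psi> (1, g (cis (2 * pi * t)))))"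
        by (simp add: \<tau>X_def \<psi>g_def mer0_def o_def)
      moreover have "\<dots> = \<one>\<^bsub>SU2\<^esub>"
      proof (rule F.meridian_trivial)
        show "pathin (top_of_set circle) (\<lambda>t. g (cis (2 * pi * t)))"
          unfolding pathin_top_of_set
          by (auto intro!: continuous_on_compose2[OF gc(1)] continuous_intros gc(3) simp del: mem_sphere)
      qed simp
      ultimately show ?thesis by simp
    qed
    have tX: "path_transport SU2 (top_of_set torus) (\<lambda>p. \<tau>X (\<psi>g \<circ> p))" by (rule transport_compose[OF \<tau>X \<psi>gc])
    have tZ: "path_transport SU2 (top_of_set torus) (\<lambda>p. \<sigma> ((f \<circ> \<psi>g) \<circ> p))" by (rule transport_compose[OF \<sigma> f\<psi>gc])
    have base: "(1, 1) \<in> topspace (top_of_set torus)" by simp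
    have "\<exists>u. (\<forall>y\<in>topspace (top_of_set torus). u y \<in> carrier SU2) \<and> (\<forall>p. pathin (top_of_set torus) p \<longrightarrow>
        \<tau>X (\<psi>g \<circ> p) = inv\<^bsub>SU2\<^esub> (u (p 0)) \<otimes>\<^bsub>SU2\<^esub> \<sigma> ((f \<circ> \<psi>g) \<circ> p) \<otimes>\<^bsub>SU2\<^esub> u (p 1))"
    proof (rule SU2.gauge_of_loops[OF path_connected_torus base tX tZ])
      fix p assume "pathin (top_of_set torus) p" "p 0 = (1, 1)" "p 1 = (1, 1)"
      then show "\<tau>X (\<psi>g \<circ> p) = \<sigma> ((f \<circ> \<psi>g) \<circ> p)"
        by (rule SU2.torus_transports_agree[OF tX tZ agree_lon[unfolded lon0_def] agree_mer[unfolded mer0_def]])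
    qed
    then obtain u where u: "\<And>y. y \<in> torus \<Longrightarrow> u y \<in> carrier SU2" "\<And>p. pathin (top_of_set torus) p \<Longrightarrow>
        \<tau>X (\<psi>g \<circ> p) = inv\<^bsub>SU2\<^esub> (u (p 0)) \<otimes>\<^bsub>SU2\<^esub> \<sigma> ((f \<circ> \<psi>g) \<circ> p) \<otimes>\<^bsub>SU2\<^esub> u (p 1)" by auto
    \<comment> \<open>The two transports agree on the seam up to gauge, and the gauge transformation extends by one
      to the rest of \<open>Z\<close>.\<close>
    define U where "U y = (if y \<in> S' then u (inv\<psi>g y) else \<one>\<^bsub>SU2\<^esub>)" for y
    have inv_torus: "inv\<psi>g y \<in> torus" if "y \<in> S'" for y
    proof -
      have "y \<in> topspace ?T" using that S' by auto
      then show ?thesis using inv\<psi>gc unfolding continuous_map_def by auto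
    qed
    have U: "U y \<in> carrier SU2" for y using u(1)[OF inv_torus] by (simp add: U_def)
    define \<sigma>' where "\<sigma>' q = inv\<^bsub>SU2\<^esub> (U (q 0)) \<otimes>\<^bsub>SU2\<^esub> \<sigma> q \<otimes>\<^bsub>SU2\<^esub> U (q 1)" for q
    have \<sigma>': "path_transport SU2 Z \<sigma>'" unfolding \<sigma>'_def[abs_def] by (rule SU2.transport_gauge[OF \<sigma> U])
    have compatible: "\<tau>X q = \<sigma>' (f \<circ> q)" if q: "pathin (subtopology X S) q" for q
    proof -
      have qS: "q t \<in> S" if "t \<in> {0..1}" for t using q that by (simp add: pathin_subtopology)
      define p where "p = inv\<psi>g \<circ> (f \<circ> q)"
      have "pathin ?T (f \<circ> q)" by (rule pathin_compose[OF q homeomorphic_imp_continuous_map[OF f]])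
      then have p: "pathin (top_of_set torus) p" unfolding p_def by (rule pathin_compose[OF _ inv\<psi>gc])
      have qp: "\<psi>g (p t) = q t" if "t \<in> {0..1}" for t using \<psi>g_inv[OF qS[OF that]] by (simp add: p_def)
      have "\<tau>X (\<psi>g \<circ> p) = \<tau>X q"
        by (rule transport_cong[OF \<tau>X]) (use q qp in \<open>auto simp: pathin_subtopology\<close>)
      moreover have "\<sigma> ((f \<circ> \<psi>g) \<circ> p) = \<sigma> (f \<circ> q)"
        by (rule transport_cong[OF \<sigma> pathin_compose[OF q fc]]) (use qp in auto)
      moreover have "f (q 0) \<in> S'" "f (q 1) \<in> S'" using fS[OF qS] by auto
      ultimately show ?thesis using u(2)[OF p] by (simp add: \<sigma>'_def U_def p_def)
    qed
    have commute_X: "\<tau>X p \<otimes>\<^bsub>SU2\<^esub> \<tau>X q = \<tau>X q \<otimes>\<^bsub>SU2\<^esub> \<tau>X p" if "p \<in> loops X y" "q \<in> loops X y" for p q y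
      by (rule commute[OF \<tau>X \<sigma>' compatible that])
    \<comment> \<open>Move the base point into \<open>X\<close>, where loops can be replaced by loops in \<open>X\<close>.\<close>
    obtain y \<delta> where "F.tether x0 y \<delta>" using F.tether_exists[OF x0] by (elim exE)
    note tether = this[unfolded F.tether_def]
    have yX: "y \<in> topspace X" by (rule conjunct1[OF tether])
    from conjunct2[OF tether] have "\<exists>d. pathin ?M d \<and> d 0 = x0 \<and> d 1 = F.inr y"
    proof (elim disjE exE conjE)
      assume "x0 = F.inr y"
      then show ?thesis using x0 by (intro exI[of _ "\<lambda>_. x0"]) simp
    next
      fix r assume r: "pathin F.V r" "x0 = F.inl (r 0)" "r 1 \<in> torus" "y = \<psi> (r 1)"
      then show ?thesis using pathin_compose[OF r(1) F.continuous_inl] F.inl_seam[OF r(3)]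
        by (intro exI[of _ "F.inl \<circ> r"]) simp
    qed
    then obtain d where d: "pathin ?M d" "d 0 = x0" "d 1 = F.inr y" by (elim exE conjE)
    have moved: "\<exists>q\<in>loops X y. \<tau>X q = inv\<^bsub>SU2\<^esub> (\<tau> d) \<otimes>\<^bsub>SU2\<^esub> \<tau> p \<otimes>\<^bsub>SU2\<^esub> \<tau> d" if p: "p \<in> loops ?M x0" for p
    proof -
      have p': "pathin ?M p" "p 0 = x0" "p 1 = x0" using p by (auto simp: loops_def)
      obtain l where l: "pathin ?M l" "l 0 = d 1" "l 1 = d 1" "\<tau> l = inv\<^bsub>SU2\<^esub> (\<tau> d) \<otimes>\<^bsub>SU2\<^esub> \<tau> p \<otimes>\<^bsub>SU2\<^esub> \<tau> d"
        using SU2.transport_conjugated[OF \<tau> d(1) p'(1) d(1)] d p' by auto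
      obtain q where "pathin X q" "q 0 = y" "q 1 = y" "\<tau> (F.inr \<circ> q) = \<tau> l"
        using F.path_to_Z[OF l(1) _ _ yX yX] l d by auto
      then show ?thesis using l(4) by (intro bexI[of _ q]) (simp_all add: \<tau>X_def loops_def)
    qed
    have dc: "\<tau> d \<in> carrier SU2" by (rule transport_closed[OF \<tau> d(1)])
    have pc: "\<tau> p \<in> carrier SU2" if "p \<in> loops ?M x0" for p
      using that by (intro transport_closed[OF \<tau>]) (simp add: loops_def)
    have conj_commute: "P \<otimes>\<^bsub>SU2\<^esub> Q = Q \<otimes>\<^bsub>SU2\<^esub> P"
      if "(inv\<^bsub>SU2\<^esub> D \<otimes>\<^bsub>SU2\<^esub> P \<otimes>\<^bsub>SU2\<^esub> D) \<otimes>\<^bsub>SU2\<^esub> (inv\<^bsub>SU2\<^esub> D \<otimes>\<^bsub>SU2\<^esub> Q \<otimes>\<^bsub>SU2\<^esub> D) = (inv\<^bsub>SU2\<^esub> D \<otimes>\<^bsub>SU2\<^esub> Q \<otimes>\<^bsub>SU2\<^esub> D) \<otimes>\<^bsub>SU2\<^esub> (inv\<^bsub>SU2\<^esub> D \<otimes>\<^bsub>SU2\<^esub> P \<otimes>\<^bsub>SU2\<^esub> D)"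
        and c: "D \<in> carrier SU2" "P \<in> carrier SU2" "Q \<in> carrier SU2" for D P Q
    proof -
      have "inv\<^bsub>SU2\<^esub> D \<otimes>\<^bsub>SU2\<^esub> ((P \<otimes>\<^bsub>SU2\<^esub> Q) \<otimes>\<^bsub>SU2\<^esub> D) = inv\<^bsub>SU2\<^esub> D \<otimes>\<^bsub>SU2\<^esub> ((Q \<otimes>\<^bsub>SU2\<^esub> P) \<otimes>\<^bsub>SU2\<^esub> D)"
        using that(1) c by (simp add: SU2.m_assoc)
      then show ?thesis using c by simp
    qed
    obtain p where p: "p \<in> loops ?M x0" "a = loop_homotopy ?M x0 `` {p}"
      using ab(1) by (auto simp: fundamental_group_def elim: quotientE)
    obtain q where q: "q \<in> loops ?M x0" "b = loop_homotopy ?M x0 `` {q}"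
      using ab(2) by (auto simp: fundamental_group_def elim: quotientE)
    have "\<tau> p \<otimes>\<^bsub>SU2\<^esub> \<tau> q = \<tau> q \<otimes>\<^bsub>SU2\<^esub> \<tau> p"
    proof (rule conj_commute[OF _ dc pc[OF p(1)] pc[OF q(1)]])
      obtain p1 where p1: "p1 \<in> loops X y" "\<tau>X p1 = inv\<^bsub>SU2\<^esub> (\<tau> d) \<otimes>\<^bsub>SU2\<^esub> \<tau> p \<otimes>\<^bsub>SU2\<^esub> \<tau> d" using moved[OF p(1)] by blast
      obtain q1 where q1: "q1 \<in> loops X y" "\<tau>X q1 = inv\<^bsub>SU2\<^esub> (\<tau> d) \<otimes>\<^bsub>SU2\<^esub> \<tau> q \<otimes>\<^bsub>SU2\<^esub> \<tau> d" using moved[OF q(1)] by blast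
      show "(inv\<^bsub>SU2\<^esub> \<tau> d \<otimes>\<^bsub>SU2\<^esub> \<tau> p \<otimes>\<^bsub>SU2\<^esub> \<tau> d) \<otimes>\<^bsub>SU2\<^esub> (inv\<^bsub>SU2\<^esub> \<tau> d \<otimes>\<^bsub>SU2\<^esub> \<tau> q \<otimes>\<^bsub>SU2\<^esub> \<tau> d) =
        (inv\<^bsub>SU2\<^esub> \<tau> d \<otimes>\<^bsub>SU2\<^esub> \<tau> q \<otimes>\<^bsub>SU2\<^esub> \<tau> d) \<otimes>\<^bsub>SU2\<^esub> (inv\<^bsub>SU2\<^esub> \<tau> d \<otimes>\<^bsub>SU2\<^esub> \<tau> p \<otimes>\<^bsub>SU2\<^esub> \<tau> d)"
        using commute_X[OF p1(1) q1(1)] unfolding p1(2) q1(2) .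
    qed
    then have "(inv\<^bsub>SU2\<^esub> (inv\<^bsub>SU2\<^esub> g0) \<otimes>\<^bsub>SU2\<^esub> \<rho> a \<otimes>\<^bsub>SU2\<^esub> inv\<^bsub>SU2\<^esub> g0) \<otimes>\<^bsub>SU2\<^esub> (inv\<^bsub>SU2\<^esub> (inv\<^bsub>SU2\<^esub> g0) \<otimes>\<^bsub>SU2\<^esub> \<rho> b \<otimes>\<^bsub>SU2\<^esub> inv\<^bsub>SU2\<^esub> g0)
      = (inv\<^bsub>SU2\<^esub> (inv\<^bsub>SU2\<^esub> g0) \<otimes>\<^bsub>SU2\<^esub> \<rho> b \<otimes>\<^bsub>SU2\<^esub> inv\<^bsub>SU2\<^esub> g0) \<otimes>\<^bsub>SU2\<^esub> (inv\<^bsub>SU2\<^esub> (inv\<^bsub>SU2\<^esub> g0) \<otimes>\<^bsub>SU2\<^esub> \<rho> a \<otimes>\<^bsub>SU2\<^esub> inv\<^bsub>SU2\<^esub> g0)"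
      unfolding \<tau>\<rho>[OF p(1)] \<tau>\<rho>[OF q(1)] p(2)[symmetric] q(2)[symmetric] SU2.inv_inv[OF g0] .
    then show "\<rho> a \<otimes>\<^bsub>SU2\<^esub> \<rho> b = \<rho> b \<otimes>\<^bsub>SU2\<^esub> \<rho> a"
      by (rule conj_commute) (use g0 hom_in_carrier[OF \<rho>] ab in simp_all)
  qed
qed

lemma boundary_diffeo_homeo:
  assumes "boundary_diffeo X A Z B f"
  shows "homeomorphic_map (subtopology X (mfd_boundary X A)) (subtopology Z (mfd_boundary Z B)) f"
    "f ` mfd_boundary X A = mfd_boundary Z B"
    "homeomorphic_map (subtopology Z (mfd_boundary Z B)) (subtopology X (mfd_boundary X A)) (inv_into (mfd_boundary X A) f)"
proof -
  let ?S = "mfd_boundary X A" and ?S' = "mfd_boundary Z B"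
  have S: "?S \<subseteq> topspace X" "?S' \<subseteq> topspace Z" by (auto simp: mfd_boundary_def)
  then have t: "topspace (subtopology X ?S) = ?S" "topspace (subtopology Z ?S') = ?S'" by (simp_all add: inf.absorb2)
  show f: "homeomorphic_map (subtopology X ?S) (subtopology Z ?S') f"
    using assms by (simp add: boundary_diffeo_def boundary_torus_def)
  show im: "f ` ?S = ?S'" using homeomorphic_imp_surjective_map[OF f] unfolding t .
  have inj: "inj_on f ?S" using homeomorphic_imp_injective_map[OF f] unfolding t .
  obtain k where k: "homeomorphic_maps (subtopology X ?S) (subtopology Z ?S') f k"
    using f unfolding homeomorphic_map_maps by blast
  have "k y = inv_into ?S f y" if y: "y \<in> ?S'" for y
  proof -
    obtain x where x: "x \<in> ?S" "y = f x" using im y by blast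
    then have "k y = x" using k t unfolding homeomorphic_maps_def by metis
    then show ?thesis using inv_into_f_f[OF inj x(1)] x(2) by simp
  qed
  then have "homeomorphic_maps (subtopology X ?S) (subtopology Z ?S') f (inv_into ?S f)"
    by (intro homeomorphic_maps_eq[OF k]) (simp_all add: t)
  then show "homeomorphic_map (subtopology Z ?S') (subtopology X ?S) (inv_into ?S f)"
    unfolding homeomorphic_map_maps using homeomorphic_maps_sym by blast
qed

theorem corollary3p11:
  fixes Y1 :: "'a topology" and A1 :: "'a chart set"
    and Y2 :: "'b topology" and A2 :: "'b chart set"
    and \<phi> :: "'a \<Rightarrow> 'b" and lam1 :: "'a set" and lam2 :: "'b set"
  assumes "compact_orientable_3manifold Y1 A1" and "torus_boundary Y1 A1"
    and "compact_orientable_3manifold Y2 A2" and "torus_boundary Y2 A2"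
    and "boundary_diffeo Y1 A1 Y2 A2 \<phi>"
    and "rational_longitude Y1 A1 lam1" and "rational_longitude Y2 A2 lam2"
    and "SU2_abelian (glue Y1 (mfd_boundary Y1 A1) \<phi> Y2)"
  shows "(\<forall>M. is_dehn_filling Y1 A1 (inv_into (mfd_boundary Y1 A1) \<phi> ` lam2) M \<longrightarrow> SU2_abelian M) \<and>
         (\<forall>M. is_dehn_filling Y2 A2 (\<phi> ` lam1) M \<longrightarrow> SU2_abelian M)"
proof -
  let ?S1 = "mfd_boundary Y1 A1" and ?S2 = "mfd_boundary Y2 A2"
  let ?\<phi>' = "inv_into ?S1 \<phi>"
  note \<phi> = boundary_diffeo_homeo[OF assms(5)]
  have S: "?S1 \<subseteq> topspace Y1" "?S2 \<subseteq> topspace Y2" by (auto simp: mfd_boundary_def)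
  have c1: "closedin Y1 ?S1" and c2: "closedin Y2 ?S2"
    using assms(1-4) by (auto intro: torus_boundary_closed simp: compact_orientable_3manifold_def)
  have patches: "convex_patches Y1" "convex_patches Y2"
    using assms(1,3) by (auto intro: convex_patches_of_atlas simp: compact_orientable_3manifold_def)
  have lpc: "locally_path_connected_space (subtopology Y1 ?S1)"
    using assms(2) homeomorphic_locally_path_connected_space locally_path_connected_torus
    unfolding torus_boundary_def boundary_torus_def by blast
  have glu: "gluing Y1 ?S1 \<phi> Y2"
    using c1 c2 \<phi>(1,2) by unfold_locales simp_all
  have commute: "(p \<in> loops Y1 x \<longrightarrow> q \<in> loops Y1 x \<longrightarrow> \<tau>1 p \<otimes>\<^bsub>SU2\<^esub> \<tau>1 q = \<tau>1 q \<otimes>\<^bsub>SU2\<^esub> \<tau>1 p) \<and>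
      (p' \<in> loops Y2 x' \<longrightarrow> q' \<in> loops Y2 x' \<longrightarrow> \<tau>2 p' \<otimes>\<^bsub>SU2\<^esub> \<tau>2 q' = \<tau>2 q' \<otimes>\<^bsub>SU2\<^esub> \<tau>2 p')"
    if t: "path_transport SU2 Y1 \<tau>1" "path_transport SU2 Y2 \<tau>2"
      "\<And>p. pathin (subtopology Y1 ?S1) p \<Longrightarrow> \<tau>1 p = \<tau>2 (\<phi> \<circ> p)" for \<tau>1 \<tau>2 x p q x' p' q'
  proof -
    interpret Gl: glued_transports SU2 Y1 ?S1 \<phi> Y2 \<tau>1 \<tau>2
      by (intro glued_transports.intro group_SU2 glu glued_transports_axioms.intro t patches lpc)
    note ab = SU2_abelian_transport[OF assms(8) Gl.glued_transport(1)]
    have l: "Gl.inl \<circ> p \<in> loops Gl.Y (Gl.inl x)" if "p \<in> loops Y1 x" for p x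
      using that pathin_compose[OF _ Gl.continuous_inl] by (simp add: loops_def)
    have r: "Gl.inr \<circ> p \<in> loops Gl.Y (Gl.inr x)" if "p \<in> loops Y2 x" for p x
      using that pathin_compose[OF _ Gl.continuous_inr] by (simp add: loops_def)
    have vl: "Gl.flat.holonomy (Gl.inl \<circ> p) = \<tau>1 p" if "p \<in> loops Y1 x" for p x
      using that Gl.glued_transport(2) by (simp add: loops_def)
    have vr: "Gl.flat.holonomy (Gl.inr \<circ> p) = \<tau>2 p" if "p \<in> loops Y2 x" for p x
      using that Gl.glued_transport(3) by (simp add: loops_def)
    show ?thesis
      using ab[OF l l] ab[OF r r] vl vr by metis
  qed
  have lam2: "torsion_curve Y2 (subtopology Y2 ?S2) lam2" "lam2 \<subseteq> ?S2"
    "\<And>C'. is_slope (subtopology Y2 ?S2) C' \<Longrightarrow> torsion_curve Y2 (subtopology Y2 ?S2) C' \<Longrightarrow> isotopic_curves (subtopology Y2 ?S2) lam2 C'"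
    using assms(7) S(2)
    by (auto simp: rational_longitude_def boundary_torus_def is_slope_def simple_closed_param_def continuous_map_def)
  have lam1: "torsion_curve Y1 (subtopology Y1 ?S1) lam1" "lam1 \<subseteq> ?S1"
    "\<And>C'. is_slope (subtopology Y1 ?S1) C' \<Longrightarrow> torsion_curve Y1 (subtopology Y1 ?S1) C' \<Longrightarrow> isotopic_curves (subtopology Y1 ?S1) lam1 C'"
    using assms(6) S(1)
    by (auto simp: rational_longitude_def boundary_torus_def is_slope_def simple_closed_param_def continuous_map_def)
  have inj: "inj_on \<phi> ?S1" using homeomorphic_imp_injective_map[OF \<phi>(1)] S(1) by (simp add: inf.absorb2)
  have e2: "\<phi> ` ?\<phi>' ` lam2 = lam2"
    by (rule image_inv_into_cancel[OF \<phi>(2) lam2(2)])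
  have e1: "?\<phi>' ` \<phi> ` lam1 = lam1"
    by (rule inv_into_image_cancel[OF inj lam1(2)])
  have "SU2_abelian M" if M: "is_dehn_filling Y1 A1 (?\<phi>' ` lam2) M" for M
  proof -
    obtain \<psi> where \<psi>: "homeomorphic_map (top_of_set torus) (subtopology Y1 ?S1) \<psi>" "\<psi> ` ({1} \<times> circle) = ?\<phi>' ` lam2"
      "M = glue (top_of_set solid_torus) torus \<psi> Y1"
      using M unfolding is_dehn_filling_def boundary_torus_def by blast
    show ?thesis
      unfolding \<psi>(3)
    proof (rule filling_SU2_abelian[OF c1 \<psi>(1) \<phi>(1) S(2)], unfold \<psi>(2) e2)
      show "torsion_curve Y2 (subtopology Y2 ?S2) lam2" by (rule lam2(1))
    qed (use lam2(3) commute in blast)+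
  qed
  moreover have "SU2_abelian M" if M: "is_dehn_filling Y2 A2 (\<phi> ` lam1) M" for M
  proof -
    obtain \<psi> where \<psi>: "homeomorphic_map (top_of_set torus) (subtopology Y2 ?S2) \<psi>" "\<psi> ` ({1} \<times> circle) = \<phi> ` lam1"
      "M = glue (top_of_set solid_torus) torus \<psi> Y2"
      using M unfolding is_dehn_filling_def boundary_torus_def by blast
    show ?thesis
      unfolding \<psi>(3)
    proof (rule filling_SU2_abelian[OF c2 \<psi>(1) \<phi>(3) S(1)], unfold \<psi>(2) e1)
      show "torsion_curve Y1 (subtopology Y1 ?S1) lam1" by (rule lam1(1))
      show "isotopic_curves (subtopology Y1 ?S1) lam1 C'"
        if "is_slope (subtopology Y1 ?S1) C'" "torsion_curve Y1 (subtopology Y1 ?S1) C'" for C' by (rule lam1(3)[OF that])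
      fix \<tau>2 \<tau>1 x p q
      assume t: "path_transport SU2 Y2 \<tau>2" "path_transport SU2 Y1 \<tau>1"
        "\<And>p. pathin (subtopology Y2 ?S2) p \<Longrightarrow> \<tau>2 p = \<tau>1 (?\<phi>' \<circ> p)" "p \<in> loops Y2 x" "q \<in> loops Y2 x"
      have "\<tau>1 r = \<tau>2 (\<phi> \<circ> r)" if r: "pathin (subtopology Y1 ?S1) r" for r
      proof -
        have "\<tau>2 (\<phi> \<circ> r) = \<tau>1 (?\<phi>' \<circ> (\<phi> \<circ> r))"
          by (rule t(3)[OF pathin_compose[OF r homeomorphic_imp_continuous_map[OF \<phi>(1)]]])
        also have "\<dots> = \<tau>1 r"
          by (rule transport_cong[OF t(2)]) (use r inj in \<open>auto simp: pathin_subtopology\<close>)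
        finally show ?thesis by simp
      qed
      then show "\<tau>2 p \<otimes>\<^bsub>SU2\<^esub> \<tau>2 q = \<tau>2 q \<otimes>\<^bsub>SU2\<^esub> \<tau>2 p"
        using commute[OF t(2,1)] t(4,5) by blast
    qed
  qed
  ultimately show ?thesis by blast
qed

end
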